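(* Let $(M,g)$ be an $n$-dimensional Riemannian manifold, $n\ge3$. Let $p\in M$, and suppose that in an open neighbourhood of $p$ the conformal class $[g]$ admits $m$ different orthogonal limiting Carleman weights (LCWs) $\varphi_1,\dots,\varphi_m$. Then there are local coordinates $\Phi=(z_1,\dots,z_n)$ near $p$ such that 1. $z_1=\varphi_1,\dots,z_m=\varphi_m$; 2. some conformal multiple of $g$ has the local expression $$\begin{pmatrix}1&0&\cdots&0&0\\0&f_2(z_{m+1},\dots,z_n)&\cdots&0&0\\ \vdots&&\ddots&&\vdots\\0&0&\cdots&f_m(z_{m+1},\dots,z_n)&0\\0&0&\cdots&0&D(z_{m+1},\dots,z_n)\end{pmatrix},$$ where $D$ is an $(n-m)\times(n-m)$ symmetric matrix (the functions $f_j$ and the matrix $D$ depend only on $z_{m+1},\dots,z_n$). Conversely, if in some local coordinates $(z_1,\dots,z_n)$ the metric $g$ has, up to a conformal multiple, the block-diagonal form $$\begin{pmatrix}1&0&\cdots&0&0\\0&f_2(z_{m+1},\dots,z_n)&\cdots&0&0\\ \vdots&&\ddots&&\vdots\\0&0&\cdots&f_m(z_{m+1},\dots,z_n)&0\\0&0&\cdots&0&D(z_{m+1},\dots,z_n)\end{pmatrix}$$ with functions $f_2,\dots,f_m$ and an $(n-m)\times(n-m)$ symmetric matrix $D$ depending only on $z_{m+1},\dots,z_n$, then $z_1,\dots,z_m$ are orthogonal LCWs.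
   Context: Limiting Carleman weight (LCW): a real-valued $\varphi\in C^\infty(U)$ on a Riemannian manifold $(U,g)$ of dimension $n\geq 3$ with $d\varphi\neq0$ everywhere and such that $\mathrm{Hess}_g\varphi(\nabla\varphi,\nabla\varphi)+\mathrm{Hess}_g\varphi(V,V)=0$ at every point $p$ and for every $V\in T_pU$ with $|V|=|\nabla\varphi|$, $\langle V,\nabla\varphi\rangle=0$. Equivalently, $d\varphi\ne0$ everywhere and $|\nabla\varphi|^{-2}\nabla\varphi$ is a conformal Killing vector field. This notion depends only on the conformal class $[g]$ (metrics $cg$ with $c$ a smooth positive function). LCWs $\varphi_1,\dots,\varphi_m$ are called orthogonal if their gradients are pairwise orthogonal at each point. *)

theory Defs
  imports "HOL-Analysis.Analysis"
begin

section \<open>Smooth functions on open subsets of Euclidean space\<close>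

text \<open>\<open>Ck_on k f S\<close> is meant for open \<open>S\<close>: all iterated directional derivatives of \<open>f\<close> of order
  less than \<open>k\<close> are (Frechet) differentiable on \<open>S\<close>, and those of order \<open>k\<close> are continuous.\<close>

fun Ck_on :: "nat \<Rightarrow> ('a::real_normed_vector \<Rightarrow> 'b::real_normed_vector) \<Rightarrow> 'a set \<Rightarrow> bool" where
  "Ck_on 0 f S \<longleftrightarrow> continuous_on S f"
| "Ck_on (Suc k) f S \<longleftrightarrow>
     (\<forall>x\<in>S. f differentiable (at x)) \<and> (\<forall>v. Ck_on k (\<lambda>x. frechet_derivative f (at x) v) S)"

definition smooth_on :: "('a::real_normed_vector \<Rightarrow> 'b::real_normed_vector) \<Rightarrow> 'a set \<Rightarrow> bool" where
  "smooth_on f S \<longleftrightarrow> (\<forall>k. Ck_on k f S)"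

definition partial :: "'n \<Rightarrow> (real^'n \<Rightarrow> real) \<Rightarrow> real^'n \<Rightarrow> real" where
  "partial i F x = frechet_derivative F (at x) (axis i 1)"

section \<open>Smooth manifolds\<close>

text \<open>A chart is a pair of a domain and a coordinate map; the values of the coordinate map outside
  the domain are irrelevant. The dimension of the manifold is \<open>CARD('n)\<close>.\<close>

type_synonym ('a, 'n) chart = "'a set \<times> ('a \<Rightarrow> real^'n)"

definition is_chart :: "'a topology \<Rightarrow> ('a, 'n::finite) chart \<Rightarrow> bool" where
  "is_chart X = (\<lambda>(U, \<psi>). openin X U \<and> open (\<psi> ` U) \<and>
     homeomorphic_map (subtopology X U) (top_of_set (\<psi> ` U)) \<psi>)"

definition in_chart :: "('a, 'n::finite) chart \<Rightarrow> ('a \<Rightarrow> 'b) \<Rightarrow> real^'n \<Rightarrow> 'b" where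
  "in_chart = (\<lambda>(U, \<psi>) f x. f (inv_into U \<psi> x))"

definition smooth_compatible :: "('a, 'n::finite) chart \<Rightarrow> ('a, 'n) chart \<Rightarrow> bool" where
  "smooth_compatible = (\<lambda>(U, \<psi>) (V, \<eta>).
     smooth_on (in_chart (U, \<psi>) \<eta>) (\<psi> ` (U \<inter> V)) \<and>
     smooth_on (in_chart (V, \<eta>) \<psi>) (\<eta> ` (U \<inter> V)))"

text \<open>\<open>A\<close> is a maximal smooth atlas, so that local coordinates are precisely the members of \<open>A\<close>.\<close>

definition smooth_manifold :: "'a topology \<Rightarrow> ('a, 'n::finite) chart set \<Rightarrow> bool" where
  "smooth_manifold X A \<longleftrightarrow>
     Hausdorff_space X \<and> second_countable X \<and>
     (\<forall>c\<in>A. is_chart X c) \<and> (\<Union>(fst ` A)) = topspace X \<and>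
     (\<forall>c\<in>A. \<forall>c'\<in>A. smooth_compatible c c') \<and>
     (\<forall>c. is_chart X c \<and> (\<forall>c'\<in>A. smooth_compatible c c') \<longrightarrow> c \<in> A)"

definition smooth_fun_on :: "('a, 'n::finite) chart set \<Rightarrow> 'a set \<Rightarrow> ('a \<Rightarrow> real) \<Rightarrow> bool" where
  "smooth_fun_on A W f \<longleftrightarrow> (\<forall>(U, \<psi>)\<in>A. smooth_on (in_chart (U, \<psi>) f) (\<psi> ` (U \<inter> W)))"

section \<open>Riemannian metrics\<close>

text \<open>A metric is given by its matrices \<open>g c q\<close> with respect to the coordinate frames of the charts
  \<open>c \<in> A\<close> at the points \<open>q\<close> of their domains; these transform as a covariant 2-tensor.\<close>

type_synonym ('a, 'n) metric = "('a, 'n) chart \<Rightarrow> 'a \<Rightarrow> real^'n^'n"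

definition jacobian_at :: "('a, 'n::finite) chart \<Rightarrow> ('a, 'n) chart \<Rightarrow> 'a \<Rightarrow> real^'n^'n" where
  "jacobian_at c c' q = matrix (frechet_derivative (in_chart c (snd c')) (at (snd c q)))"

definition riemannian_metric :: "('a, 'n::finite) chart set \<Rightarrow> ('a, 'n) metric \<Rightarrow> bool" where
  "riemannian_metric A g \<longleftrightarrow>
     (\<forall>c\<in>A. smooth_on (in_chart c (g c)) (snd c ` fst c)) \<and>
     (\<forall>c\<in>A. \<forall>q\<in>fst c. transpose (g c q) = g c q \<and> (\<forall>v. v \<noteq> 0 \<longrightarrow> v \<bullet> (g c q *v v) > 0)) \<and>
     (\<forall>c\<in>A. \<forall>c'\<in>A. \<forall>q\<in>fst c \<inter> fst c'.
        g c q = transpose (jacobian_at c c' q) ** g c' q ** jacobian_at c c' q)"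

definition riemannian_manifold ::
  "'a topology \<Rightarrow> ('a, 'n::finite) chart set \<Rightarrow> ('a, 'n) metric \<Rightarrow> bool" where
  "riemannian_manifold X A g \<longleftrightarrow> smooth_manifold X A \<and> riemannian_metric A g"

text \<open>Below, tangent vectors at \<open>q\<close> are represented by their components in the chart \<open>c\<close>.\<close>

definition g_inner :: "('a, 'n::finite) metric \<Rightarrow> ('a, 'n) chart \<Rightarrow> 'a \<Rightarrow> real^'n \<Rightarrow> real^'n \<Rightarrow> real" where
  "g_inner g c q v w = v \<bullet> (g c q *v w)"

definition g_norm :: "('a, 'n::finite) metric \<Rightarrow> ('a, 'n) chart \<Rightarrow> 'a \<Rightarrow> real^'n \<Rightarrow> real" where
  "g_norm g c q v = sqrt (g_inner g c q v v)"

definition differential :: "('a, 'n::finite) chart \<Rightarrow> ('a \<Rightarrow> real) \<Rightarrow> 'a \<Rightarrow> real^'n" where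
  "differential c f q = (\<chi> i. partial i (in_chart c f) (snd c q))"

definition grad ::
  "('a, 'n::finite) metric \<Rightarrow> ('a, 'n) chart \<Rightarrow> ('a \<Rightarrow> real) \<Rightarrow> 'a \<Rightarrow> real^'n" where
  "grad g c f q = matrix_inv (g c q) *v differential c f q"

text \<open>\<open>christoffel g c q k i j\<close> is the Christoffel symbol with upper index \<open>k\<close> and lower indices
  \<open>i\<close>, \<open>j\<close>.\<close>

definition christoffel ::
  "('a, 'n::finite) metric \<Rightarrow> ('a, 'n) chart \<Rightarrow> 'a \<Rightarrow> 'n \<Rightarrow> 'n \<Rightarrow> 'n \<Rightarrow> real" where
  "christoffel g c q k i j =
     (let dg = (\<lambda>l a b. partial l (in_chart c (\<lambda>r. g c r $ a $ b)) (snd c q))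
      in (1/2) * (\<Sum>l\<in>UNIV. matrix_inv (g c q) $ k $ l * (dg i j l + dg j i l - dg l i j)))"

definition hess ::
  "('a, 'n::finite) metric \<Rightarrow> ('a, 'n) chart \<Rightarrow> ('a \<Rightarrow> real) \<Rightarrow> 'a \<Rightarrow> real^'n \<Rightarrow> real^'n \<Rightarrow> real" where
  "hess g c f q v w =
     (\<Sum>i\<in>UNIV. \<Sum>j\<in>UNIV. v $ i * w $ j *
        (partial i (partial j (in_chart c f)) (snd c q)
         - (\<Sum>k\<in>UNIV. christoffel g c q k i j * differential c f q $ k)))"

section \<open>Limiting Carleman weights\<close>

definition LCW :: "('a, 'n::finite) chart set \<Rightarrow> ('a, 'n) metric \<Rightarrow> 'a set \<Rightarrow> ('a \<Rightarrow> real) \<Rightarrow> bool" where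
  "LCW A g U \<phi> \<longleftrightarrow> smooth_fun_on A U \<phi> \<and>
     (\<forall>c\<in>A. \<forall>q\<in>U \<inter> fst c. differential c \<phi> q \<noteq> 0 \<and>
        (\<forall>v. g_norm g c q v = g_norm g c q (grad g c \<phi> q) \<and> g_inner g c q v (grad g c \<phi> q) = 0 \<longrightarrow>
           hess g c \<phi> q (grad g c \<phi> q) (grad g c \<phi> q) + hess g c \<phi> q v v = 0))"

definition orthogonal_LCWs ::
  "('a, 'n::finite) chart set \<Rightarrow> ('a, 'n) metric \<Rightarrow> 'a set \<Rightarrow> nat \<Rightarrow> (nat \<Rightarrow> 'a \<Rightarrow> real) \<Rightarrow> bool" where
  "orthogonal_LCWs A g U m \<phi> \<longleftrightarrow>
     (\<forall>i\<in>{1..m}. LCW A g U (\<phi> i)) \<and>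
     (\<forall>i\<in>{1..m}. \<forall>j\<in>{1..m}. i \<noteq> j \<longrightarrow>
        (\<forall>c\<in>A. \<forall>q\<in>U \<inter> fst c. g_inner g c q (grad g c (\<phi> i) q) (grad g c (\<phi> j) q) = 0))"

section \<open>The local normal form\<close>

text \<open>The index type \<open>'n\<close> carries no order; \<open>e\<close>, a bijection from \<open>{1..CARD('n)}\<close> to it, numbers
  the coordinates.\<close>

definition coord :: "(nat \<Rightarrow> 'n::finite) \<Rightarrow> ('a \<Rightarrow> real^'n) \<Rightarrow> nat \<Rightarrow> 'a \<Rightarrow> real" where
  "coord e \<Phi> i q = \<Phi> q $ e i"

text \<open>The tuple of the last coordinates, from the \<open>(m+1)\<close>-st on (it is constant if
  \<open>m = CARD('n)\<close>).\<close>

definition tail_coords :: "(nat \<Rightarrow> 'n::finite) \<Rightarrow> nat \<Rightarrow> ('a \<Rightarrow> real^'n) \<Rightarrow> 'a \<Rightarrow> nat \<Rightarrow> real" where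
  "tail_coords e m \<Phi> q = restrict (\<lambda>k. coord e \<Phi> k q) {m+1..CARD('n)}"

text \<open>\<open>G\<close> is the block matrix with diagonal entries \<open>1, f 2, \<dots>, f m\<close> followed by the symmetric
  block \<open>D\<close>, whose entries are indexed by \<open>{m+1..CARD('n)}\<close>.\<close>

definition block_matrix ::
  "(nat \<Rightarrow> 'n::finite) \<Rightarrow> nat \<Rightarrow> (nat \<Rightarrow> real) \<Rightarrow> (nat \<Rightarrow> nat \<Rightarrow> real) \<Rightarrow> real^'n^'n \<Rightarrow> bool" where
  "block_matrix e m f D G \<longleftrightarrow>
     (\<forall>i\<in>{m+1..CARD('n)}. \<forall>j\<in>{m+1..CARD('n)}. D i j = D j i) \<and>
     (\<forall>i\<in>{1..CARD('n)}. \<forall>j\<in>{1..CARD('n)}. G $ e i $ e j =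
        (if m < i \<and> m < j then D i j
         else if i \<noteq> j then 0
         else if i = 1 then 1
         else f i))"

definition conformal_block_form ::
  "('a, 'n::finite) chart set \<Rightarrow> ('a, 'n) metric \<Rightarrow> (nat \<Rightarrow> 'n) \<Rightarrow> nat \<Rightarrow> ('a, 'n) chart \<Rightarrow> bool" where
  "conformal_block_form A g e m = (\<lambda>(V, \<Phi>).
     \<exists>(\<mu> :: 'a \<Rightarrow> real) (f :: nat \<Rightarrow> (nat \<Rightarrow> real) \<Rightarrow> real) (D :: (nat \<Rightarrow> real) \<Rightarrow> nat \<Rightarrow> nat \<Rightarrow> real).
       smooth_fun_on A V \<mu> \<and> (\<forall>q\<in>V. \<mu> q > 0) \<and>
       (\<forall>q\<in>V. block_matrix e m (\<lambda>j. f j (tail_coords e m \<Phi> q)) (D (tail_coords e m \<Phi> q))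
                 (\<mu> q *\<^sub>R g (V, \<Phi>) q)))"

end

theory Submission
  imports Defs
begin

text \<open>Let \<open>X\<^sub>i\<close> be the field \<open>grad \<phi>\<^sub>i / |grad \<phi>\<^sub>i|\<^sup>2\<close>. Since twice the Hessian of \<open>\<phi>\<^sub>i\<close> is the Lie
  derivative of the metric along \<open>grad \<phi>\<^sub>i\<close>, the function \<open>\<phi>\<^sub>i\<close> is a limiting Carleman weight iff
  \<open>X\<^sub>i\<close> is conformal Killing. For orthogonal weights the Lie derivative along \<open>X\<^sub>i\<close> of the 1-form dual
  to \<open>X\<^sub>j\<close>, which is a multiple of \<open>d\<phi>\<^sub>j\<close>, is again a multiple of \<open>d\<phi>\<^sub>j\<close>; hence \<open>[X\<^sub>i, X\<^sub>j]\<close> is a multiple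
  of \<open>X\<^sub>j\<close>, by antisymmetry also of \<open>X\<^sub>i\<close>, and so vanishes. In coordinates that straighten the
  commuting fields and have \<open>z\<^sub>i = \<phi>\<^sub>i\<close>, the metric is block diagonal. After rescaling so that
  \<open>|X\<^sub>1| = 1\<close> the fields \<open>X\<^sub>i\<close> are Killing, because they are conformal Killing and commute with the
  unit field \<open>X\<^sub>1\<close>; so the coefficients do not depend on \<open>z\<^sub>1, \<dots>, z\<^sub>m\<close>. Conversely, for a metric in
  the normal form \<open>X\<^sub>i\<close> is the coordinate field of \<open>z\<^sub>i\<close>, which is Killing for the rescaled metric.

  The straightening coordinates are the time-one map of a parametrised ordinary differential
  equation. That its solution is \<open>C\<^sup>k\<close> in the parameters is an induction over \<open>k\<close> for all equations at
  once, because the derivatives of the solution solve an equation of the same type.\<close>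

section \<open>Calculus of smooth functions\<close>

text \<open>The regularity of the straightening chart is the obstacle, and it fixes the constants.
  Every equation lives on the times between -2 and 2, so that the time 1 is interior, and has
  Lipschitz constant 1/4 in the state: a Picard step contracts by 2 * 1/4 = 1/2, and the maximum of
  the unknown can be absorbed in place of an exponential Gronwall bound. Linearising preserves the
  constant 1/4, so this class of equations is closed under differentiation. The flow equation enters
  the class because its coefficients \<open>c k z\<close> vanish at the centre \<open>z0\<close>:
  the parameters are shrunk, not the time.

  The geometry is done with matrix-valued functions on open subsets of Euclidean space.
  \<open>lie\<close> is natural for fields related by a map (\<open>lie_pullback\<close>), so
  Killing and conformal Killing conditions pass between a given chart and the new coordinates
  without Christoffel symbols of the latter. The conformal factor is |grad \<phi>_1|^2, as the field
  of \<phi>_1 has squared length 1/|grad \<phi>_1|^2; the diagonal entries become |grad \<phi>_1|^2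
  / |grad \<phi>_j|^2, which is 1 for j = 1.\<close>

abbreviation FD :: "('a::real_normed_vector \<Rightarrow> 'b::real_normed_vector) \<Rightarrow> 'a \<Rightarrow> 'a \<Rightarrow> 'b" where
  "FD f x \<equiv> frechet_derivative f (at x)"

lemma linear_basis_expansion:
  fixes L :: "'a::euclidean_space \<Rightarrow> 'b::real_vector"
  assumes "linear L"
  shows "L v = (\<Sum>b\<in>Basis. (v \<bullet> b) *\<^sub>R L b)"
  using linear_sum[OF assms, of "\<lambda>b. (v \<bullet> b) *\<^sub>R b" Basis] linear_cmul[OF assms]
  by (simp add: euclidean_representation)

lemma linear_norm_le_basis:
  fixes L :: "'a::euclidean_space \<Rightarrow> 'b::real_normed_vector"
  assumes "linear L"
  shows "norm (L v) \<le> norm v * (\<Sum>b\<in>Basis. norm (L b))"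
  unfolding linear_basis_expansion[OF assms, of v] sum_distrib_left
  by (rule sum_norm_le) (simp add: Basis_le_norm mult_right_mono)

text \<open>\<open>Ck_on\<close> speaks of the derivative chosen by
  \<open>frechet_derivative\<close>; this rule accepts any explicit derivative instead. The two
  agree only on \<open>S\<close>, so a congruence on open sets is called for; its induction is
  carried out inside because \<open>Ck_on_cong\<close> itself rests on this rule.\<close>

lemma Ck_on_SucI:
  assumes "open S" "\<And>x. x \<in> S \<Longrightarrow> (f has_derivative f' x) (at x)"
    and "\<And>v. Ck_on k (\<lambda>x. f' x v) S"
  shows "Ck_on (Suc k) f S"
proof -
  have eq: "FD f x = f' x" if "x \<in> S" for x
    using assms(2)[OF that] frechet_derivative_at by metis
  have cong: "Ck_on k g S" if "\<And>x. x \<in> S \<Longrightarrow> h x = g x" "Ck_on k h S" for g h :: "'a \<Rightarrow> 'b"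
    using that
  proof (induction k arbitrary: g h)
    case 0
    then show ?case using continuous_on_cong[of S S h g] by simp
  next
    case (Suc k)
    have d: "(g has_derivative FD h x) (at x)" if "x \<in> S" for x
      using Suc.prems that assms(1)
      by (auto intro: has_derivative_transform_within_open[where s=S] simp: frechet_derivative_works)
    have "FD h x v = FD g x v" if "x \<in> S" for x v
      using frechet_derivative_at[OF d[OF that]] by simp
    then have "Ck_on k (\<lambda>x. FD g x v) S" for v
      by (rule Suc.IH) (use Suc.prems(2) in auto)
    moreover have "\<forall>x\<in>S. g differentiable (at x)"
      using d differentiable_def by blast
    ultimately show ?case by simp
  qed
  have "\<And>v. Ck_on k (\<lambda>x. FD f x v) S"
    by (rule cong[OF _ assms(3)]) (simp add: eq)
  then show ?thesis
    using assms(2) unfolding Ck_on.simps differentiable_def by blast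
qed

lemma Ck_on_has_derivative:
  "Ck_on (Suc k) f S \<Longrightarrow> x \<in> S \<Longrightarrow> (f has_derivative FD f x) (at x)"
  by (simp add: frechet_derivative_works)

lemma Ck_on_frechet_derivative:
  "Ck_on (Suc k) f S \<Longrightarrow> Ck_on k (\<lambda>x. FD f x v) S"
  by simp

lemma Ck_on_cong:
  assumes "open S" "\<And>x. x \<in> S \<Longrightarrow> f x = g x" "Ck_on k f S"
  shows "Ck_on k g S"
proof (cases k)
  case 0
  then show ?thesis using assms continuous_on_cong[of S S f g] by simp
next
  case (Suc l)
  show ?thesis unfolding Suc
  proof (rule Ck_on_SucI[OF assms(1)])
    show "(g has_derivative FD f x) (at x)" if "x \<in> S" for x
      using assms that Suc
      by (auto intro: has_derivative_transform_within_open[where s=S] simp: frechet_derivative_works)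
    show "Ck_on l (\<lambda>x. FD f x v) S" for v
      using assms(3) Suc by simp
  qed
qed

lemma Ck_on_imp_continuous_on: "Ck_on k f S \<Longrightarrow> continuous_on S f"
  by (cases k) (auto intro!: continuous_at_imp_continuous_on differentiable_imp_continuous_within)

lemma Ck_on_lower: "Ck_on (Suc k) f S \<Longrightarrow> Ck_on k f S"
proof (induction k arbitrary: f)
  case 0
  then show ?case using Ck_on_imp_continuous_on[OF 0] by simp
qed auto

lemma Ck_on_le: "Ck_on k f S \<Longrightarrow> j \<le> k \<Longrightarrow> Ck_on j f S"
  by (induction k) (auto simp: le_Suc_eq simp del: Ck_on.simps dest: Ck_on_lower)

lemma Ck_on_subset: "Ck_on k f S \<Longrightarrow> T \<subseteq> S \<Longrightarrow> Ck_on k f T"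
  by (induction k arbitrary: f) (auto intro: continuous_on_subset)

lemma Ck_on_const: "open S \<Longrightarrow> Ck_on k (\<lambda>x. c) S"
proof (induction k arbitrary: c)
  case (Suc k)
  show ?case by (rule Ck_on_SucI[OF Suc.prems has_derivative_const Suc.IH[OF Suc.prems]])
qed simp

lemma Ck_on_bounded_linear:
  assumes "open S" "bounded_linear f" shows "Ck_on k f S"
proof (cases k)
  case 0
  then show ?thesis using assms bounded_linear.linear linear_continuous_on by auto
next
  case (Suc l)
  then show ?thesis
    using assms Ck_on_SucI[of S f "\<lambda>x. f" l] by (simp add: Ck_on_const bounded_linear_imp_has_derivative)
qed

lemma Ck_on_linear_compose:
  assumes "open S" "bounded_linear L" "Ck_on k f S"
  shows "Ck_on k (\<lambda>x. L (f x)) S"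
  using assms(3)
proof (induction k arbitrary: f)
  case 0
  then show ?case using bounded_linear.continuous_on[OF assms(2)] by auto
next
  case (Suc k)
  show ?case
    by (rule Ck_on_SucI[OF assms(1) bounded_linear.has_derivative[OF assms(2) Ck_on_has_derivative[OF Suc.prems]]])
      (auto intro!: Suc.IH Ck_on_frechet_derivative[OF Suc.prems])
qed

lemma Ck_on_add:
  assumes "open S" "Ck_on k f S" "Ck_on k g S"
  shows "Ck_on k (\<lambda>x. f x + g x) S"
  using assms(2,3)
proof (induction k arbitrary: f g)
  case 0
  then show ?case by (auto intro: continuous_intros)
next
  case (Suc k)
  show ?case
    by (rule Ck_on_SucI[OF assms(1) has_derivative_add[OF Ck_on_has_derivative[OF Suc.prems(1)]
            Ck_on_has_derivative[OF Suc.prems(2)]]])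
      (auto intro!: Suc.IH Ck_on_frechet_derivative Suc.prems)
qed

lemma Ck_on_bilinear:
  assumes "open S" "bounded_bilinear B" "Ck_on k f S" "Ck_on k g S"
  shows "Ck_on k (\<lambda>x. B (f x) (g x)) S"
  using assms(3,4)
proof (induction k arbitrary: f g)
  case 0
  then show ?case using bounded_bilinear.continuous_on[OF assms(2)] by auto
next
  case (Suc k)
  show ?case
    by (rule Ck_on_SucI[OF assms(1) bounded_bilinear.FDERIV[OF assms(2)
            Ck_on_has_derivative[OF Suc.prems(1)] Ck_on_has_derivative[OF Suc.prems(2)]]])
      (auto intro!: Suc.IH Ck_on_add assms(1) Ck_on_frechet_derivative Suc.prems Ck_on_lower[OF Suc.prems(1)]
         Ck_on_lower[OF Suc.prems(2)])
qed

lemmas Ck_on_scaleR = Ck_on_bilinear[OF _ bounded_bilinear_scaleR]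
lemmas Ck_on_mult = Ck_on_bilinear[OF _ bounded_bilinear_mult]
lemmas Ck_on_inner = Ck_on_bilinear[OF _ bounded_bilinear_inner]

lemma Ck_on_minus: "open S \<Longrightarrow> Ck_on k f S \<Longrightarrow> Ck_on k (\<lambda>x. - f x) S"
  by (rule Ck_on_linear_compose) (auto intro: bounded_linear_minus bounded_linear_ident)

lemma Ck_on_diff: "open S \<Longrightarrow> Ck_on k f S \<Longrightarrow> Ck_on k g S \<Longrightarrow> Ck_on k (\<lambda>x. f x - g x) S"
  using Ck_on_add[OF _ _ Ck_on_minus, of S k f g] by simp

lemma Ck_on_sum:
  assumes "open S" "\<And>i. i \<in> I \<Longrightarrow> Ck_on k (f i) S"
  shows "Ck_on k (\<lambda>x. \<Sum>i\<in>I. f i x) S"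
  using assms(2) by (induction I rule: infinite_finite_induct) (auto intro: Ck_on_const Ck_on_add assms(1))

lemma Ck_on_prod:
  fixes f :: "'i \<Rightarrow> 'a::real_normed_vector \<Rightarrow> real"
  assumes "open S" "\<And>i. i \<in> I \<Longrightarrow> Ck_on k (f i) S"
  shows "Ck_on k (\<lambda>x. \<Prod>i\<in>I. f i x) S"
  using assms(2) by (induction I rule: infinite_finite_induct) (auto intro: Ck_on_const Ck_on_mult assms(1))

lemma Ck_on_compose:
  fixes f :: "'b::euclidean_space \<Rightarrow> 'c::real_normed_vector"
  assumes "open S" "open T" "g ` S \<subseteq> T" "Ck_on k g S" "Ck_on k f T"
  shows "Ck_on k (\<lambda>x. f (g x)) S"
  using assms(4,5)
proof (induction k arbitrary: f)
  case 0
  then show ?case using continuous_on_compose2[of T f S g] assms(3) by auto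
next
  case (Suc k)
  \<comment> \<open>The chain rule applies the derivative of \<open>f\<close> to a moving direction.
    Expanding that direction in \<open>Basis\<close> leaves products of scalar functions with
    \<open>FD f (g x) b\<close> for fixed \<open>b\<close>, to which the induction hypothesis
    applies.\<close>
  let ?f' = "\<lambda>x v. \<Sum>b\<in>Basis. (FD g x v \<bullet> b) *\<^sub>R FD f (g x) b"
  show ?case
  proof (rule Ck_on_SucI[OF assms(1), where f'="?f'"])
    fix x assume x: "x \<in> S"
    have df: "(f has_derivative FD f (g x)) (at (g x))"
      using Ck_on_has_derivative[OF Suc.prems(2)] assms(3) x by blast
    have A: "((\<lambda>x. f (g x)) has_derivative (\<lambda>v. FD f (g x) (FD g x v))) (at x)"
      using diff_chain_at[OF Ck_on_has_derivative[OF Suc.prems(1) x] df] by (simp add: o_def)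
    have B: "FD f (g x) w = (\<Sum>b\<in>Basis. (w \<bullet> b) *\<^sub>R FD f (g x) b)" for w
      by (rule linear_basis_expansion[OF has_derivative_linear[OF df]])
    show "((\<lambda>x. f (g x)) has_derivative ?f' x) (at x)"
      by (rule has_derivative_eq_rhs[OF A]) (rule ext, rule B)
  next
    fix v
    show "Ck_on k (\<lambda>x. ?f' x v) S"
      by (intro Ck_on_sum assms(1) Ck_on_scaleR Ck_on_inner Ck_on_const Suc.IH
          Ck_on_frechet_derivative[OF Suc.prems(1)] Ck_on_frechet_derivative[OF Suc.prems(2)] Ck_on_lower[OF Suc.prems(1)])
  qed
qed

lemma Ck_on_inverse:
  fixes f :: "'a::real_normed_vector \<Rightarrow> real"
  assumes "open S" "Ck_on k f S" "\<And>x. x \<in> S \<Longrightarrow> f x \<noteq> 0"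
  shows "Ck_on k (\<lambda>x. inverse (f x)) S"
  using assms(2)
proof (induction k)
  case 0
  then show ?case using assms(3) by (auto intro: continuous_intros)
next
  case (Suc k)
  have "((\<lambda>x. inverse (f x)) has_derivative (\<lambda>v. - (inverse (f x) * FD f x v * inverse (f x)))) (at x)"
    if "x \<in> S" for x
    using Ck_on_has_derivative[OF Suc.prems that] assms(3)[OF that] by (auto intro: derivative_intros)
  then show ?case
    by (rule Ck_on_SucI[OF assms(1)]) (auto intro!: Ck_on_minus Ck_on_mult assms(1) Ck_on_frechet_derivative[OF Suc.prems]
        Suc.IH Ck_on_lower[OF Suc.prems])
qed

lemma Ck_on_Pair:
  assumes "open S" "Ck_on k f S" "Ck_on k g S"
  shows "Ck_on k (\<lambda>x. (f x, g x)) S"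
proof -
  have "Ck_on k (\<lambda>x. (f x, 0) + (0, g x)) S"
    by (intro Ck_on_add assms Ck_on_linear_compose[of S "\<lambda>y. (y, 0)"] Ck_on_linear_compose[of S "\<lambda>y. (0, y)"]
        bounded_linear_Pair bounded_linear_zero bounded_linear_ident)
  then show ?thesis by simp
qed

lemma Ck_on_vec_nth: "open S \<Longrightarrow> Ck_on k f S \<Longrightarrow> Ck_on k (\<lambda>x. f x $ i) S"
  by (rule Ck_on_linear_compose) (auto intro: bounded_linear_vec_nth)

lemma Ck_on_vec_lambda:
  fixes f :: "'n::finite \<Rightarrow> 'a::real_normed_vector \<Rightarrow> 'b::real_normed_vector"
  assumes "open S" "\<And>i. Ck_on k (f i) S"
  shows "Ck_on k (\<lambda>x. \<chi> i. f i x) S"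
proof -
  have ax: "bounded_linear (axis i :: 'b \<Rightarrow> 'b^'n)" for i :: 'n
  proof (rule bounded_linear_intro[of _ 1])
    fix x y :: 'b and c :: real
    show "axis i (x + y) = axis i x + axis i y" "axis i (c *\<^sub>R x) = c *\<^sub>R axis i x"
      by (simp_all add: axis_def vec_eq_iff)
    have "norm (axis i x) \<le> (\<Sum>j\<in>UNIV. norm (axis i x $ j))"
      unfolding norm_vec_def by (rule L2_set_le_sum) simp
    also have "\<dots> = (\<Sum>j\<in>UNIV. if j = i then norm x else 0)"
      by (rule sum.cong) (auto simp: axis_def)
    finally show "norm (axis i x) \<le> norm x * 1" by simp
  qed
  have "Ck_on k (\<lambda>x. \<Sum>i\<in>UNIV. axis i (f i x) :: 'b^'n) S"
    by (rule Ck_on_sum[OF assms(1)], rule Ck_on_linear_compose[OF assms(1) ax assms(2)])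
  moreover have "(\<Sum>i\<in>UNIV. axis i (f i x)) = (\<chi> i. f i x)" for x
    by (simp add: vec_eq_iff axis_def if_distrib cong: if_cong)
  ultimately show ?thesis by simp
qed

lemma bounded_bilinear_matrix_vector_mult:
  "bounded_bilinear (\<lambda>(A::real^'n::finite^'m::finite) x. A *v x)"
  unfolding bilinear_conv_bounded_bilinear[symmetric]
  by (auto simp: bilinear_def linear_iff matrix_vector_mult_add_rdistrib matrix_vector_right_distrib
      scaleR_matrix_vector_assoc matrix_vector_mult_scaleR)

lemmas Ck_on_matrix_vector_mult = Ck_on_bilinear[OF _ bounded_bilinear_matrix_vector_mult]

lemma matrix_inv:
  fixes A :: "real^'n::finite^'n"
  assumes "det A \<noteq> 0"
  shows "A ** matrix_inv A = mat 1" "matrix_inv A ** A = mat 1"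
proof -
  have "\<exists>B. A ** B = mat 1 \<and> B ** A = mat 1"
    using assms invertible_det_nz[of A] by (simp add: invertible_def)
  then have "A ** matrix_inv A = mat 1 \<and> matrix_inv A ** A = mat 1"
    unfolding matrix_inv_def by (rule someI_ex)
  then show "A ** matrix_inv A = mat 1" "matrix_inv A ** A = mat 1" by auto
qed

lemma matrix_inv_mult_cramer:
  fixes A :: "real^'n::finite^'n"
  assumes "det A \<noteq> 0"
  shows "matrix_inv A *v b = (\<chi> k. det (\<chi> i j. if j = k then b $ i else A $ i $ j) / det A)"
proof -
  have "A *v (matrix_inv A *v b) = b"
    using assms by (simp add: matrix_vector_mul_assoc matrix_inv)
  then show ?thesis using cramer[OF assms] by blast
qed

lemma Ck_on_det:
  fixes A :: "'a::real_normed_vector \<Rightarrow> real^'n::finite^'n"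
  assumes "open S" "\<And>i j. Ck_on k (\<lambda>x. A x $ i $ j) S"
  shows "Ck_on k (\<lambda>x. det (A x)) S"
  unfolding det_def by (intro Ck_on_sum Ck_on_mult Ck_on_const Ck_on_prod assms)

text \<open>Cramer's rule writes each component as a polynomial in the entries divided by
  \<open>det (A x)\<close>, so the inverse matrix never has to be differentiated.\<close>

lemma Ck_on_matrix_inv_mult:
  fixes A :: "'a::real_normed_vector \<Rightarrow> real^'n::finite^'n"
  assumes S: "open S" "Ck_on k A S" "Ck_on k b S" "\<And>x. x \<in> S \<Longrightarrow> det (A x) \<noteq> 0"
  shows "Ck_on k (\<lambda>x. matrix_inv (A x) *v b x) S"
proof (rule Ck_on_cong[OF S(1)])
  show "(\<chi> k. det (\<chi> i j. if j = k then b x $ i else A x $ i $ j) * inverse (det (A x))) = matrix_inv (A x) *v b x"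
    if "x \<in> S" for x
    using matrix_inv_mult_cramer[OF S(4)[OF that]] by (simp add: field_simps)
  have A: "Ck_on k (\<lambda>x. A x $ i $ j) S" for i j by (intro Ck_on_vec_nth S)
  have b: "Ck_on k (\<lambda>x. b x $ i) S" for i by (intro Ck_on_vec_nth S)
  show "Ck_on k (\<lambda>x. \<chi> k. det (\<chi> i j. if j = k then b x $ i else A x $ i $ j) * inverse (det (A x))) S"
  proof (intro Ck_on_vec_lambda Ck_on_mult Ck_on_inverse Ck_on_det S A)
    show "Ck_on k (\<lambda>x. (\<chi> i j. if j = l then b x $ i else A x $ i $ j) $ i $ j) S" for l i j
      by (cases "j = l") (auto intro: A b)
  qed
qed

text \<open>The second difference of \<open>f\<close> over a small parallelogram with sides along
  \<open>v\<close> and \<open>w\<close> is symmetric in \<open>v\<close> and \<open>w\<close>. Two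
  mean value theorems turn it into t^2 times a mixed second derivative at a nearby point, in either
  order; continuity at \<open>x\<close> makes the two orders agree up to any
  \<open>e\<close>.\<close>

lemma frechet_derivative_symmetric_real:
  fixes f :: "'a::real_normed_vector \<Rightarrow> real"
  assumes S: "open S" "x \<in> S" and f: "Ck_on 2 f S"
  shows "FD (\<lambda>y. frechet_derivative f (at y) w) x v =
         FD (\<lambda>y. frechet_derivative f (at y) v) x w"
proof -
  define D where "D v w y = FD (\<lambda>y. frechet_derivative f (at y) w) y v" for v w y
  have f2: "Ck_on (Suc (Suc 0)) f S" using f by (simp add: numeral_2_eq_2)
  have df: "(f has_derivative FD f y) (at y)" if "y \<in> S" for y
    by (rule Ck_on_has_derivative[OF f2 that])
  have ddf: "((\<lambda>y. FD f y w) has_derivative (\<lambda>v. D v w y)) (at y)" if "y \<in> S" for y w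
    unfolding D_def by (rule Ck_on_has_derivative[OF Ck_on_frechet_derivative[OF f2] that])
  have cD: "continuous_on S (D v w)" for v w
    using f2 unfolding D_def by simp
  obtain r where r: "r > 0" "ball x r \<subseteq> S"
    using S openE by blast
  have key: "\<exists>y. dist y x < e \<and> f (x + t *\<^sub>R v + t *\<^sub>R w) - f (x + t *\<^sub>R v) - f (x + t *\<^sub>R w) + f x = t * (t * D w v y)"
    if e: "e > 0" "e \<le> r" and t: "t > 0" "t * (norm v + norm w) < e" for v w e t
  proof -
    have near: "dist (x + a *\<^sub>R v + b *\<^sub>R w) x < e" if "0 \<le> a" "a \<le> t" "0 \<le> b" "b \<le> t" for a b
    proof -
      have "norm (a *\<^sub>R v + b *\<^sub>R w) \<le> a * norm v + b * norm w"
        using that by (metis abs_of_nonneg norm_scaleR norm_triangle_ineq)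
      also have "\<dots> \<le> t * norm v + t * norm w"
        using that by (intro add_mono mult_right_mono) auto
      finally show ?thesis using t(2) by (simp add: dist_norm algebra_simps)
    qed
    have inS: "x + a *\<^sub>R v + b *\<^sub>R w \<in> S" if "0 \<le> a" "a \<le> t" "0 \<le> b" "b \<le> t" for a b
      using near[OF that] e r(2) by (auto simp: dist_commute)
    let ?g = "\<lambda>s. f (x + s *\<^sub>R v + t *\<^sub>R w) - f (x + s *\<^sub>R v + 0 *\<^sub>R w)"
    have "(?g has_derivative (\<lambda>h. FD f (x + s *\<^sub>R v + t *\<^sub>R w) (h *\<^sub>R v)
        - FD f (x + s *\<^sub>R v + 0 *\<^sub>R w) (h *\<^sub>R v))) (at s within {0..t})"
      if "s \<in> {0..t}" for s
      using that t by (auto intro!: derivative_eq_intros has_derivative_compose[OF _ df] inS) (use inS[of s 0] in auto)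
    from mvt_very_simple[OF _ this] t obtain s where s: "s \<in> {0..t}"
      and "?g t - ?g 0 = FD f (x + s *\<^sub>R v + t *\<^sub>R w) ((t - 0) *\<^sub>R v)
        - FD f (x + s *\<^sub>R v + 0 *\<^sub>R w) ((t - 0) *\<^sub>R v)"
      by (metis atLeastAtMost_iff less_eq_real_def)
    then have 1: "?g t - ?g 0 = t * (FD f (x + s *\<^sub>R v + t *\<^sub>R w) v
        - FD f (x + s *\<^sub>R v + 0 *\<^sub>R w) v)"
      using inS[of s t] inS[of s 0] t linear_cmul[OF has_derivative_linear[OF df]]
      by (auto simp: algebra_simps)
    let ?h = "\<lambda>b. FD f (x + s *\<^sub>R v + b *\<^sub>R w) v"
    have "(?h has_derivative (\<lambda>h. D (h *\<^sub>R w) v (x + s *\<^sub>R v + b *\<^sub>R w))) (at b within {0..t})" if "b \<in> {0..t}" for b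
      using that s by (auto intro!: derivative_eq_intros has_derivative_compose[OF _ ddf] inS)
    from mvt_very_simple[OF _ this] t obtain b where b: "b \<in> {0..t}"
      and "?h t - ?h 0 = D ((t - 0) *\<^sub>R w) v (x + s *\<^sub>R v + b *\<^sub>R w)"
      by (metis atLeastAtMost_iff less_eq_real_def)
    then have 2: "?h t - ?h 0 = t * D w v (x + s *\<^sub>R v + b *\<^sub>R w)"
      using linear_cmul[OF has_derivative_linear[OF ddf[OF inS[of s b]]]] s by auto
    show ?thesis
      using 1 2 near[of s b] s b by (intro exI[of _ "x + s *\<^sub>R v + b *\<^sub>R w"]) (auto simp: algebra_simps)
  qed
  have "\<bar>D v w x - D w v x\<bar> \<le> e" if "e > 0" for e
  proof -
    obtain d1 where d1: "d1 > 0" "\<And>y. y \<in> S \<Longrightarrow> dist y x < d1 \<Longrightarrow> dist (D v w y) (D v w x) < e/2"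
      using cD[of v w] \<open>e > 0\<close> S(2) half_gt_zero[of e] unfolding continuous_on_iff by metis
    obtain d2 where d2: "d2 > 0" "\<And>y. y \<in> S \<Longrightarrow> dist y x < d2 \<Longrightarrow> dist (D w v y) (D w v x) < e/2"
      using cD[of w v] \<open>e > 0\<close> S(2) half_gt_zero[of e] unfolding continuous_on_iff by metis
    define d where "d = min r (min d1 d2)"
    have d: "d > 0" "d \<le> r" using d1 d2 r by (auto simp: d_def)
    define t where "t = d / (norm v + norm w + 1) / 2"
    have t: "t > 0" "t * (norm v + norm w) < d"
    proof -
      have "0 \<le> norm v + norm w" by simp
      then show "t > 0" using d by (simp add: t_def add_nonneg_pos)
      have "t * (norm v + norm w) < t * ((norm v + norm w + 1) * 2)"
        by (rule mult_strict_left_mono[OF _ \<open>t > 0\<close>]) (smt (verit) \<open>0 \<le> norm v + norm w\<close>)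
      also have "\<dots> = d"
        using \<open>0 \<le> norm v + norm w\<close> by (simp add: t_def add_nonneg_eq_0_iff)
      finally show "t * (norm v + norm w) < d" .
    qed
    from key[OF d t] obtain y where y: "dist y x < d"
      "f (x + t *\<^sub>R v + t *\<^sub>R w) - f (x + t *\<^sub>R v) - f (x + t *\<^sub>R w) + f x = t * (t * D w v y)" by blast
    from key[OF d, of t w v] t obtain z where z: "dist z x < d"
      "f (x + t *\<^sub>R w + t *\<^sub>R v) - f (x + t *\<^sub>R w) - f (x + t *\<^sub>R v) + f x = t * (t * D v w z)"
      by (auto simp: add.commute)
    have "t * (t * D w v y) = t * (t * D v w z)"
      unfolding y(2)[symmetric] z(2)[symmetric] by (simp add: algebra_simps)
    then have "D w v y = D v w z" using t by simp
    moreover have "dist (D w v y) (D w v x) < e/2"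
      using y r by (intro d2) (auto simp: d_def dist_commute)
    moreover have "dist (D v w z) (D v w x) < e/2"
      using z r by (intro d1) (auto simp: d_def dist_commute)
    ultimately show ?thesis unfolding dist_real_def by linarith
  qed
  then have "\<bar>D v w x - D w v x\<bar> \<le> 0" using dense_ge by blast
  then show ?thesis by (simp add: D_def)
qed

section \<open>Ordinary differential equations with parameters\<close>

text \<open>A Gronwall estimate without exponentials: at a point t where the norm of
  \<open>R\<close> is largest, |R t| \<le> \<alpha> + 2 (|R t| / 4 + c), because |t| \<le> 2.
  Absorbing |R t| / 2 on the left gives the factors 2 and 4. With \<alpha> = c = 0 it serves below
  as the uniqueness theorem for solutions.\<close>

lemma deriv_bound_growth:
  fixes R :: "real \<Rightarrow> 'b::real_normed_vector"
  assumes a: "0 \<le> a" "a \<le> 2"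
    and der: "\<And>s. s \<in> {-a..a} \<Longrightarrow> (R has_vector_derivative R' s) (at s within {-a..a})"
    and bnd: "\<And>s. s \<in> {-a..a} \<Longrightarrow> norm (R' s) \<le> norm (R s) / 4 + c"
    and R0: "norm (R 0) \<le> \<alpha>" and s: "s \<in> {-a..a}"
  shows "norm (R s) \<le> 2 * \<alpha> + 4 * c"
proof -
  have cont: "continuous_on {-a..a} R"
    unfolding continuous_on_eq_continuous_within using der has_vector_derivative_continuous by blast
  obtain t where t: "t \<in> {-a..a}" and max: "\<And>s. s \<in> {-a..a} \<Longrightarrow> norm (R s) \<le> norm (R t)"
  proof -
    have "\<exists>t\<in>{-a..a}. \<forall>s\<in>{-a..a}. norm (R s) \<le> norm (R t)"
      by (rule continuous_attains_sup) (use s cont in \<open>auto intro: continuous_on_norm\<close>)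
    then show thesis using that by blast
  qed
  define B where "B = norm (R t) / 4 + c"
  have B: "norm (R' s) \<le> B" if "s \<in> {-a..a}" for s
    using bnd[OF that] max[OF that] by (simp add: B_def)
  have B0: "0 \<le> B" using B[OF t] norm_ge_zero order_trans by blast
  have "norm (R t - R 0) \<le> B * norm (t - 0)"
  proof (rule differentiable_bound)
    show "(R has_derivative (\<lambda>h. h *\<^sub>R R' s)) (at s within {-a..a})" if "s \<in> {-a..a}" for s
      using der[OF that] by (simp add: has_vector_derivative_def)
    show "onorm (\<lambda>h. h *\<^sub>R R' s) \<le> B" if "s \<in> {-a..a}" for s
      using B[OF that] B0 by (intro onorm_bound) (auto simp: mult.commute[of _ "norm (R' s)"] intro: mult_right_mono)
  qed (use a t in auto)
  also have "\<dots> \<le> B * 2"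
    using B0 t a by (intro mult_left_mono) auto
  finally have "norm (R t) \<le> \<alpha> + B * 2"
    using R0 norm_triangle_sub[of "R t" "R 0"] by linarith
  then show ?thesis using max[OF s] by (simp add: B_def)
qed

text \<open>Picard iteration for all parameters at once, in the supremum norm over
  \<open>K \<times> T\<close>. \<open>C\<close> is a closed set kept by the Picard step: the whole
  space for linearised equations, a ball for the flow. The bound \<open>M\<close> controls the first
  increment, with which the geometric series of increments starts.\<close>

lemma picard_parameters:
  fixes F :: "'a::real_normed_vector \<times> real \<Rightarrow> 'b::euclidean_space \<Rightarrow> 'b"
  assumes a: "0 \<le> a" "a \<le> 2" and T: "T = {-a..a}"
    and contF: "continuous_on ((K \<times> T) \<times> C) (\<lambda>(p, u). F p u)"
    and lip: "\<And>p v w. p \<in> K \<times> T \<Longrightarrow> v \<in> C \<Longrightarrow> w \<in> C \<Longrightarrow> norm (F p v - F p w) \<le> norm (v - w) / 4"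
    and bnd: "\<And>z s. z \<in> K \<Longrightarrow> s \<in> T \<Longrightarrow> norm (F (z, s) (y z)) \<le> M"
    and y: "continuous_on K y" "y ` K \<subseteq> C" and C: "closed C"
    and inC: "\<And>z s f. z \<in> K \<Longrightarrow> s \<in> T \<Longrightarrow> continuous_on {0..1} f \<Longrightarrow> f ` {0..1} \<subseteq> C \<Longrightarrow>
                y z + s *\<^sub>R integral {0..1} (\<lambda>\<theta>. F (z, \<theta> * s) (f \<theta>)) \<in> C"
  obtains u where "continuous_on (K \<times> T) u" "u ` (K \<times> T) \<subseteq> C" "\<And>z. z \<in> K \<Longrightarrow> u (z, 0) = y z"
    "\<And>z s. z \<in> K \<Longrightarrow> s \<in> T \<Longrightarrow> ((\<lambda>s. u (z, s)) has_vector_derivative F (z, s) (u (z, s))) (at s within T)"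
proof -
  \<comment> \<open>The integration variable is rescaled to \<theta> * s, so that the interval
    {0..1} does not depend on s: joint continuity in (z, s) becomes continuity of a parameter
    integral, and negative times are covered by the same formula.\<close>
  define P where "P u = (\<lambda>(z, s). y z + s *\<^sub>R integral {0..1} (\<lambda>\<theta>. F (z, \<theta> * s) (u (z, \<theta> * s))))" for u
  define good where "good u \<longleftrightarrow> continuous_on (K \<times> T) u \<and> u ` (K \<times> T) \<subseteq> C" for u
  have scale: "\<theta> * s \<in> T" if "s \<in> T" "\<theta> \<in> {0..1}" for \<theta> s
  proof -
    have "\<bar>\<theta> * s\<bar> \<le> 1 * \<bar>s\<bar>" using that unfolding abs_mult by (intro mult_right_mono) auto
    then show ?thesis using that T by auto
  qed
  have contint: "continuous_on ((K \<times> T) \<times> {0..1}) (\<lambda>(p, \<theta>). F (fst p, \<theta> * snd p) (u (fst p, \<theta> * snd p)))"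
    if "good u" for u
  proof -
    have "continuous_on ((K \<times> T) \<times> {0..1}) (\<lambda>q. u (fst (fst q), snd q * snd (fst q)))"
    proof (rule continuous_on_compose2[of "K \<times> T" u])
      show "continuous_on (K \<times> T) u" using that by (simp add: good_def)
      show "continuous_on ((K \<times> T) \<times> {0..1}) (\<lambda>q. (fst (fst q), snd q * snd (fst q)))"
        by (intro continuous_intros)
      show "(\<lambda>q. (fst (fst q), snd q * snd (fst q))) ` ((K \<times> T) \<times> {0..1}) \<subseteq> K \<times> T"
        using scale by auto
    qed
    then have "continuous_on ((K \<times> T) \<times> {0..1})
       (\<lambda>q. (\<lambda>(p, u). F p u) ((fst (fst q), snd q * snd (fst q)), u (fst (fst q), snd q * snd (fst q))))"
      using that scale unfolding good_def
      by (intro continuous_on_compose2[OF contF] continuous_on_Pair continuous_intros) (force simp: image_subset_iff)+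
    then show ?thesis by (simp add: case_prod_beta)
  qed
  have slice: "continuous_on {0..1} (\<lambda>\<theta>. F (z, \<theta> * s) (u (z, \<theta> * s)))" if "good u" "z \<in> K" "s \<in> T" for u z s
    using continuous_on_compose2[OF contint[OF that(1)], of "{0..1}" "\<lambda>\<theta>. ((z, s), \<theta>)"] that
      continuous_on_Pair[OF continuous_on_const continuous_on_id, of "{0..1}" "(z, s)"]
    by auto
  have goodP: "good (P u)" if u: "good u" for u
    unfolding good_def
  proof
    have "continuous_on (K \<times> T) (\<lambda>p. integral (cbox 0 1) (\<lambda>\<theta>. F (fst p, \<theta> * snd p) (u (fst p, \<theta> * snd p))))"
      by (rule integral_continuous_on_param) (use contint[OF u] in simp)
    moreover have "continuous_on (K \<times> T) (\<lambda>p. y (fst p))"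
      by (rule continuous_on_compose2[OF y(1)]) (auto intro: continuous_intros)
    ultimately show "continuous_on (K \<times> T) (P u)"
      unfolding P_def case_prod_beta by (auto intro!: continuous_intros)
    have "P u (z, s) \<in> C" if "z \<in> K" "s \<in> T" for z s
    proof -
      have "continuous_on {0..1} (\<lambda>\<theta>. u (z, \<theta> * s))"
      proof (rule continuous_on_compose2[of "K \<times> T" u])
        show "continuous_on (K \<times> T) u" using u by (simp add: good_def)
        show "continuous_on {0..1} (\<lambda>\<theta>. (z, \<theta> * s))" by (intro continuous_intros)
      qed (use scale that in auto)
      moreover have "(\<lambda>\<theta>. u (z, \<theta> * s)) ` {0..1} \<subseteq> C"
        using u scale that unfolding good_def by (auto simp: image_subset_iff)
      ultimately show ?thesis unfolding P_def using inC[OF that] by simp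
    qed
    then show "P u ` (K \<times> T) \<subseteq> C" by auto
  qed
  have contr: "norm (P u p - P v p) \<le> e / 2"
    if u: "good u" and v: "good v" and e: "\<And>p. p \<in> K \<times> T \<Longrightarrow> norm (u p - v p) \<le> e" and p: "p \<in> K \<times> T" for u v e p
  proof -
    obtain z s where p: "p = (z, s)" "z \<in> K" "s \<in> T" using p by auto
    let ?f = "\<lambda>\<theta>. F (z, \<theta> * s) (u (z, \<theta> * s))" and ?g = "\<lambda>\<theta>. F (z, \<theta> * s) (v (z, \<theta> * s))"
    have int: "?f integrable_on {0..1}" "?g integrable_on {0..1}"
      using slice u v p by (auto intro: integrable_continuous_real)
    have le: "norm (?f \<theta> - ?g \<theta>) \<le> e / 4" if "\<theta> \<in> {0..1}" for \<theta>
    proof -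
      have "(z, \<theta> * s) \<in> K \<times> T" using scale p that by auto
      then have "norm (?f \<theta> - ?g \<theta>) \<le> norm (u (z, \<theta> * s) - v (z, \<theta> * s)) / 4"
        using u v unfolding good_def by (intro lip) auto
      then show ?thesis using e[OF \<open>(z, \<theta> * s) \<in> K \<times> T\<close>] by linarith
    qed
    have "norm (integral {0..1} (\<lambda>\<theta>. ?f \<theta> - ?g \<theta>)) \<le> e / 4 * (1 - 0)"
      by (rule integral_bound) (use slice u v p le in \<open>auto intro!: continuous_intros\<close>)
    then have "norm (integral {0..1} ?f - integral {0..1} ?g) \<le> e / 4"
      by (simp add: integral_diff int)
    moreover have "P u p - P v p = s *\<^sub>R (integral {0..1} ?f - integral {0..1} ?g)"
      by (simp add: P_def p algebra_simps)
    moreover have "\<bar>s\<bar> \<le> 2" using p T a by auto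
    ultimately show ?thesis
      using mult_mono[of "\<bar>s\<bar>" 2 "norm (integral {0..1} ?f - integral {0..1} ?g)" "e / 4"] by simp
  qed
  define U where "U n = (P ^^ n) (\<lambda>(z, s). y z)" for n
  have US: "U (Suc n) = P (U n)" for n by (simp add: U_def)
  have goodU: "good (U n)" for n
  proof (induction n)
    case 0
    have "continuous_on (K \<times> T) (\<lambda>p. y (fst p))"
      by (rule continuous_on_compose2[OF y(1)]) (auto intro: continuous_intros)
    then show ?case using y(2) by (auto simp: U_def good_def case_prod_beta)
  qed (simp add: US goodP)
  \<comment> \<open>The factor 2 * M is the bound on |s| times the bound on the integrand at the
    initial function; each further step gains the contraction factor 1/2.\<close>
  have step: "norm (U (Suc n) p - U n p) \<le> 2 * M * (1/2) ^ n" if "p \<in> K \<times> T" for n p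
    using that
  proof (induction n arbitrary: p)
    case 0
    obtain z s where p: "p = (z, s)" "z \<in> K" "s \<in> T" using 0 by auto
    have "norm (integral {0..1} (\<lambda>\<theta>. F (z, \<theta> * s) (y z))) \<le> M * (1 - 0)"
      by (rule integral_bound) (use slice[OF goodU[of 0]] p bnd scale in \<open>auto simp: U_def\<close>)
    moreover have "\<bar>s\<bar> \<le> 2" using p T a by auto
    ultimately show ?case
      using mult_mono[of "\<bar>s\<bar>" 2 "norm (integral {0..1} (\<lambda>\<theta>. F (z, \<theta> * s) (y z)))" M]
      by (simp add: US P_def p, simp add: U_def)
  next
    case (Suc n)
    show ?case unfolding US[of "Suc n"] US[of n, symmetric]
      using contr[OF goodU[of "Suc n"] goodU[of n], of "2 * M * (1/2) ^ n" p] Suc by (simp add: US)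
  qed
  define w where "w p = U 0 p + (\<Sum>i. U (Suc i) p - U i p)" for p
  have "uniform_limit (K \<times> T) (\<lambda>n p. \<Sum>i<n. U (Suc i) p - U i p) (\<lambda>p. \<Sum>i. U (Suc i) p - U i p) sequentially"
    by (rule Weierstrass_m_test[OF step]) (auto intro: summable_mult summable_geometric)
  then have ul: "uniform_limit (K \<times> T) U w sequentially"
    using sum_lessThan_telescope[of "\<lambda>i. U i _"]
    by (simp add: w_def uniform_limit_iff dist_norm diff_diff_eq)
  have gw: "good w" unfolding good_def
  proof
    show "continuous_on (K \<times> T) w"
      by (rule uniform_limit_theorem[OF _ ul]) (use goodU in \<open>auto simp: good_def\<close>)
    have "w p \<in> C" if "p \<in> K \<times> T" for p
      using closed_sequentially[OF C _ tendsto_uniform_limitI[OF ul that]] goodU that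
      unfolding good_def by blast
    then show "w ` (K \<times> T) \<subseteq> C" by auto
  qed
  have fixpt: "P w p = w p" if p: "p \<in> K \<times> T" for p
  proof -
    have "norm (P w p - w p) \<le> e" if "e > 0" for e
    proof -
      have "\<forall>\<^sub>F n in sequentially. \<forall>p\<in>K \<times> T. dist (U n p) (w p) < e / 2"
        using uniform_limitD[OF ul half_gt_zero[OF that]] .
      then obtain N where N: "\<And>n p. n \<ge> N \<Longrightarrow> p \<in> K \<times> T \<Longrightarrow> norm (w p - U n p) < e / 2"
        by (auto simp: eventually_sequentially dist_norm norm_minus_commute)
      have "norm (P w p - P (U N) p) \<le> (e / 2) / 2"
        by (rule contr[OF gw goodU _ p]) (use N[of N] in \<open>auto intro: less_imp_le\<close>)
      moreover have "norm (w p - P (U N) p) < e / 2"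
        using N[of "Suc N" p] p by (simp add: US)
      ultimately show ?thesis
        using that norm_triangle_ineq4[of "P w p - P (U N) p" "w p - P (U N) p"] by simp
    qed
    then show ?thesis using dense_ge[of 0 "norm (P w p - w p)"] by simp
  qed
  show thesis
  proof (rule that[of w])
    show "continuous_on (K \<times> T) w" "w ` (K \<times> T) \<subseteq> C" using gw by (auto simp: good_def)
    show "w (z, 0) = y z" if "z \<in> K" for z
      using fixpt[of "(z, 0)"] that a T by (simp add: P_def)
    fix z s assume z: "z \<in> K" and s: "s \<in> T"
    let ?f = "\<lambda>\<tau>. F (z, \<tau>) (w (z, \<tau>))"
    have "continuous_on T (\<lambda>\<tau>. w (z, \<tau>))"
    proof (rule continuous_on_compose2[of "K \<times> T" w])
      show "continuous_on (K \<times> T) w" using gw by (simp add: good_def)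
      show "continuous_on T (\<lambda>\<tau>. (z, \<tau>))" by (intro continuous_intros)
    qed (use z in auto)
    then have "continuous_on T (\<lambda>\<tau>. (\<lambda>(p, u). F p u) ((z, \<tau>), w (z, \<tau>)))"
      using gw z unfolding good_def
      by (intro continuous_on_compose2[OF contF] continuous_on_Pair continuous_intros) (force simp: image_subset_iff)+
    then have "continuous_on {-a..a} ?f" by (simp add: T)
    then obtain g where g: "\<And>\<tau>. \<tau> \<in> T \<Longrightarrow> (g has_vector_derivative ?f \<tau>) (at \<tau> within T)"
      using antiderivative_continuous[of "-a" a ?f] T by blast
    \<comment> \<open>Undoes the rescaling: by the fundamental theorem the integral in the
      fixed-point equation is an increment of the antiderivative \<open>g\<close>, whose derivative
      is known.\<close>
    have "w (z, \<tau>) = y z + (g \<tau> - g 0)" if \<tau>: "\<tau> \<in> T" for \<tau>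
    proof -
      have "((\<lambda>\<theta>. \<tau> *\<^sub>R ?f (\<theta> * \<tau>)) has_integral (g (1 * \<tau>) - g (0 * \<tau>))) {0..1}"
      proof (rule fundamental_theorem_of_calculus)
        fix \<theta> :: real assume \<theta>: "\<theta> \<in> {0..1}"
        have "((g \<circ> (\<lambda>\<theta>. \<theta> * \<tau>)) has_vector_derivative (\<tau> *\<^sub>R ?f (\<theta> * \<tau>))) (at \<theta> within {0..1})"
        proof (rule vector_diff_chain_within)
          show "((\<lambda>\<theta>. \<theta> * \<tau>) has_vector_derivative \<tau>) (at \<theta> within {0..1})"
            by (auto intro!: derivative_eq_intros)
          show "(g has_vector_derivative ?f (\<theta> * \<tau>)) (at (\<theta> * \<tau>) within (\<lambda>\<theta>. \<theta> * \<tau>) ` {0..1})"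
            by (rule has_vector_derivative_within_subset[OF g]) (use scale \<tau> \<theta> in auto)
        qed
        then show "((\<lambda>\<theta>. g (\<theta> * \<tau>)) has_vector_derivative (\<tau> *\<^sub>R ?f (\<theta> * \<tau>))) (at \<theta> within {0..1})"
          by (simp add: o_def)
      qed simp
      then have "integral {0..1} (\<lambda>\<theta>. \<tau> *\<^sub>R ?f (\<theta> * \<tau>)) = g (1 * \<tau>) - g (0 * \<tau>)"
        by (rule integral_unique)
      then show ?thesis
        using fixpt[of "(z, \<tau>)"] z \<tau> by (simp add: P_def)
    qed
    moreover have "((\<lambda>\<tau>. y z + (g \<tau> - g 0)) has_vector_derivative ?f s) (at s within T)"
      using has_vector_derivative_add[OF has_vector_derivative_const
          has_vector_derivative_diff[OF g[OF s] has_vector_derivative_const]] by simp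
    ultimately show "((\<lambda>s. w (z, s)) has_vector_derivative ?f s) (at s within T)"
      using has_vector_derivative_transform[OF s] by (metis (no_types, lifting))
  qed
qed

text \<open>Transfers the Lipschitz constant 1/4 of an equation to its linearisation. Up to an error
  \<open>e\<close>, the bound is read off from a difference quotient in the direction
  \<open>v\<close>.\<close>

lemma lipschitz_imp_derivative_bound:
  fixes f :: "'a::real_normed_vector \<Rightarrow> 'b::real_normed_vector"
  assumes der: "(f has_derivative f') (at x)" and S: "open S" "x \<in> S"
    and lip: "\<And>y. y \<in> S \<Longrightarrow> norm (f y - f x) \<le> L * norm (y - x)"
  shows "norm (f' v) \<le> L * norm v"
proof (cases "v = 0")
  case True
  then show ?thesis using der has_derivative_linear linear_0 by fastforce
next
  case False
  interpret bounded_linear f' using der has_derivative_bounded_linear by blast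
  have "norm (f' v) \<le> L * norm v + e" if "e > 0" for e
  proof -
    have "e / norm v > 0" using that False by simp
    then obtain d where d: "d > 0" "\<And>y. norm (y - x) < d \<Longrightarrow> norm (f y - f x - f' (y - x)) \<le> e / norm v * norm (y - x)"
      using der unfolding has_derivative_at_alt by blast
    obtain r where r: "r > 0" "ball x r \<subseteq> S" using S openE by blast
    \<comment> \<open>Half of the smaller radius, divided by the norm of \<open>v\<close>: the step
      has length below both \<open>d\<close> and \<open>r\<close>.\<close>
    define t where "t = min d r / 2 / norm v"
    have t: "t > 0" "t * norm v < d" "t * norm v < r" using d r False by (auto simp: t_def)
    define y where "y = x + t *\<^sub>R v"
    have yx: "y - x = t *\<^sub>R v" "norm (y - x) = t * norm v" using t by (auto simp: y_def)
    have "dist x y < r" unfolding dist_norm norm_minus_commute[of x y] yx(2) using t(3) .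
    then have "y \<in> S" using r by auto
    have "norm (f' (y - x)) \<le> norm (f y - f x) + norm (f y - f x - f' (y - x))"
      using norm_triangle_ineq4[of "f y - f x" "f y - f x - f' (y - x)"] by simp
    also have "\<dots> \<le> L * norm (y - x) + e / norm v * norm (y - x)"
      using lip[OF \<open>y \<in> S\<close>] d(2)[of y] t yx by (intro add_mono) auto
    finally have "t * norm (f' v) \<le> t * (L * norm v + e)"
      using t False by (simp add: yx scaleR algebra_simps)
    then show ?thesis using t by simp
  qed
  then show ?thesis using field_le_epsilon by blast
qed

text \<open>One radius for all base points of \<open>K\<close>: cover \<open>K\<close> by balls in
  which the derivative varies by at most e/2 from its value at the centre, and take a Lebesgue
  number of the cover. The second point \<open>q'\<close> may leave \<open>K\<close>, as perturbed
  solutions leave the compact solution curve.\<close>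

lemma uniform_differentiable_on_compact:
  fixes F :: "'a::euclidean_space \<Rightarrow> 'b::real_normed_vector"
  assumes S: "open S" and F: "Ck_on 1 F S" and K: "compact K" "K \<subseteq> S" and e: "e > 0"
  obtains d where "d > 0" "\<And>q q'. q \<in> K \<Longrightarrow> norm (q' - q) < d \<Longrightarrow>
     q' \<in> S \<and> norm (F q' - F q - FD F q (q' - q)) \<le> e * norm (q' - q)"
proof -
  let ?D = "\<lambda>x. FD F x"
  have F1: "Ck_on (Suc 0) F S" using F by simp
  have der: "(F has_derivative ?D x) (at x)" if "x \<in> S" for x
    by (rule Ck_on_has_derivative[OF F1 that])
  have cD: "continuous_on S (\<lambda>x. ?D x v)" for v using F1 by simp
  have "\<exists>r>0. ball x r \<subseteq> S \<and> (\<forall>y\<in>ball x r. onorm (\<lambda>v. ?D y v - ?D x v) \<le> e / 2)" if x: "x \<in> S" for x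
  proof -
    define N where "N y = (\<Sum>b\<in>Basis. norm (?D y b - ?D x b))" for y
    have "continuous_on S N" unfolding N_def by (intro continuous_intros cD)
    then have "\<exists>d>0. \<forall>y\<in>S. dist y x < d \<longrightarrow> dist (N y) (N x) < e / 2"
      using x e unfolding continuous_on_iff by (meson half_gt_zero)
    moreover have "N x = 0" by (simp add: N_def)
    ultimately obtain d where d: "d > 0" "\<And>y. y \<in> S \<Longrightarrow> dist y x < d \<Longrightarrow> \<bar>N y\<bar> < e / 2" by auto
    obtain r where r: "r > 0" "ball x r \<subseteq> S" using S x openE by blast
    have "onorm (\<lambda>v. ?D y v - ?D x v) \<le> e / 2" if y: "y \<in> ball x (min d r)" for y
    proof (rule onorm_bound)
      have "y \<in> S" using y r by auto
      fix v
      let ?L = "\<lambda>v. ?D y v - ?D x v"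
      have "linear ?L"
        using der[OF x] der[OF \<open>y \<in> S\<close>] by (intro linear_compose_sub has_derivative_linear)
      then have "norm (?L v) \<le> norm v * N y" unfolding N_def by (rule linear_norm_le_basis)
      also have "\<dots> \<le> norm v * (e / 2)"
        using d(2)[OF \<open>y \<in> S\<close>] y by (intro mult_left_mono) (auto simp: dist_commute)
      finally show "norm (?L v) \<le> e / 2 * norm v" by (simp add: mult.commute)
    qed (use e in simp)
    then show ?thesis using d r by (intro exI[of _ "min d r"]) auto
  qed
  then obtain r where r: "\<And>x. x \<in> S \<Longrightarrow> r x > 0" "\<And>x. x \<in> S \<Longrightarrow> ball x (r x) \<subseteq> S"
    "\<And>x y. x \<in> S \<Longrightarrow> y \<in> ball x (r x) \<Longrightarrow> onorm (\<lambda>v. ?D y v - ?D x v) \<le> e / 2" by metis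
  have "K \<subseteq> \<Union> ((\<lambda>x. ball x (r x)) ` K)" using r(1) K(2) by force
  from Heine_Borel_lemma[OF K(1) this] obtain d where d: "d > 0"
    "\<And>q. q \<in> K \<Longrightarrow> \<exists>G\<in>(\<lambda>x. ball x (r x)) ` K. ball q d \<subseteq> G" by auto
  show thesis
  proof (rule that[OF d(1)])
    fix q q' assume q: "q \<in> K" "norm (q' - q) < d"
    obtain x where x: "x \<in> K" "ball q d \<subseteq> ball x (r x)" using d(2)[OF q(1)] by auto
    have xS: "x \<in> S" using x K by auto
    have q': "q' \<in> ball q d" "q \<in> ball q d" using q d by (auto simp: dist_norm norm_minus_commute)
    have sub: "ball q d \<subseteq> S" using x r(2)[OF xS] by blast
    have "norm (F q' - F q - ?D q (q' - q)) \<le> norm (q' - q) * e"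
    proof (rule differentiable_bound_linearization[where S="ball q d" and f'="?D"])
      fix t :: real assume "t \<in> {0..1}"
      then show "q + t *\<^sub>R (q' - q) \<in> ball q d"
        using convex_ball[of q d] q' unfolding convex_alt by (auto simp: algebra_simps)
    next
      fix y assume y: "y \<in> ball q d"
      show "(F has_derivative ?D y) (at y within ball q d)"
        using der y sub has_derivative_at_withinI by blast
      have bl: "bounded_linear (\<lambda>v. ?D y v - ?D x v)" "bounded_linear (\<lambda>v. ?D x v - ?D q v)"
        using y sub xS q'(2) by (auto intro!: bounded_linear_sub has_derivative_bounded_linear[OF der])
      \<comment> \<open>\<open>y\<close> and \<open>q\<close> lie in the same ball of the cover, so
        their derivatives are compared through its centre \<open>x\<close>, at a cost of e/2
        each.\<close>
      have "onorm (\<lambda>v. ?D y v - ?D q v) = onorm (\<lambda>v. (?D y v - ?D x v) + (?D x v - ?D q v))" by simp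
      also have "\<dots> \<le> onorm (\<lambda>v. ?D y v - ?D x v) + onorm (\<lambda>v. ?D x v - ?D q v)"
        by (rule onorm_triangle[OF bl])
      also have "onorm (\<lambda>v. ?D x v - ?D q v) = onorm (\<lambda>v. ?D q v - ?D x v)"
        using onorm_neg[of "\<lambda>v. ?D q v - ?D x v"] by simp
      also have "onorm (\<lambda>v. ?D y v - ?D x v) + onorm (\<lambda>v. ?D q v - ?D x v) \<le> e / 2 + e / 2"
        using y q'(2) x(2) by (intro add_mono r(3)[OF xS]) (blast+)
      finally show "onorm (?D y - ?D q) \<le> e" by (simp add: fun_diff_def)
    qed (use q' in auto)
    then show "q' \<in> S \<and> norm (F q' - F q - ?D q (q' - q)) \<le> e * norm (q' - q)"
      using q' sub by (auto simp: mult.commute)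
  qed
qed

text \<open>The difference of the increment of the solution and the
  solution of the linearised equation satisfies a differential inequality with small data.\<close>

lemma solution_has_derivative_parameter:
  fixes F :: "('a::euclidean_space \<times> real) \<times> 'b::euclidean_space \<Rightarrow> 'b"
  assumes U: "open U" and C: "open C" and I: "I = {-2<..<2}"
    and F: "Ck_on 1 F ((U \<times> I) \<times> C)"
    and lip: "\<And>p v w. p \<in> U \<times> I \<Longrightarrow> v \<in> C \<Longrightarrow> w \<in> C \<Longrightarrow> norm (F (p, v) - F (p, w)) \<le> norm (v - w) / 4"
    and y: "Ck_on 1 y U"
    and u: "continuous_on (U \<times> I) u" "u ` (U \<times> I) \<subseteq> C" "\<And>z. z \<in> U \<Longrightarrow> u (z, 0) = y z"
      "\<And>z s. z \<in> U \<Longrightarrow> s \<in> I \<Longrightarrow> ((\<lambda>s. u (z, s)) has_vector_derivative F ((z, s), u (z, s))) (at s)"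
    and z: "z \<in> U" and a: "0 \<le> a" "a < 2"
    and W: "\<And>s. linear (\<lambda>v. W v s)" "\<And>v. W v 0 = FD y z v"
      "\<And>v s. s \<in> {-a..a} \<Longrightarrow> ((\<lambda>s. W v s) has_vector_derivative
          FD F ((z, s), u (z, s)) ((v, 0), W v s)) (at s within {-a..a})"
    and s: "s \<in> {-a..a}"
  shows "((\<lambda>z. u (z, s)) has_derivative (\<lambda>v. W v s)) (at z)"
proof -
  define T where "T = {-a..a}"
  have TI: "T \<subseteq> I" using a by (auto simp: T_def I)
  define Om where "Om = (U \<times> I) \<times> C"
  have Om: "open Om" unfolding Om_def I by (intro open_Times U C open_greaterThanLessThan)
  have FO: "Ck_on (Suc 0) F Om" using F by (simp add: Om_def)
  let ?q = "\<lambda>\<tau>. ((z, \<tau>), u (z, \<tau>))"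
  have qO: "?q \<tau> \<in> Om" if "\<tau> \<in> T" for \<tau> using that TI z u(2) by (auto simp: Om_def)
  have cu: "continuous_on T (\<lambda>\<tau>. u (z, \<tau>))"
  proof (rule continuous_on_compose2[OF u(1)])
    show "continuous_on T (\<lambda>\<tau>. (z, \<tau>))" by (intro continuous_intros)
  qed (use z TI in auto)
  define K where "K = ?q ` T"
  have K: "compact K" "K \<subseteq> Om"
    unfolding K_def using qO cu by (auto simp: T_def intro!: compact_continuous_image continuous_intros)
  have dF: "(F has_derivative FD F q) (at q)" if "q \<in> Om" for q
    by (rule Ck_on_has_derivative[OF FO that])
  have state: "norm (FD F (?q \<tau>) (0, w)) \<le> norm w / 4" if \<tau>: "\<tau> \<in> T" for \<tau> w
  proof -
    have "((\<lambda>v. ((z, \<tau>), v)) has_derivative (\<lambda>w. (0, w))) (at (u (z, \<tau>)))"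
      by (intro has_derivative_Pair has_derivative_const has_derivative_ident)
    from has_derivative_compose[OF this, of F] dF[OF qO[OF \<tau>]]
    have "((\<lambda>v. F ((z, \<tau>), v)) has_derivative (\<lambda>w. FD F (?q \<tau>) (0, w))) (at (u (z, \<tau>)))"
      by blast
    then have "norm (FD F (?q \<tau>) (0, w)) \<le> (1/4) * norm w"
      by (rule lipschitz_imp_derivative_bound[OF _ C]) (use qO[OF \<tau>] lip in \<open>auto simp: Om_def\<close>)
    then show ?thesis by simp
  qed
  obtain M where M: "M \<ge> 0" "\<And>\<tau> h. \<tau> \<in> T \<Longrightarrow> norm (FD F (?q \<tau>) ((h, 0), 0)) \<le> M * norm h"
  proof -
    define N where "N q = (\<Sum>b\<in>Basis. norm (FD F q ((b::'a, 0), 0)))" for q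
    have "continuous_on K N"
    proof -
      have "continuous_on K (\<lambda>q. FD F q v)" for v
        by (rule continuous_on_subset[OF Ck_on_imp_continuous_on[OF Ck_on_frechet_derivative[OF FO]] K(2)])
      then show ?thesis unfolding N_def by (intro continuous_intros)
    qed
    from compact_imp_bounded[OF compact_continuous_image[OF this K(1)]]
    obtain B where B: "\<And>q. q \<in> K \<Longrightarrow> \<bar>N q\<bar> \<le> B"
      unfolding bounded_real by blast
    have "norm (FD F (?q \<tau>) ((h, 0), 0)) \<le> max 0 B * norm h" if \<tau>: "\<tau> \<in> T" for \<tau> h
    proof -
      let ?L = "\<lambda>h. FD F (?q \<tau>) ((h::'a, 0), 0)"
      have "linear ?L"
        using linear_compose[OF _ has_derivative_linear[OF dF[OF qO[OF \<tau>]]], of "\<lambda>h. ((h, 0), 0)"]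
        by (simp add: o_def linear_iff)
      then have "norm (?L h) \<le> norm h * N (?q \<tau>)" unfolding N_def by (rule linear_norm_le_basis)
      also have "\<dots> \<le> norm h * max 0 B"
        using B[of "?q \<tau>"] \<tau> by (intro mult_left_mono) (auto simp: K_def)
      finally show ?thesis by (simp add: mult.commute)
    qed
    then show ?thesis using that[of "max 0 B"] by auto
  qed
  have dy: "(y has_derivative FD y z) (at z)"
    using Ck_on_has_derivative[of 0 y U z] y z by simp
  obtain Ly where Ly: "Ly \<ge> 0" "\<And>v. norm (FD y z v) \<le> Ly * norm v"
    using bounded_linear.nonneg_bounded[OF has_derivative_bounded_linear[OF dy]] by (metis mult.commute)
  \<comment> \<open>The output of \<open>deriv_bound_growth\<close> for the increment of the
    solution, with \<alpha> = (Ly + 1) |h| from the initial value and c = (M + 1) |h| from the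
    dependence of \<open>F\<close> on the parameter.\<close>
  define L where "L = 2 * (Ly + 1) + 4 * (M + 1)"
  have L0: "L \<ge> 0" using Ly M by (simp add: L_def)
  obtain r where r: "r > 0" "cball z r \<subseteq> U" using U z open_contains_cball by blast
  \<comment> \<open>A qualitative bound has to come first: it puts the perturbed curve within the
    radius \<open>d0\<close> of uniform differentiability. The quantitative bound by L |h| is then
    derived from it.\<close>
  have uc: "uniformly_continuous_on (cball z r \<times> T) u"
    using r TI by (intro compact_uniformly_continuous continuous_on_subset[OF u(1)] compact_Times) (auto simp: T_def)
  have "\<exists>d>0. \<forall>z'. norm (z' - z) < d \<longrightarrow> norm (u (z', s) - u (z, s) - W (z' - z) s) \<le> e * norm (z' - z)"
    if e: "e > 0" for e
  proof -
    \<comment> \<open>The last estimate bounds the remainder by \<epsilon> (2 + 4 (1 + L)) |h|. The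
      bound \<epsilon> \<le> 1 is what lets L be fixed before \<epsilon>.\<close>
    define \<epsilon> where "\<epsilon> = min 1 (e / (2 + 4 * (1 + L)))"
    have \<epsilon>: "\<epsilon> > 0" "\<epsilon> \<le> 1" using e L0 by (auto simp: \<epsilon>_def)
    have "\<epsilon> \<le> e / (2 + 4 * (1 + L))" by (simp add: \<epsilon>_def)
    then have \<epsilon>e: "\<epsilon> * (2 + 4 * (1 + L)) \<le> e" using L0 by (simp add: pos_le_divide_eq)
    obtain d0 where d0: "d0 > 0" "\<And>q q'. q \<in> K \<Longrightarrow> norm (q' - q) < d0 \<Longrightarrow>
       q' \<in> Om \<and> norm (F q' - F q - FD F q (q' - q)) \<le> \<epsilon> * norm (q' - q)"
      using uniform_differentiable_on_compact[OF Om _ K \<epsilon>(1), of F] FO by auto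
    obtain d1 where d1: "d1 > 0" "\<And>p p'. p \<in> cball z r \<times> T \<Longrightarrow> p' \<in> cball z r \<times> T \<Longrightarrow> dist p' p < d1 \<Longrightarrow> dist (u p') (u p) < d0 / 2"
      using uc d0(1) unfolding uniformly_continuous_on_def by (meson half_gt_zero)
    obtain d2 where d2: "d2 > 0" "\<And>z'. norm (z' - z) < d2 \<Longrightarrow> norm (y z' - y z - FD y z (z' - z)) \<le> \<epsilon> * norm (z' - z)"
      using dy \<epsilon>(1) unfolding has_derivative_at_alt by blast
    \<comment> \<open>Half of \<open>d0\<close> is left for the parameter increment \<open>h\<close>
      and half for the state increment, since both enter the distance of the points
      \<open>?q'\<close> and \<open>?q\<close>.\<close>
    define d where "d = min (min (d0 / 2) d1) (min d2 r)"
    have "norm (u (z', s) - u (z, s) - W (z' - z) s) \<le> e * norm (z' - z)" if z': "norm (z' - z) < d" for z'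
    proof -
      define h where "h = z' - z"
      define \<Delta> where "\<Delta> \<tau> = u (z', \<tau>) - u (z, \<tau>)" for \<tau>
      have z'U: "z' \<in> cball z r" "z' \<in> U" using z' r by (auto simp: d_def dist_norm norm_minus_commute)
      let ?q' = "\<lambda>\<tau>. ((z', \<tau>), u (z', \<tau>))"
      have small: "norm (\<Delta> \<tau>) < d0 / 2" if "\<tau> \<in> T" for \<tau>
        using d1(2)[of "(z, \<tau>)" "(z', \<tau>)"] z'U z' that r(1) unfolding \<Delta>_def
        by (simp add: dist_Pair_Pair dist_norm d_def)
      have qq: "?q' \<tau> - ?q \<tau> = ((h, 0), \<Delta> \<tau>)" for \<tau> by (simp add: h_def \<Delta>_def)
      have nq: "norm ((h, 0::real), w) \<le> norm h + norm w" for w :: 'b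
        using norm_Pair_le[of "(h, 0::real)" w] norm_Pair_le[of h "0::real"] by simp
      have dist1: "norm (?q' \<tau> - ?q \<tau>) < d0" if "\<tau> \<in> T" for \<tau>
      proof -
        have "norm h < d0 / 2" using z' by (simp add: h_def d_def)
        then show ?thesis unfolding qq using nq[of "\<Delta> \<tau>"] small[OF that] by linarith
      qed
      have d\<Delta>: "(\<Delta> has_vector_derivative F (?q' \<tau>) - F (?q \<tau>)) (at \<tau> within T)" if "\<tau> \<in> T" for \<tau>
        unfolding \<Delta>_def
        by (rule has_vector_derivative_diff[OF has_vector_derivative_at_within[OF u(4)]
              has_vector_derivative_at_within[OF u(4)]]) (use z z'U that TI in auto)
      have \<Delta>le: "norm (\<Delta> \<tau>) \<le> L * norm h" if "\<tau> \<in> T" for \<tau>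
      proof -
        have "norm (\<Delta> \<tau>) \<le> 2 * ((Ly + 1) * norm h) + 4 * ((M + 1) * norm h)"
        proof (rule deriv_bound_growth[where a=a and R=\<Delta> and R'="\<lambda>\<tau>. F (?q' \<tau>) - F (?q \<tau>)"])
          fix \<tau> assume "\<tau> \<in> {-a..a}"
          then have \<tau>: "\<tau> \<in> T" by (simp add: T_def)
          show "(\<Delta> has_vector_derivative F (?q' \<tau>) - F (?q \<tau>)) (at \<tau> within {-a..a})"
            using d\<Delta>[OF \<tau>] by (simp add: T_def)
          \<comment> \<open>Intermediate point with the new parameter and the old state: the step
            from \<open>?q\<close> to \<open>?m\<close> is controlled by differentiability, the step
            from \<open>?m\<close> to \<open>?q'\<close> by the Lipschitz condition.\<close>
          let ?m = "((z', \<tau>), u (z, \<tau>))"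
          have m: "?m - ?q \<tau> = ((h, 0), 0)" by (simp add: h_def)
          have "norm (?m - ?q \<tau>) < d0" unfolding m using z' d0(1) by (simp add: h_def d_def)
          then have "norm (F ?m - F (?q \<tau>) - FD F (?q \<tau>) ((h, 0), 0)) \<le> \<epsilon> * norm h"
            using d0(2)[of "?q \<tau>" ?m] \<tau> by (simp add: K_def h_def)
          then have "norm (F ?m - F (?q \<tau>)) \<le> \<epsilon> * norm h + M * norm h"
            using M(2)[OF \<tau>, of h] norm_triangle_sub[of "F ?m - F (?q \<tau>)" "FD F (?q \<tau>) ((h, 0), 0)"]
            by linarith
          also have "\<dots> \<le> (M + 1) * norm h"
            using \<epsilon> mult_right_mono[of \<epsilon> 1 "norm h"] by (simp add: algebra_simps)
          finally have 1: "norm (F ?m - F (?q \<tau>)) \<le> (M + 1) * norm h" .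
          have 2: "norm (F (?q' \<tau>) - F ?m) \<le> norm (\<Delta> \<tau>) / 4"
            unfolding \<Delta>_def using z'U z \<tau> TI u(2) by (intro lip) auto
          show "norm (F (?q' \<tau>) - F (?q \<tau>)) \<le> norm (\<Delta> \<tau>) / 4 + (M + 1) * norm h"
            using 1 2 norm_triangle_ineq[of "F (?q' \<tau>) - F ?m" "F ?m - F (?q \<tau>)"] by simp
        next
          have "norm (y z' - y z) \<le> \<epsilon> * norm h + Ly * norm h"
            using d2(2)[of z'] z' Ly(2)[of h] norm_triangle_sub[of "y z' - y z" "FD y z h"]
            by (simp add: d_def h_def)
          also have "\<dots> \<le> (Ly + 1) * norm h"
            using \<epsilon> mult_right_mono[of \<epsilon> 1 "norm h"] by (simp add: algebra_simps)
          finally show "norm (\<Delta> 0) \<le> (Ly + 1) * norm h"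
            using u(3) z z'U by (simp add: \<Delta>_def)
        qed (use a that in \<open>auto simp: T_def\<close>)
        then show ?thesis by (simp add: L_def algebra_simps)
      qed
      let ?R = "\<lambda>\<tau>. \<Delta> \<tau> - W h \<tau>"
      let ?R' = "\<lambda>\<tau>. F (?q' \<tau>) - F (?q \<tau>) - FD F (?q \<tau>) ((h, 0), W h \<tau>)"
      have "norm (?R s) \<le> 2 * (\<epsilon> * norm h) + 4 * (\<epsilon> * ((1 + L) * norm h))"
      proof (rule deriv_bound_growth[where a=a and R'="?R'"])
        fix \<tau> assume "\<tau> \<in> {-a..a}"
        then have \<tau>: "\<tau> \<in> T" by (simp add: T_def)
        show "(?R has_vector_derivative ?R' \<tau>) (at \<tau> within {-a..a})"
          using d\<Delta>[OF \<tau>] W(3) \<tau> by (auto simp: T_def intro!: has_vector_derivative_diff)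
        \<comment> \<open>Splits the linearised term so that the remainder \<open>?R\<close> appears
          only under the state derivative. That part is bounded by a quarter of its norm, the rest
          by the error of linearisation.\<close>
        have "((h, 0::real), W h \<tau>) = ((h, 0), \<Delta> \<tau>) - (0, ?R \<tau>)" by simp
        then have eq: "FD F (?q \<tau>) ((h, 0), W h \<tau>) =
            FD F (?q \<tau>) ((h, 0), \<Delta> \<tau>) - FD F (?q \<tau>) (0, ?R \<tau>)"
          using linear_diff[OF has_derivative_linear[OF dF[OF qO[OF \<tau>]]]] by metis
        have "norm (F (?q' \<tau>) - F (?q \<tau>) - FD F (?q \<tau>) ((h, 0), \<Delta> \<tau>)) \<le> \<epsilon> * norm ((h, 0::real), \<Delta> \<tau>)"
          using d0(2)[of "?q \<tau>" "?q' \<tau>"] dist1[OF \<tau>] \<tau> unfolding qq by (simp add: K_def)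
        also have "\<dots> \<le> \<epsilon> * ((1 + L) * norm h)"
          using nq[of "\<Delta> \<tau>"] \<Delta>le[OF \<tau>] \<epsilon> by (intro mult_left_mono) (auto simp: algebra_simps)
        finally show "norm (?R' \<tau>) \<le> norm (?R \<tau>) / 4 + \<epsilon> * ((1 + L) * norm h)"
          using state[OF \<tau>, of "?R \<tau>"] unfolding eq
          using norm_triangle_ineq[of "F (?q' \<tau>) - F (?q \<tau>) - FD F (?q \<tau>) ((h, 0), \<Delta> \<tau>)"
              "FD F (?q \<tau>) (0, ?R \<tau>)"]
          by (simp add: algebra_simps)
      next
        show "norm (?R 0) \<le> \<epsilon> * norm h"
          using d2(2)[of z'] z' u(3) z z'U W(2) by (simp add: \<Delta>_def d_def h_def)
      qed (use a s in auto)
      also have "\<dots> = \<epsilon> * (2 + 4 * (1 + L)) * norm h" by (simp add: algebra_simps)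
      also have "\<dots> \<le> e * norm h" using \<epsilon>e by (intro mult_right_mono) auto
      finally show ?thesis by (simp add: \<Delta>_def h_def)
    qed
    then show ?thesis using d0 d1 d2 r by (intro exI[of _ d]) (auto simp: d_def)
  qed
  then show ?thesis
    using W(1) by (auto simp: has_derivative_at_alt linear_conv_bounded_linear)
qed

text \<open>Separates the base point from the state in the linearised right-hand side: only finitely
  many functions \<open>FD F (p, u p) q\<close> with fixed \<open>q\<close> occur, so joint
  continuity or \<open>Ck_on\<close> in the pair (p, w) follows from that of these
  functions.\<close>

lemma linear_pair_expansion:
  fixes L :: "'a::real_vector \<times> 'b::euclidean_space \<Rightarrow> 'c::real_vector"
  assumes "linear L"
  shows "L (x, w) = L (x, 0) + (\<Sum>c\<in>Basis. (w \<bullet> c) *\<^sub>R L (0, c))"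
proof -
  have "linear (\<lambda>w. L (0, w))"
    using linear_compose[OF _ assms, of "\<lambda>w. (0, w)"] by (simp add: o_def linear_iff)
  from linear_basis_expansion[OF this]
  have "L (0, w) = (\<Sum>c\<in>Basis. (w \<bullet> c) *\<^sub>R L (0, c))" .
  moreover have "L (x, w) = L (x, 0) + L (0, w)"
    using linear_add[OF assms, of "(x, 0)" "(0, w)"] by simp
  ultimately show ?thesis by simp
qed

text \<open>The linearised equation is solved on compact boxes with initial value
  \<open>FD y z v\<close>. By \<open>solution_has_derivative_parameter\<close> these solutions are
  the parameter derivatives of \<open>u\<close>; being continuous, they combine with the time
  derivative \<open>F (p, u p)\<close> to the full derivative.\<close>

lemma solution_C1:
  fixes F :: "('a::euclidean_space \<times> real) \<times> 'b::euclidean_space \<Rightarrow> 'b"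
  assumes U: "open U" and C: "open C" and I: "I = {-2<..<2}"
    and F: "Ck_on 1 F ((U \<times> I) \<times> C)"
    and lip: "\<And>p v w. p \<in> U \<times> I \<Longrightarrow> v \<in> C \<Longrightarrow> w \<in> C \<Longrightarrow> norm (F (p, v) - F (p, w)) \<le> norm (v - w) / 4"
    and y: "Ck_on 1 y U"
    and u: "continuous_on (U \<times> I) u" "u ` (U \<times> I) \<subseteq> C" "\<And>z. z \<in> U \<Longrightarrow> u (z, 0) = y z"
      "\<And>z s. z \<in> U \<Longrightarrow> s \<in> I \<Longrightarrow> ((\<lambda>s. u (z, s)) has_vector_derivative F ((z, s), u (z, s))) (at s)"
  obtains W where "\<And>v. continuous_on (U \<times> I) (W v)"
    "\<And>p. p \<in> U \<times> I \<Longrightarrow> (u has_derivative (\<lambda>(v, \<tau>). W v p + \<tau> *\<^sub>R F (p, u p))) (at p)"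
    "\<And>z v. z \<in> U \<Longrightarrow> W v (z, 0) = FD y z v"
    "\<And>z s v. z \<in> U \<Longrightarrow> s \<in> I \<Longrightarrow> ((\<lambda>s. W v (z, s)) has_vector_derivative
        FD F ((z, s), u (z, s)) ((v, 0), W v (z, s))) (at s)"
    "\<And>p w. p \<in> U \<times> I \<Longrightarrow> norm (FD F (p, u p) (0, w)) \<le> norm w / 4"
proof -
  define Om where "Om = (U \<times> I) \<times> C"
  have Om: "open Om" unfolding Om_def I by (intro open_Times U C open_greaterThanLessThan)
  have FO: "Ck_on (Suc 0) F Om" using F by (simp add: Om_def)
  have qO: "(p, u p) \<in> Om" if "p \<in> U \<times> I" for p using that u(2) by (auto simp: Om_def)
  have dF: "(F has_derivative FD F q) (at q)" if "q \<in> Om" for q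
    by (rule Ck_on_has_derivative[OF FO that])
  have dy: "(y has_derivative FD y z) (at z)" if "z \<in> U" for z
    using Ck_on_has_derivative[of 0 y U z] y that by simp
  have linF: "linear (FD F (p, u p))" if "p \<in> U \<times> I" for p
    using has_derivative_linear[OF dF[OF qO[OF that]]] .
  have state: "norm (FD F (p, u p) (0, w)) \<le> norm w / 4" if p: "p \<in> U \<times> I" for p w
  proof -
    have "((\<lambda>v. (p, v)) has_derivative (\<lambda>w. (0, w))) (at (u p))"
      by (intro has_derivative_Pair has_derivative_const has_derivative_ident)
    from has_derivative_compose[OF this, of F] dF[OF qO[OF p]]
    have "((\<lambda>v. F (p, v)) has_derivative (\<lambda>w. FD F (p, u p) (0, w))) (at (u p))"
      by blast
    then have "norm (FD F (p, u p) (0, w)) \<le> (1/4) * norm w"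
      by (rule lipschitz_imp_derivative_bound[OF _ C]) (use qO[OF p] lip p in \<open>auto simp: Om_def\<close>)
    then show ?thesis by simp
  qed
  have cDF: "continuous_on (U \<times> I) (\<lambda>p. FD F (p, u p) v)" for v
  proof (rule continuous_on_compose2[of Om "\<lambda>q. FD F q v"])
    show "continuous_on Om (\<lambda>q. FD F q v)"
      by (rule Ck_on_imp_continuous_on[OF Ck_on_frechet_derivative[OF FO]])
    show "continuous_on (U \<times> I) (\<lambda>p. (p, u p))" by (intro continuous_intros u)
  qed (use qO in auto)
  let ?G = "\<lambda>v p w. FD F (p, u p) ((v, 0), w)"
  have local: "\<exists>d a w. d > 0 \<and> 0 < a \<and> a < 2 \<and> \<bar>s\<bar> < a \<and> cball z d \<subseteq> U \<and>
      (\<forall>v. continuous_on (cball z d \<times> {-a..a}) (w v)) \<and>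
      (\<forall>z'\<in>cball z d. \<forall>v. w v (z', 0) = FD y z' v) \<and>
      (\<forall>z'\<in>cball z d. \<forall>s'\<in>{-a..a}. \<forall>v. ((\<lambda>s. w v (z', s)) has_vector_derivative ?G v (z', s') (w v (z', s'))) (at s' within {-a..a})) \<and>
      (\<forall>z'\<in>cball z d. \<forall>s'\<in>{-a..a}. ((\<lambda>z. u (z, s')) has_derivative (\<lambda>v. w v (z', s'))) (at z'))"
    if z: "z \<in> U" and s: "s \<in> I" for z s
  proof -
    obtain d where d: "d > 0" "cball z d \<subseteq> U" using U z open_contains_cball by blast
    \<comment> \<open>The midpoint of |s| and 2: the closed interval {-a..a} contains s in its
      interior and stays inside \<open>I\<close>.\<close>
    define a where "a = (\<bar>s\<bar> + 2) / 2"
    have a: "0 < a" "a < 2" "\<bar>s\<bar> < a" using s by (auto simp: a_def I)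
    let ?K = "cball z d" and ?T = "{-a..a}"
    have KT: "?K \<times> ?T \<subseteq> U \<times> I" using d a by (auto simp: I)
    have cD: "continuous_on (?K \<times> ?T) (\<lambda>p. FD F (p, u p) v)" for v
      by (rule continuous_on_subset[OF cDF KT])
    have cy: "continuous_on ?K (\<lambda>z. FD y z b)" for b
      using y d(2) by (auto intro: continuous_on_subset)
    have "\<exists>w. continuous_on (?K \<times> ?T) w \<and> (\<forall>z\<in>?K. w (z, 0) = FD y z b) \<and>
       (\<forall>z\<in>?K. \<forall>s\<in>?T. ((\<lambda>s. w (z, s)) has_vector_derivative ?G b (z, s) (w (z, s))) (at s within ?T))" for b
    proof -
      have cG: "continuous_on ((?K \<times> ?T) \<times> UNIV) (\<lambda>(p, w). ?G b p w)"
      proof -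
        have "continuous_on ((?K \<times> ?T) \<times> UNIV) (\<lambda>x. FD F (fst x, u (fst x)) v)" for v
          by (rule continuous_on_compose2[OF cD]) (auto intro: continuous_intros)
        then have "continuous_on ((?K \<times> ?T) \<times> UNIV)
          (\<lambda>x. ?G b (fst x) 0 + (\<Sum>c\<in>Basis. (snd x \<bullet> c) *\<^sub>R FD F (fst x, u (fst x)) (0, c)))"
          by (intro continuous_intros)
        then show ?thesis
        proof (rule continuous_on_eq)
          fix x :: "('a \<times> real) \<times> 'b" assume "x \<in> (?K \<times> ?T) \<times> UNIV"
          then have "fst x \<in> U \<times> I" using KT by auto
          from linear_pair_expansion[OF linF[OF this], of "(b, 0)" "snd x"]
          show "?G b (fst x) 0 + (\<Sum>c\<in>Basis. (snd x \<bullet> c) *\<^sub>R FD F (fst x, u (fst x)) (0, c)) =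
            (\<lambda>(p, w). ?G b p w) x"
            by (simp only: case_prod_beta)
        qed
      qed
      have lipG: "norm (?G b p v - ?G b p w) \<le> norm (v - w) / 4" if "p \<in> ?K \<times> ?T" for p v w
      proof -
        have "p \<in> U \<times> I" using that KT by blast
        then show ?thesis
          using linear_diff[OF linF, of p "((b, 0), v)" "((b, 0), w)"] state[of p "v - w"] by simp
      qed
      have "continuous_on (?K \<times> ?T) (\<lambda>p. (\<lambda>(p, w). ?G b p w) (p, FD y (fst p) b))"
        by (rule continuous_on_compose2[OF cG]) (auto intro!: continuous_intros continuous_on_compose2[OF cy])
      from compact_imp_bounded[OF compact_continuous_image[OF this compact_Times[OF compact_cball compact_Icc]]]
      obtain M where M: "\<forall>x\<in>(\<lambda>p. (\<lambda>(p, w). ?G b p w) (p, FD y (fst p) b)) ` (?K \<times> ?T). norm x \<le> M"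
        unfolding bounded_iff by blast
      show ?thesis
      proof (rule picard_parameters[where K="?K" and T="?T" and a=a and C=UNIV and F="?G b"
            and y="\<lambda>z. FD y z b" and M=M])
        show "norm (?G b (z', s') (FD y z' b)) \<le> M" if "z' \<in> ?K" "s' \<in> ?T" for z' s'
          using bspec[OF M imageI[of "(z', s')"]] that by simp
      qed (use a cG lipG cy in auto)
    qed
    then obtain w0 where w0: "\<And>b. continuous_on (?K \<times> ?T) (w0 b)"
      "\<And>b z. z \<in> ?K \<Longrightarrow> w0 b (z, 0) = FD y z b"
      "\<And>b z s. z \<in> ?K \<Longrightarrow> s \<in> ?T \<Longrightarrow> ((\<lambda>s. w0 b (z, s)) has_vector_derivative ?G b (z, s) (w0 b (z, s))) (at s within ?T)"
      by metis
    \<comment> \<open>The equation is solved for basis directions only. Combining these solutions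
      makes \<open>w v\<close> linear in \<open>v\<close> by construction, and linearity of the
      equation in (v, w) keeps it a solution.\<close>
    define w where "w v p = (\<Sum>b\<in>Basis. (v \<bullet> b) *\<^sub>R w0 b p)" for v p
    have w1: "continuous_on (?K \<times> ?T) (w v)" for v
      unfolding w_def by (intro continuous_intros w0)
    have expand: "L ((v, 0), \<Sum>b\<in>Basis. (v \<bullet> b) *\<^sub>R w b) = (\<Sum>b\<in>Basis. (v \<bullet> b) *\<^sub>R L ((b, 0), w b))"
      if "linear L" for L :: "('a \<times> real) \<times> 'b \<Rightarrow> 'b" and v w
    proof -
      have "((v, 0), \<Sum>b\<in>Basis. (v \<bullet> b) *\<^sub>R w b) = (\<Sum>b\<in>Basis. (v \<bullet> b) *\<^sub>R ((b, 0::real), w b))"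
        using euclidean_representation[of v] by (simp add: sum_prod)
      then show ?thesis by (simp only: linear_sum[OF that] linear_cmul[OF that])
    qed
    have w2: "w v (z', 0) = FD y z' v" if "z' \<in> ?K" for v z'
    proof -
      have L: "linear (FD y z')" using has_derivative_linear[OF dy] d that by blast
      show ?thesis unfolding linear_basis_expansion[OF L, of v] w_def w0(2)[OF that] ..
    qed
    have w3: "((\<lambda>s. w v (z', s)) has_vector_derivative ?G v (z', s') (w v (z', s'))) (at s' within ?T)"
      if "z' \<in> ?K" "s' \<in> ?T" for v z' s'
    proof -
      have m: "(z', s') \<in> U \<times> I" using that KT by blast
      have eq: "?G v (z', s') (w v (z', s')) = (\<Sum>b\<in>Basis. (v \<bullet> b) *\<^sub>R ?G b (z', s') (w0 b (z', s')))"
        unfolding w_def by (rule expand[OF linF[OF m]])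
      have "((\<lambda>s. \<Sum>b\<in>Basis. (v \<bullet> b) *\<^sub>R w0 b (z', s)) has_vector_derivative
          (\<Sum>b\<in>Basis. (v \<bullet> b) *\<^sub>R ?G b (z', s') (w0 b (z', s')))) (at s' within ?T)"
        by (intro has_vector_derivative_sum bounded_linear.has_vector_derivative[OF bounded_linear_scaleR_right] w0(3) that)
      then show ?thesis unfolding eq unfolding w_def .
    qed
    have w4: "((\<lambda>z. u (z, s')) has_derivative (\<lambda>v. w v (z', s'))) (at z')" if "z' \<in> ?K" "s' \<in> ?T" for z' s'
    proof (rule solution_has_derivative_parameter[OF U C I F lip y u, where a=a and W="\<lambda>v s. w v (z', s)"])
      show "linear (\<lambda>v. w v (z', s))" for s
        unfolding w_def by (simp add: linear_iff inner_left_distrib scaleR_left_distrib sum.distrib scaleR_right.sum)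
    qed (use that d a w2 w3 in auto)
    show ?thesis
      by (rule exI[of _ d], rule exI[of _ a], rule exI[of _ w]) (use d a w1 w2 w3 w4 in blast)
  qed
  \<comment> \<open>Defined as a derivative of \<open>u\<close> and hence independent of the box:
    the local solutions \<open>w\<close> agree with it on their boxes and so patch together.\<close>
  define W where "W v p = FD (\<lambda>z. u (z, snd p)) (fst p) v" for v p
  have loc: "\<exists>N. open N \<and> (z, s) \<in> N \<and> N \<subseteq> U \<times> I \<and> continuous_on N (W v)"
    and dz: "((\<lambda>z. u (z, s)) has_derivative (\<lambda>v. W v (z, s))) (at z)"
    and W0: "W v (z, 0) = FD y z v"
    and Ws: "((\<lambda>s. W v (z, s)) has_vector_derivative ?G v (z, s) (W v (z, s))) (at s)"
    if zs: "z \<in> U" "s \<in> I" for z s v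
  proof -
    obtain d a w where w: "d > 0" "0 < a" "a < 2" "\<bar>s\<bar> < a" "cball z d \<subseteq> U"
      "\<And>v. continuous_on (cball z d \<times> {-a..a}) (w v)"
      "\<And>z' v. z'\<in>cball z d \<Longrightarrow> w v (z', 0) = FD y z' v"
      "\<And>z' s' v. z'\<in>cball z d \<Longrightarrow> s'\<in>{-a..a} \<Longrightarrow>
         ((\<lambda>s. w v (z', s)) has_vector_derivative ?G v (z', s') (w v (z', s'))) (at s' within {-a..a})"
      "\<And>z' s'. z'\<in>cball z d \<Longrightarrow> s'\<in>{-a..a} \<Longrightarrow> ((\<lambda>z. u (z, s')) has_derivative (\<lambda>v. w v (z', s'))) (at z')"
      using local[OF zs] by blast
    have eq: "W v (z', s') = w v (z', s')" if "z' \<in> cball z d" "s' \<in> {-a..a}" for z' s' v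
      using fun_cong[OF frechet_derivative_at[OF w(9)[OF that]], of v] by (simp add: W_def)
    show "\<exists>N. open N \<and> (z, s) \<in> N \<and> N \<subseteq> U \<times> I \<and> continuous_on N (W v)"
    proof (intro exI conjI)
      show "open (ball z d \<times> {-a<..<a})" by (intro open_Times open_ball open_greaterThanLessThan)
      show "continuous_on (ball z d \<times> {-a<..<a}) (W v)"
        by (rule continuous_on_eq[OF continuous_on_subset[OF w(6)[of v]]]) (auto simp: eq)
    qed (use w I in \<open>auto simp: subset_iff\<close>)
    have zd: "z \<in> cball z d" "s \<in> {-a..a}" "0 \<in> {-a..a}" using w by auto
    show "((\<lambda>z. u (z, s)) has_derivative (\<lambda>v. W v (z, s))) (at z)"
      using w(9)[OF zd(1,2)] eq[OF zd(1,2)] by simp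
    show "W v (z, 0) = FD y z v"
      using w(7)[OF zd(1)] eq[OF zd(1,3)] by simp
    have "((\<lambda>s. w v (z, s)) has_vector_derivative ?G v (z, s) (w v (z, s))) (at s within {-a<..<a})"
      by (rule has_vector_derivative_within_subset[OF w(8)[OF zd(1,2)]]) auto
    moreover have "at s within {-a<..<a} = at s"
      using w(4) by (intro at_within_open) auto
    ultimately have "((\<lambda>s. w v (z, s)) has_vector_derivative ?G v (z, s) (w v (z, s))) (at s)"
      by simp
    then have "((\<lambda>s. W v (z, s)) has_vector_derivative ?G v (z, s) (w v (z, s))) (at s)"
      by (rule has_vector_derivative_transform_within_open[of _ _ _ "{-a<..<a}"]) (use w(4) zd eq in auto)
    then show "((\<lambda>s. W v (z, s)) has_vector_derivative ?G v (z, s) (W v (z, s))) (at s)"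
      using eq[OF zd(1,2)] by simp
  qed
  show thesis
  proof (rule that[of W])
    show "continuous_on (U \<times> I) (W v)" for v
    proof (rule continuous_at_imp_continuous_on, safe)
      fix z s assume "z \<in> U" "s \<in> I"
      from loc[OF this, of v] show "isCont (W v) (z, s)"
        using continuous_on_eq_continuous_at by blast
    qed
    fix p assume "p \<in> U \<times> I"
    then obtain z s where p: "p = (z, s)" "z \<in> U" "s \<in> I" by auto
    \<comment> \<open>The partial derivative in time is continuous in both variables, so the one in
      the parameter is asked for at the single point (z, s).\<close>
    have "((\<lambda>(x, y). u (x, y)) has_derivative (\<lambda>(tx, ty). W tx (z, s) + blinfun_scaleR_left (F ((z, s), u (z, s))) ty)) (at (z, s) within U \<times> I)"
    proof (rule has_derivative_partialsI[where fy="\<lambda>x y. blinfun_scaleR_left (F ((x, y), u (x, y)))"])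
      show "((\<lambda>x. u (x, s)) has_derivative (\<lambda>v. W v (z, s))) (at z within U)"
        by (rule has_derivative_at_withinI[OF dz[OF p(2,3)]])
      show "((\<lambda>y. u (x, y)) has_derivative blinfun_apply (blinfun_scaleR_left (F ((x, y), u (x, y))))) (at y within I)"
        if "x \<in> U" "y \<in> I" for x y
        using u(4)[OF that] has_derivative_at_withinI by (auto simp: has_vector_derivative_def)
      have "continuous_on (U \<times> I) (\<lambda>p. F (p, u p))"
      proof (rule continuous_on_compose2[OF Ck_on_imp_continuous_on[OF FO]])
        show "continuous_on (U \<times> I) (\<lambda>p. (p, u p))" by (intro continuous_intros u)
      qed (use qO in auto)
      then have "continuous (at (z, s) within U \<times> I) (\<lambda>p. F (p, u p))"
        using p by (auto simp: continuous_on_eq_continuous_within)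
      from bounded_linear.continuous[OF bounded_linear_blinfun_scaleR_left this]
      show "continuous (at (z, s) within U \<times> I) (\<lambda>(x, y). blinfun_scaleR_left (F ((x, y), u (x, y))))"
        by (simp add: case_prod_beta')
    qed (use p I in \<open>auto\<close>)
    moreover have "open (U \<times> I)" unfolding I by (intro open_Times U open_greaterThanLessThan)
    ultimately show "(u has_derivative (\<lambda>(v, \<tau>). W v p + \<tau> *\<^sub>R F (p, u p))) (at p)"
      using p by (simp add: at_within_open[of "(z, s)" "U \<times> I"])
  next
    show "W v (z, 0) = FD y z v" if "z \<in> U" for z v
      using W0[OF that, of 0] by (simp add: I)
  qed (use Ws state in auto)
qed

theorem solution_Ck:
  fixes F :: "('a::euclidean_space \<times> real) \<times> 'b::euclidean_space \<Rightarrow> 'b"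
  assumes U: "open U" and I: "I = {-2<..<2}" and C: "open C"
    and F: "Ck_on k F ((U \<times> I) \<times> C)"
    and lip: "\<And>p v w. p \<in> U \<times> I \<Longrightarrow> v \<in> C \<Longrightarrow> w \<in> C \<Longrightarrow> norm (F (p, v) - F (p, w)) \<le> norm (v - w) / 4"
    and y: "Ck_on k y U"
    and u: "continuous_on (U \<times> I) u" "u ` (U \<times> I) \<subseteq> C" "\<And>z. z \<in> U \<Longrightarrow> u (z, 0) = y z"
      "\<And>z s. z \<in> U \<Longrightarrow> s \<in> I \<Longrightarrow> ((\<lambda>s. u (z, s)) has_vector_derivative F ((z, s), u (z, s))) (at s)"
  shows "Ck_on k u (U \<times> I)"
  using C F lip y u
proof (induction k arbitrary: F C y u)
  case 0
  then show ?case by simp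
next
  case (Suc k)
  note C = Suc.prems(1) and F = Suc.prems(2) and lip = Suc.prems(3) and y = Suc.prems(4) and u = Suc.prems(5-8)
  have UI: "open (U \<times> I)" unfolding I by (intro open_Times U open_greaterThanLessThan)
  have UIU: "open ((U \<times> I) \<times> (UNIV :: 'b set))" by (intro open_Times UI open_UNIV)
  have UIC: "open ((U \<times> I) \<times> C)" by (intro open_Times UI C)
  have F1: "Ck_on 1 F ((U \<times> I) \<times> C)" and y1: "Ck_on 1 y U"
    by (rule Ck_on_le[OF F], simp, rule Ck_on_le[OF y], simp)
  obtain W where W: "\<And>v. continuous_on (U \<times> I) (W v)"
    "\<And>p. p \<in> U \<times> I \<Longrightarrow> (u has_derivative (\<lambda>(v, \<tau>). W v p + \<tau> *\<^sub>R F (p, u p))) (at p)"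
    "\<And>z v. z \<in> U \<Longrightarrow> W v (z, 0) = FD y z v"
    "\<And>z s v. z \<in> U \<Longrightarrow> s \<in> I \<Longrightarrow> ((\<lambda>s. W v (z, s)) has_vector_derivative
        FD F ((z, s), u (z, s)) ((v, 0), W v (z, s))) (at s)"
    "\<And>p w. p \<in> U \<times> I \<Longrightarrow> norm (FD F (p, u p) (0, w)) \<le> norm w / 4"
    by (rule solution_C1[OF U C I F1 lip y1 u]) blast+
  \<comment> \<open>The induction hypothesis for the same equation, one order lower. It makes the
    coefficients \<open>FD F (p, u p) q\<close> of the linearised equation
    \<open>Ck_on k\<close>.\<close>
  have uk: "Ck_on k u (U \<times> I)"
    by (rule Suc.IH[OF C Ck_on_lower[OF F] lip Ck_on_lower[OF y] u])
  have qC: "(p, u p) \<in> (U \<times> I) \<times> C" if "p \<in> U \<times> I" for p using u(2) that by auto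
  have linF: "linear (FD F (p, u p))" if "p \<in> U \<times> I" for p
    using has_derivative_linear[OF Ck_on_has_derivative[OF F qC[OF that]]] .
  \<comment> \<open>The induction hypothesis for the linearised equation. Its right-hand side is
    defined for every state, so the state set is now \<open>UNIV\<close>; this is why
    \<open>C\<close>, \<open>F\<close>, \<open>y\<close> and \<open>u\<close> are generalised in the
    induction.\<close>
  have Wk: "Ck_on k (W v) (U \<times> I)" for v
  proof (rule Suc.IH[where F="\<lambda>(p, w). FD F (p, u p) ((v, 0), w)" and C=UNIV
        and y="\<lambda>z. FD y z v"])
    show "Ck_on k (\<lambda>(p, w). FD F (p, u p) ((v, 0), w)) ((U \<times> I) \<times> UNIV)"
    proof (rule Ck_on_cong[OF UIU])
      have fst: "Ck_on k fst ((U \<times> I) \<times> (UNIV :: 'b set))"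
        by (rule Ck_on_bounded_linear[OF UIU bounded_linear_fst])
      have ufst: "Ck_on k (\<lambda>x. u (fst x)) ((U \<times> I) \<times> (UNIV :: 'b set))"
        by (rule Ck_on_compose[OF UIU UI _ fst uk]) auto
      have "Ck_on k (\<lambda>x. FD F (fst x, u (fst x)) q) ((U \<times> I) \<times> (UNIV :: 'b set))" for q
        by (rule Ck_on_compose[OF UIU UIC _ Ck_on_Pair[OF UIU fst ufst] Ck_on_frechet_derivative[OF F]])
          (use qC in auto)
      moreover have "Ck_on k snd ((U \<times> I) \<times> (UNIV :: 'b set))"
        by (rule Ck_on_bounded_linear[OF UIU bounded_linear_snd])
      ultimately show "Ck_on k (\<lambda>x. FD F (fst x, u (fst x)) ((v, 0), 0) +
          (\<Sum>c\<in>Basis. (snd x \<bullet> c) *\<^sub>R FD F (fst x, u (fst x)) (0, c))) ((U \<times> I) \<times> (UNIV :: 'b set))"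
        by (intro Ck_on_add Ck_on_sum Ck_on_scaleR Ck_on_inner Ck_on_const UIU)
      fix x :: "('a \<times> real) \<times> 'b" assume "x \<in> (U \<times> I) \<times> UNIV"
      then have "fst x \<in> U \<times> I" by auto
      from linear_pair_expansion[OF linF[OF this], of "(v, 0)" "snd x"]
      show "FD F (fst x, u (fst x)) ((v, 0), 0) +
          (\<Sum>c\<in>Basis. (snd x \<bullet> c) *\<^sub>R FD F (fst x, u (fst x)) (0, c)) =
          (case x of (p, w) \<Rightarrow> FD F (p, u p) ((v, 0), w))"
        by (simp only: case_prod_beta)
    qed
    show "norm ((case (p, v') of (p, w) \<Rightarrow> FD F (p, u p) ((v, 0), w)) -
         (case (p, w) of (p, w) \<Rightarrow> FD F (p, u p) ((v, 0), w))) \<le> norm (v' - w) / 4"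
      if "p \<in> U \<times> I" for p v' w
      using linear_diff[OF linF[OF that], of "((v, 0), v')" "((v, 0), w)"] W(5)[OF that, of "v' - w"] by simp
    show "Ck_on k (\<lambda>z. FD y z v) U" by (rule Ck_on_frechet_derivative[OF y])
  qed (use W in auto)
  show ?case
  proof (rule Ck_on_SucI[OF UI W(2)])
    fix q :: "'a \<times> real"
    have "Ck_on k (\<lambda>p. F (p, u p)) (U \<times> I)"
      by (rule Ck_on_compose[OF UI UIC _ Ck_on_Pair[OF UI _ uk] Ck_on_lower[OF F]])
        (use qC in \<open>auto intro: Ck_on_bounded_linear UI bounded_linear_ident\<close>)
    then have "Ck_on k (\<lambda>p. W (fst q) p + snd q *\<^sub>R F (p, u p)) (U \<times> I)"
      by (intro Ck_on_add Ck_on_scaleR Ck_on_const UI Wk)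
    then show "Ck_on k (\<lambda>p. case q of (v, \<tau>) \<Rightarrow> W v p + \<tau> *\<^sub>R F (p, u p)) (U \<times> I)"
      by (simp add: case_prod_beta)
  qed
qed

section \<open>The inverse function theorem for smooth maps\<close>

lemma smooth_onD: "smooth_on f S \<Longrightarrow> Ck_on k f S"
  by (simp add: smooth_on_def)

lemma smooth_on_has_derivative:
  "smooth_on f S \<Longrightarrow> x \<in> S \<Longrightarrow> (f has_derivative FD f x) (at x)"
  by (rule Ck_on_has_derivative[OF smooth_onD])

lemma smooth_on_frechet_derivative:
  "smooth_on f S \<Longrightarrow> smooth_on (\<lambda>x. FD f x v) S"
  unfolding smooth_on_def using Ck_on_frechet_derivative by blast

lemma smooth_on_subset: "smooth_on f S \<Longrightarrow> T \<subseteq> S \<Longrightarrow> smooth_on f T"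
  unfolding smooth_on_def using Ck_on_subset by blast

lemma smooth_on_cong: "open S \<Longrightarrow> (\<And>x. x \<in> S \<Longrightarrow> f x = g x) \<Longrightarrow> smooth_on f S \<Longrightarrow> smooth_on g S"
  unfolding smooth_on_def using Ck_on_cong by blast

lemma smooth_on_compose:
  fixes f :: "'b::euclidean_space \<Rightarrow> 'c::real_normed_vector"
  shows "open S \<Longrightarrow> open T \<Longrightarrow> g ` S \<subseteq> T \<Longrightarrow> smooth_on g S \<Longrightarrow> smooth_on f T \<Longrightarrow> smooth_on (\<lambda>x. f (g x)) S"
  unfolding smooth_on_def using Ck_on_compose by blast

lemma matrix_frechet_mult:
  fixes f :: "real^'n::finite \<Rightarrow> real^'m::finite"
  assumes "(f has_derivative f') (at x)"
  shows "matrix f' *v v = f' v"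
  using matrix_vector_mul(2)[OF has_derivative_linear[OF assms]] by metis

lemma det_matrix_nonzero:
  fixes L :: "real^'n::finite \<Rightarrow> real^'n"
  assumes "linear L" "\<And>v. L v = 0 \<Longrightarrow> v = 0"
  shows "det (matrix L) \<noteq> 0"
proof -
  have "inj L" using assms by (simp add: linear_injective_0)
  then have "inj ((*v) (matrix L))" using matrix_vector_mul(2)[OF assms(1)] by simp
  then show ?thesis
    using matrix_left_invertible_injective invertible_left_inverse invertible_det_nz by blast
qed

text \<open>Bootstrapping: the derivative of the inverse map is the inverse matrix of
  \<open>FD f\<close> at \<open>g y\<close>, which is \<open>Ck_on k\<close> as soon as
  \<open>g\<close> is; then \<open>g\<close> is one order better.\<close>

lemma Ck_on_inverse_function:
  fixes f :: "real^'n::finite \<Rightarrow> real^'n"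
  assumes T: "open T" and S: "open S" and g: "g ` T \<subseteq> S" and f: "smooth_on f S"
    and der: "\<And>y. y \<in> T \<Longrightarrow> (g has_derivative g' y) (at y)"
    and g': "\<And>y v. y \<in> T \<Longrightarrow> FD f (g y) (g' y v) = v"
    and inj: "\<And>y v. y \<in> T \<Longrightarrow> FD f (g y) v = 0 \<Longrightarrow> v = 0"
  shows "Ck_on k g T"
proof (induction k)
  case 0
  have "continuous_on T g"
    using der has_derivative_continuous continuous_at_imp_continuous_on by blast
  then show ?case by simp
next
  case (Suc k)
  let ?A = "\<lambda>y. matrix (FD f (g y))"
  have df: "(f has_derivative FD f (g y)) (at (g y))" if "y \<in> T" for y
    using smooth_on_has_derivative[OF f] g that by blast
  have det: "det (?A y) \<noteq> 0" if "y \<in> T" for y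
    by (rule det_matrix_nonzero[OF has_derivative_linear[OF df[OF that]] inj[OF that]])
  have "?A y $ i $ j = FD f (g y) (axis j 1) $ i" for i j y
    by (simp add: matrix_def)
  moreover have "Ck_on k (\<lambda>y. FD f (g y) v) T" for v
    by (rule Ck_on_compose[OF T S g Suc smooth_onD[OF smooth_on_frechet_derivative[OF f]]])
  ultimately have "Ck_on k (\<lambda>y. \<chi> i j. ?A y $ i $ j) T"
    by (intro Ck_on_vec_lambda T) (simp add: Ck_on_vec_nth T del: vec_lambda_eta)
  then have A: "Ck_on k ?A T" by simp
  show ?case
  proof (rule Ck_on_SucI[OF T der])
    fix v
    show "Ck_on k (\<lambda>y. g' y v) T"
    proof (rule Ck_on_cong[OF T _ Ck_on_matrix_inv_mult[OF T A Ck_on_const[OF T] det]])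
      fix y assume y: "y \<in> T"
      have "?A y *v g' y v = v" using matrix_frechet_mult[OF df[OF y]] g'[OF y] by simp
      then have "matrix_inv (?A y) *v v = matrix_inv (?A y) *v (?A y *v g' y v)" by simp
      then show "matrix_inv (?A y) *v v = g' y v"
        by (simp add: matrix_vector_mul_assoc matrix_inv[OF det[OF y]])
    qed
  qed
qed

text \<open>The inverse function theorem supplies a differentiable inverse, which the preceding
  lemma makes smooth. The domain is cut down to a ball because the coordinate range has to be convex
  when the metric is integrated along segments.\<close>

lemma smooth_inverse_function:
  fixes f :: "real^'n::finite \<Rightarrow> real^'n"
  assumes U: "open U" "x \<in> U" and f: "smooth_on f U"
    and inj: "\<And>v. FD f x v = 0 \<Longrightarrow> v = 0"
  obtains r g where "r > 0" "ball x r \<subseteq> U" "open (f ` ball x r)" "homeomorphism (ball x r) (f ` ball x r) f g"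
    "smooth_on g (f ` ball x r)" "\<And>z v. z \<in> ball x r \<Longrightarrow> FD f z v = 0 \<Longrightarrow> v = 0"
proof -
  let ?f' = "\<lambda>z. Blinfun (FD f z)"
  have app: "blinfun_apply (?f' z) = FD f z" if "z \<in> U" for z
    using bounded_linear_Blinfun_apply[OF has_derivative_bounded_linear[OF smooth_on_has_derivative[OF f that]]] .
  have der: "(f has_derivative blinfun_apply (?f' z)) (at z)" if "z \<in> U" for z
    using smooth_on_has_derivative[OF f that] app[OF that] by simp
  have cont: "continuous_on U ?f'"
  proof (rule continuous_on_blinfun_componentwise)
    fix b :: "real^'n"
    have "continuous_on U (\<lambda>z. FD f z b)"
      by (rule Ck_on_imp_continuous_on[OF smooth_onD[OF smooth_on_frechet_derivative[OF f], of 0]])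
    then show "continuous_on U (\<lambda>z. blinfun_apply (?f' z) b)"
      by (rule continuous_on_eq) (simp add: app)
  qed
  have lin: "linear (FD f x)"
    using has_derivative_linear[OF smooth_on_has_derivative[OF f U(2)]] .
  have "inj (FD f x)"
    using inj lin by (simp add: linear_injective_0)
  from linear_injective_left_inverse[OF lin this]
  obtain h where h: "linear h" "h \<circ> FD f x = id" by blast
  have happ: "h (FD f x v) = v" for v
    using h(2) by (metis comp_apply id_apply)
  have "Blinfun h o\<^sub>L ?f' x = id_blinfun"
    by (rule blinfun_eqI)
      (use h(1) happ in \<open>simp add: app[OF U(2)] bounded_linear_Blinfun_apply linear_conv_bounded_linear\<close>)
  from inverse_function_theorem[OF U(1) der cont U(2) this]
  obtain U' V g g' where g: "open U'" "U' \<subseteq> U" "x \<in> U'" "open V" "homeomorphism U' V f g"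
    "\<And>y. y \<in> V \<Longrightarrow> (g has_derivative (g' y)) (at y)"
    "\<And>y. y \<in> V \<Longrightarrow> g' y = inv (blinfun_apply (?f' (g y)))"
    "\<And>y. y \<in> V \<Longrightarrow> bij (blinfun_apply (?f' (g y)))" by metis
  obtain r where r: "r > 0" "ball x r \<subseteq> U'" using g(1,3) openE by blast
  have hom: "homeomorphism (ball x r) (f ` ball x r) f g"
    by (rule homeomorphism_of_subsets[OF g(5)]) (use r in auto)
  have "openin (top_of_set V) (f ` ball x r)"
    using homeomorphism_imp_open_map[OF g(5), of "ball x r"] r by (simp add: openin_open_eq[OF g(1)])
  then have op: "open (f ` ball x r)" using g(4) openin_open_trans by blast
  have sub: "f ` ball x r \<subseteq> V" using g(5) r by (auto simp: homeomorphism_def)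
  have gy: "g y \<in> ball x r" if "y \<in> f ` ball x r" for y
    using hom that by (auto simp: homeomorphism_def)
  have gU: "g y \<in> U" if "y \<in> f ` ball x r" for y using gy[OF that] r g(2) by blast
  have injU: "v = 0" if z: "z \<in> ball x r" and v: "FD f z v = 0" for z v
  proof -
    have "f z \<in> V" "g (f z) = z" "z \<in> U" using z sub hom r g(2) by (auto simp: homeomorphism_def)
    then have "bij (FD f z)" using g(8)[of "f z"] app by simp
    moreover have "FD f z 0 = 0"
      using linear_0[OF has_derivative_linear[OF smooth_on_has_derivative[OF f \<open>z \<in> U\<close>]]] .
    ultimately show "v = 0" using v by (metis bij_is_inj injD)
  qed
  have "Ck_on k g (f ` ball x r)" for k
  proof (rule Ck_on_inverse_function[OF op U(1) _ f g(6)])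
    fix y v assume y: "y \<in> f ` ball x r"
    have "y \<in> V" using y sub by blast
    then show "FD f (g y) (g' y v) = v"
      using g(7,8)[of y] app[OF gU[OF y]] by (simp add: bij_is_surj surj_f_inv_f)
    show "v = 0" if "FD f (g y) v = 0"
      using injU[OF gy[OF y] that] .
  qed (use gU sub in auto)
  then show thesis
    using that[OF r(1) _ op hom] r g(2) injU by (auto simp: smooth_on_def)
qed

section \<open>Straightening commuting vector fields\<close>

lemma Ck_on_lipschitz_compact_convex:
  fixes f :: "'a::euclidean_space \<Rightarrow> 'b::real_normed_vector"
  assumes f: "Ck_on 1 f S" and K: "compact K" "convex K" "K \<subseteq> S"
  obtains B where "B \<ge> 0" "\<And>x y. x \<in> K \<Longrightarrow> y \<in> K \<Longrightarrow> norm (f x - f y) \<le> B * norm (x - y)"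
proof -
  have f1: "Ck_on (Suc 0) f S" using f by simp
  define N where "N x = (\<Sum>b\<in>Basis. norm (FD f x b))" for x
  have "continuous_on S (\<lambda>x. FD f x b)" for b
    by (rule Ck_on_imp_continuous_on[OF Ck_on_frechet_derivative[OF f1]])
  then have "continuous_on K N"
    unfolding N_def using K(3) by (intro continuous_intros) (auto intro: continuous_on_subset)
  from compact_imp_bounded[OF compact_continuous_image[OF this K(1)]]
  obtain B where B: "\<And>x. x \<in> K \<Longrightarrow> \<bar>N x\<bar> \<le> B" unfolding bounded_real by blast
  have "norm (f x - f y) \<le> max 0 B * norm (x - y)" if "x \<in> K" "y \<in> K" for x y
  proof (rule differentiable_bound[OF K(2) _ _ that])
    fix x assume x: "x \<in> K"
    have d: "(f has_derivative FD f x) (at x)"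
      using Ck_on_has_derivative[OF f1] K x by blast
    then show "(f has_derivative FD f x) (at x within K)"
      by (rule has_derivative_at_withinI)
    show "onorm (FD f x) \<le> max 0 B"
    proof (rule onorm_bound)
      fix v
      have "norm (FD f x v) \<le> norm v * N x"
        unfolding N_def by (rule linear_norm_le_basis[OF has_derivative_linear[OF d]])
      also have "\<dots> \<le> norm v * max 0 B"
        using B[OF x] by (intro mult_left_mono) auto
      finally show "norm (FD f x v) \<le> max 0 B * norm v"
        by (simp only: mult.commute)
    qed simp
  qed
  then show thesis using that[of "max 0 B"] by simp
qed

text \<open>\<open>a i\<close> annihilates the span of the other \<open>b j\<close> but not
  \<open>b i\<close>, so the \<open>b j\<close> are independent. This bounds the number of
  orthogonal weights by the dimension.\<close>

lemma dual_system_card: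
  fixes a b :: "'i \<Rightarrow> 'a::euclidean_space"
  assumes "finite I" "\<And>i j. i \<in> I \<Longrightarrow> j \<in> I \<Longrightarrow> a i \<bullet> b j = (if i = j then 1 else 0)"
  shows "card I \<le> DIM('a)"
proof -
  have "inj_on b I"
  proof (rule inj_onI)
    fix i j assume "i \<in> I" "j \<in> I" "b i = b j"
    then show "i = j" using assms(2)[of i i] assms(2)[of i j] by (auto split: if_splits)
  qed
  moreover have "independent (b ` I)"
    unfolding dependent_def
  proof safe
    fix i assume i: "i \<in> I" "b i \<in> span (b ` I - {b i})"
    have "span (b ` I - {b i}) \<subseteq> {x. a i \<bullet> x = 0}"
      by (rule span_minimal) (use assms(2) i(1) in \<open>auto simp: subspace_hyperplane\<close>)
    then show False using i assms(2)[OF i(1) i(1)] by auto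
  qed
  ultimately show ?thesis using independent_bound[of "b ` I"] card_image by fastforce
qed

text \<open>The common kernel of the independent covectors \<open>a k\<close> and the coordinate
  subspace on which the components in \<open>J\<close> vanish have the same dimension, so some
  linear \<open>l\<close> maps the second isomorphically onto the first. It provides directions
  tangent to all level sets.\<close>

lemma kernel_parametrisation:
  fixes a b :: "'n::finite \<Rightarrow> real^'n"
  assumes dual: "\<And>i j. i \<in> J \<Longrightarrow> j \<in> J \<Longrightarrow> a i \<bullet> b j = (if i = j then 1 else 0)"
  obtains l :: "real^'n \<Rightarrow> real^'n" where "linear l"
    "\<And>v k. (\<And>k. k \<in> J \<Longrightarrow> v $ k = 0) \<Longrightarrow> k \<in> J \<Longrightarrow> a k \<bullet> l v = 0"
    "\<And>v. (\<And>k. k \<in> J \<Longrightarrow> v $ k = 0) \<Longrightarrow> l v = 0 \<Longrightarrow> v = 0"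
proof -
  define V' where "V' = {v :: real^'n. \<forall>k. k \<notin> J \<longrightarrow> v $ k = 0}"
  define G where "G v = (\<Sum>k\<in>J. v $ k *\<^sub>R a k)" for v :: "real^'n"
  have V': "subspace V'" by (auto simp: V'_def subspace_def)
  have G: "linear G" by (auto simp: G_def linear_iff scaleR_left_distrib sum.distrib scaleR_right.sum)
  have Gb: "G v \<bullet> b j = v $ j" if "j \<in> J" for v j
  proof -
    have "G v \<bullet> b j = (\<Sum>k\<in>J. v $ k * (if k = j then 1 else 0))"
      unfolding G_def inner_sum_left using that by (intro sum.cong) (auto simp: dual)
    also have "\<dots> = v $ j" using that by (simp add: if_distrib cong: if_cong)
    finally show ?thesis .
  qed
  \<comment> \<open>Pairing with the dual vectors \<open>b j\<close> recovers the coefficients of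
    \<open>G v\<close>, so the \<open>a k\<close> span a space of dimension \<open>dim V'\<close>.
    Its orthogonal complement \<open>W\<close> then has the dimension of \<open>V\<close>.\<close>
  have injG: "inj_on G (span V')"
  proof (rule inj_onI)
    fix v w assume "v \<in> span V'" "w \<in> span V'" and eq: "G v = G w"
    then have "v \<in> V'" "w \<in> V'" using span_minimal[OF subset_refl V'] by blast+
    then have "v $ j = w $ j" for j
      using Gb[of j v] Gb[of j w] eq by (cases "j \<in> J") (auto simp: V'_def)
    then show "v = w" by (simp add: vec_eq_iff)
  qed
  define V where "V = {y \<in> UNIV. \<forall>x\<in>V'. orthogonal x y}"
  define W where "W = {y \<in> UNIV. \<forall>x\<in>G ` V'. orthogonal x y}"
  have "dim V + dim V' = dim (UNIV :: (real^'n) set)"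
    unfolding V_def by (rule dim_subspace_orthogonal_to_vectors) (auto simp: V')
  moreover have "dim W + dim (G ` V') = dim (UNIV :: (real^'n) set)"
    unfolding W_def by (rule dim_subspace_orthogonal_to_vectors) (auto intro: linear_subspace_image G V')
  moreover have "dim (G ` V') = dim V'" by (rule dim_image_eq[OF G injG])
  ultimately have "dim V = dim W" by simp
  moreover have sV: "subspace V" "subspace W"
    by (auto simp: V_def W_def subspace_def orthogonal_def inner_add_right)
  ultimately obtain l where l: "linear l" "l ` V = W" "inj_on l V"
    using subspace_isomorphism by blast
  have inV: "v \<in> V" if "\<And>k. k \<in> J \<Longrightarrow> v $ k = 0" for v
  proof -
    have "x $ i * v $ i = 0" if "x \<in> V'" for x i
      using that \<open>\<And>k. k \<in> J \<Longrightarrow> v $ k = 0\<close> by (cases "i \<in> J") (auto simp: V'_def)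
    then show ?thesis unfolding V_def orthogonal_def inner_vec_def by (auto intro!: sum.neutral)
  qed
  show thesis
  proof (rule that[OF l(1)])
    fix v :: "real^'n" and k assume v: "\<And>k. k \<in> J \<Longrightarrow> v $ k = 0" and k: "k \<in> J"
    have "l v \<in> W" using l(2) inV[OF v] by blast
    moreover have "axis k 1 \<in> V'" using k by (auto simp: V'_def axis_def)
    moreover have "G (axis k 1) = (\<Sum>i\<in>J. if i = k then a i else 0)"
      unfolding G_def by (rule sum.cong) (auto simp: axis_def)
    then have "G (axis k 1) = a k" using k by simp
    ultimately show "a k \<bullet> l v = 0" by (auto simp: W_def orthogonal_def)
  next
    fix v :: "real^'n" assume v: "\<And>k. k \<in> J \<Longrightarrow> v $ k = 0" and "l v = 0"
    moreover have "0 \<in> V" "l 0 = 0" using sV(1) subspace_0 linear_0[OF l(1)] by auto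
    ultimately show "v = 0" using inj_onD[OF l(3), of v 0] inV[OF v] by simp
  qed
qed

lemma linear_functional_inner:
  fixes L :: "real^'n::finite \<Rightarrow> real"
  assumes "linear L"
  shows "(\<chi> i. L (axis i 1)) \<bullet> w = L w"
proof -
  have "L w = L (\<Sum>i\<in>UNIV. w $ i *\<^sub>R axis i 1)"
    using basis_expansion[of w] by (simp add: scalar_mult_eq_scaleR)
  also have "\<dots> = (\<Sum>i\<in>UNIV. w $ i * L (axis i 1))"
    by (simp add: linear_sum[OF assms] linear_cmul[OF assms])
  finally show ?thesis by (simp add: inner_vec_def mult.commute)
qed

text \<open>The chart is the time-one map of the flow of \<open>\<Sum>k\<in>J. c k z *\<^sub>R X k\<close> started on an affine
  plane; the coefficients \<open>c k z\<close> are chosen so that \<open>f k\<close> reaches the value \<open>z $ k\<close>.\<close>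

theorem straightening_commuting_fields:
  fixes X :: "'n::finite \<Rightarrow> real^'n \<Rightarrow> real^'n" and f :: "'n \<Rightarrow> real^'n \<Rightarrow> real"
  assumes S: "open S" "x0 \<in> S"
    and X: "\<And>k. k \<in> J \<Longrightarrow> smooth_on (X k) S" and f: "\<And>k. k \<in> J \<Longrightarrow> smooth_on (f k) S"
    and dual: "\<And>j k x. j \<in> J \<Longrightarrow> k \<in> J \<Longrightarrow> x \<in> S \<Longrightarrow>
        FD (f j) x (X k x) = (if j = k then 1 else 0)"
    and comm: "\<And>j k x. j \<in> J \<Longrightarrow> k \<in> J \<Longrightarrow> x \<in> S \<Longrightarrow>
        FD (X j) x (X k x) = FD (X k) x (X j x)"
  obtains z0 r \<Psi> \<Theta> where "r > 0" "x0 \<in> \<Psi> ` ball z0 r" "\<Psi> ` ball z0 r \<subseteq> S" "open (\<Psi> ` ball z0 r)"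
    "homeomorphism (ball z0 r) (\<Psi> ` ball z0 r) \<Psi> \<Theta>" "smooth_on \<Psi> (ball z0 r)" "smooth_on \<Theta> (\<Psi> ` ball z0 r)"
    "\<And>z k. z \<in> ball z0 r \<Longrightarrow> k \<in> J \<Longrightarrow> f k (\<Psi> z) = z $ k"
    "\<And>z k. z \<in> ball z0 r \<Longrightarrow> k \<in> J \<Longrightarrow> FD \<Psi> z (axis k 1) = X k (\<Psi> z)"
proof -
  let ?D = "\<lambda>g x. FD g x"
  have df: "(f k has_derivative ?D (f k) x) (at x)" if "k \<in> J" "x \<in> S" for k x
    by (rule smooth_on_has_derivative[OF f[OF that(1)] that(2)])
  have dX: "(X k has_derivative ?D (X k) x) (at x)" if "k \<in> J" "x \<in> S" for k x
    by (rule smooth_on_has_derivative[OF X[OF that(1)] that(2)])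

  \<comment> \<open>An affine slice tangent to the level sets, and the coefficients of the
    flow\<close>
  define a where "a k = (\<chi> i. ?D (f k) x0 (axis i 1))" for k
  have a: "a k \<bullet> w = ?D (f k) x0 w" if "k \<in> J" for k w
    unfolding a_def by (rule linear_functional_inner[OF has_derivative_linear[OF df[OF that S(2)]]])
  obtain l :: "real^'n \<Rightarrow> real^'n" where l: "linear l"
    "\<And>v k. (\<And>k. k \<in> J \<Longrightarrow> v $ k = 0) \<Longrightarrow> k \<in> J \<Longrightarrow> a k \<bullet> l v = 0"
    "\<And>v. (\<And>k. k \<in> J \<Longrightarrow> v $ k = 0) \<Longrightarrow> l v = 0 \<Longrightarrow> v = 0"
    using kernel_parametrisation[of J a "\<lambda>k. X k x0"] a dual S(2) by (metis (no_types, lifting))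
  \<comment> \<open>Projection that forgets the components in \<open>J\<close>. Hence
    \<open>Y\<close> takes values in the common kernel of the differentials of the
    \<open>f k\<close> at \<open>x0\<close> and kills the directions that the flow will
    supply.\<close>
  define Q :: "real^'n \<Rightarrow> real^'n" where "Q v = (\<chi> k. if k \<in> J then 0 else v $ k)" for v
  define Y where "Y v = l (Q v)" for v
  have "linear Q" by (auto simp: Q_def linear_iff vec_eq_iff)
  then have Y: "linear Y" using linear_compose[OF _ l(1), of Q] by (simp add: Y_def[abs_def] o_def)
  then have bY: "bounded_linear Y" by (simp add: linear_conv_bounded_linear)
  have Yk: "Y (axis k 1) = 0" if "k \<in> J" for k
  proof -
    have "Q (axis k 1) = 0" using that by (auto simp: Q_def vec_eq_iff axis_def)
    then show ?thesis using linear_0[OF l(1)] by (simp add: Y_def)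
  qed
  have aY: "?D (f k) x0 (Y v) = 0" if "k \<in> J" for k v
    using l(2)[of "Q v" k] a[OF that] that by (simp add: Y_def Q_def)
  \<comment> \<open>The components in \<open>J\<close> are the values of \<open>f k\<close> at
    \<open>x0\<close>, so that \<open>c k z0\<close> vanishes; the other components may be
    anything.\<close>
  define z0 :: "real^'n" where "z0 = (\<chi> k. if k \<in> J then f k x0 else 0)"
  define y where "y z = x0 + Y (z - z0)" for z
  define c where "c k z = z $ k - f k (y z)" for k z
  have y0: "y z0 = x0" using linear_0[OF Y] by (simp add: y_def)
  have c0: "c k z0 = 0" if "k \<in> J" for k using that by (simp add: c_def y0) (simp add: z0_def)
  have dy: "(y has_derivative Y) (at z)" for z
    unfolding y_def[abs_def]
    by (rule derivative_eq_intros bounded_linear.has_derivative[OF bY] | simp)+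
  have ys: "smooth_on y T" if "open T" for T
    unfolding smooth_on_def
  proof
    fix k
    have "y = (\<lambda>z. (x0 - Y z0) + Y z)" by (rule ext) (simp add: y_def linear_diff[OF Y])
    then show "Ck_on k y T" using that by (simp add: Ck_on_add Ck_on_const Ck_on_bounded_linear bY)
  qed

  \<comment> \<open>Constants that keep the flow small and inside the domain\<close>
  obtain R2 where R2: "R2 > 0" "cball x0 R2 \<subseteq> S" using S open_contains_cball by blast
  \<comment> \<open>Solutions are confined to the closed ball of radius \<open>R\<close>; the larger
    open ball of radius \<open>R2\<close> is the open state set that \<open>solution_Ck\<close>
    requires.\<close>
  define R where "R = R2 / 2"
  have R: "R > 0" "cball x0 R \<subseteq> ball x0 R2" "ball x0 R2 \<subseteq> S" using R2 by (auto simp: R_def)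
  have "\<exists>L. L \<ge> 0 \<and> (\<forall>u\<in>cball x0 R2. \<forall>v\<in>cball x0 R2. norm (X k u - X k v) \<le> L * norm (u - v))" if "k \<in> J" for k
    using Ck_on_lipschitz_compact_convex[OF smooth_onD[OF X[OF that]] compact_cball convex_cball R2(2)] by metis
  then obtain L where L: "\<And>k. k \<in> J \<Longrightarrow> L k \<ge> 0"
    "\<And>k u v. k \<in> J \<Longrightarrow> u \<in> cball x0 R2 \<Longrightarrow> v \<in> cball x0 R2 \<Longrightarrow> norm (X k u - X k v) \<le> L k * norm (u - v)"
    by metis
  have "\<exists>M. M \<ge> 0 \<and> (\<forall>u\<in>cball x0 R2. norm (X k u) \<le> M)" if "k \<in> J" for k
  proof -
    have "bounded (X k ` cball x0 R2)"
      using compact_imp_bounded[OF compact_continuous_image[OF continuous_on_subset[OF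
        Ck_on_imp_continuous_on[OF smooth_onD[OF X[OF that], of 0]] R2(2)] compact_cball]] .
    then obtain M where "M > 0" "\<forall>u\<in>X k ` cball x0 R2. norm u \<le> M" using bounded_pos by blast
    then show ?thesis by (intro exI[of _ M]) auto
  qed
  then obtain M where M: "\<And>k. k \<in> J \<Longrightarrow> M k \<ge> 0"
    "\<And>k u. k \<in> J \<Longrightarrow> u \<in> cball x0 R2 \<Longrightarrow> norm (X k u) \<le> M k"
    by metis
  define B where "B = (\<Sum>k\<in>J. L k) + (\<Sum>k\<in>J. M k)"
  have B: "0 \<le> (\<Sum>k\<in>J. L k)" "0 \<le> (\<Sum>k\<in>J. M k)" using L(1) M(1) by (auto intro: sum_nonneg)
  \<comment> \<open>Bound for the coefficients \<open>c k z\<close>. The part 1/4 yields the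
    Lipschitz constant of the equation; the part R/8 bounds the speed, so that a solution starting
    within R/2 of \<open>x0\<close> has moved by at most R/4 at time 2 and stays in the ball of
    radius R.\<close>
  define \<gamma> where "\<gamma> = min (1/4) (R/8) / (B + 1)"
  have \<gamma>: "\<gamma> > 0" using B R by (simp add: \<gamma>_def B_def add_nonneg_pos)
  have "\<gamma> * (B + 1) = min (1/4) (R/8)" using B by (simp add: \<gamma>_def B_def add_nonneg_pos)
  moreover have "\<gamma> * (\<Sum>k\<in>J. L k) \<le> \<gamma> * (B + 1)" "\<gamma> * (\<Sum>k\<in>J. M k) \<le> \<gamma> * (B + 1)"
    using B \<gamma> by (auto intro!: mult_left_mono simp: B_def)
  ultimately have \<gamma>L: "\<gamma> * (\<Sum>k\<in>J. L k) \<le> 1/4" and \<gamma>M: "\<gamma> * (\<Sum>k\<in>J. M k) \<le> R/8" by auto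
  have icy: "isCont y z0" using has_derivative_continuous[OF dy] .
  have icc: "isCont (c k) z0" if "k \<in> J" for k
  proof -
    have "isCont (f k) (y z0)" unfolding y0 using has_derivative_continuous[OF df[OF that S(2)]] .
    then have "isCont (\<lambda>z. f k (y z)) z0" using isCont_o2[OF icy] by blast
    then show ?thesis unfolding c_def[abs_def] by (intro continuous_intros)
  qed
  have "\<forall>\<^sub>F z in nhds z0. y z \<in> ball x0 (R / 2)"
    using icy R y0 by (intro topological_tendstoD[where f=y]) (auto simp: isCont_def tendsto_at_iff_tendsto_nhds)
  moreover have "\<forall>\<^sub>F z in nhds z0. \<bar>c k z\<bar> < \<gamma>" if "k \<in> J" for k
  proof -
    have "(c k \<longlongrightarrow> c k z0) (nhds z0)"
      using icc[OF that] unfolding isCont_def tendsto_at_iff_tendsto_nhds .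
    from topological_tendstoD[OF this, of "ball 0 \<gamma>"] show ?thesis
      using \<gamma> c0[OF that] by simp
  qed
  ultimately have "\<forall>\<^sub>F z in nhds z0. y z \<in> ball x0 (R / 2) \<and> (\<forall>k\<in>J. \<bar>c k z\<bar> < \<gamma>)"
    by (intro eventually_conj) (auto simp: eventually_ball_finite_distrib)
  then obtain \<delta> where \<delta>: "\<delta> > 0" and \<delta>y: "\<And>z. z \<in> ball z0 \<delta> \<Longrightarrow> y z \<in> ball x0 (R / 2)"
    and \<delta>c: "\<And>z k. z \<in> ball z0 \<delta> \<Longrightarrow> k \<in> J \<Longrightarrow> \<bar>c k z\<bar> \<le> \<gamma>"
    unfolding eventually_nhds_metric by (auto simp: dist_commute less_imp_le)

  \<comment> \<open>The parametrised flow equation and its smooth solution\<close>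
  define U where "U = ball z0 \<delta>"
  define I where "I = {-2<..<2::real}"
  define C where "C = ball x0 R2"
  have UI: "open U" "open I" "open C" "open (U \<times> I)" "open ((U \<times> I) \<times> C)"
    by (auto simp: U_def I_def C_def intro!: open_Times)
  have yC: "y z \<in> cball x0 R" if "z \<in> U" for z using \<delta>y[of z] that R by (auto simp: U_def)
  have yS: "y z \<in> S" if "z \<in> U" for z
    using yC[OF that] R by blast
  have CS: "C \<subseteq> S" using R(3) by (simp add: C_def)
  have dc: "(c k has_derivative (\<lambda>v. v $ k - ?D (f k) (y z) (Y v))) (at z)" if "k \<in> J" "z \<in> U" for k z
  proof -
    have "((\<lambda>z. f k (y z)) has_derivative (\<lambda>v. ?D (f k) (y z) (Y v))) (at z)"
      by (rule has_derivative_compose[OF dy df[OF that(1) yS[OF that(2)]]])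
    then show ?thesis unfolding c_def[abs_def]
      by (intro has_derivative_diff bounded_linear_imp_has_derivative[OF bounded_linear_vec_nth])
  qed
  have cs: "smooth_on (c k) U" if "k \<in> J" for k
    unfolding smooth_on_def
  proof
    fix n
    have "Ck_on n (\<lambda>z. f k (y z)) U"
      by (rule Ck_on_compose[OF UI(1) S(1) _ smooth_onD[OF ys[OF UI(1)]] smooth_onD[OF f[OF that]]]) (use yS in auto)
    then show "Ck_on n (c k) U" unfolding c_def[abs_def]
      by (rule Ck_on_diff[OF UI(1) Ck_on_bounded_linear[OF UI(1) bounded_linear_vec_nth]])
  qed
  define F where "F x = (\<Sum>k\<in>J. c k (fst (fst x)) *\<^sub>R X k (snd x))" for x :: "((real^'n) \<times> real) \<times> (real^'n)"
  have Fs: "smooth_on F ((U \<times> I) \<times> C)"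
    unfolding smooth_on_def
  proof
    fix n
    have "Ck_on n (\<lambda>x. c k (fst (fst x))) ((U \<times> I) \<times> C)" if "k \<in> J" for k
      by (rule Ck_on_compose[OF UI(5,1) _ _ smooth_onD[OF cs[OF that]]])
        (auto intro!: Ck_on_bounded_linear UI bounded_linear_fst_comp bounded_linear_ident)
    moreover have "Ck_on n (\<lambda>x. X k (snd x)) ((U \<times> I) \<times> C)" if "k \<in> J" for k
      by (rule Ck_on_compose[OF UI(5) S(1) _ _ smooth_onD[OF X[OF that]]])
        (use CS in \<open>auto intro!: Ck_on_bounded_linear UI bounded_linear_snd\<close>)
    ultimately show "Ck_on n F ((U \<times> I) \<times> C)"
      unfolding F_def[abs_def] by (intro Ck_on_sum Ck_on_scaleR UI) auto
  qed
  have lip: "norm (F (p, v) - F (p, w)) \<le> norm (v - w) / 4" if p: "p \<in> U \<times> I" and vw: "v \<in> C" "w \<in> C" for p v w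
  proof -
    have "F (p, v) - F (p, w) = (\<Sum>k\<in>J. c k (fst p) *\<^sub>R (X k v - X k w))"
      by (simp add: F_def sum_subtractf scaleR_right_diff_distrib)
    also have "norm \<dots> \<le> (\<Sum>k\<in>J. \<gamma> * (L k * norm (v - w)))"
    proof (rule sum_norm_le)
      fix k assume k: "k \<in> J"
      have "\<bar>c k (fst p)\<bar> * norm (X k v - X k w) \<le> \<gamma> * (L k * norm (v - w))"
        using \<delta>c[of "fst p" k] p k L(2)[OF k, of v w] vw \<gamma> by (intro mult_mono) (auto simp: U_def C_def)
      then show "norm (c k (fst p) *\<^sub>R (X k v - X k w)) \<le> \<gamma> * (L k * norm (v - w))" by simp
    qed
    also have "\<dots> = \<gamma> * (\<Sum>k\<in>J. L k) * norm (v - w)"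
      by (simp add: sum_distrib_left sum_distrib_right mult.assoc)
    also have "\<dots> \<le> 1/4 * norm (v - w)" by (intro mult_right_mono \<gamma>L) simp
    finally show ?thesis by simp
  qed
  have Fb: "norm (F (p, v)) \<le> R / 8" if p: "fst p \<in> U" and v: "v \<in> cball x0 R" for p v
  proof -
    have "norm (F (p, v)) \<le> (\<Sum>k\<in>J. \<gamma> * M k)"
      unfolding F_def
    proof (rule sum_norm_le)
      fix k assume k: "k \<in> J"
      have "\<bar>c k (fst p)\<bar> * norm (X k v) \<le> \<gamma> * M k"
        using \<delta>c[of "fst p" k] p k M(2)[OF k, of v] v \<gamma> R_def R2 by (intro mult_mono) (auto simp: U_def)
      then show "norm (c k (fst (fst (p, v))) *\<^sub>R X k (snd (p, v))) \<le> \<gamma> * M k" by simp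
    qed
    also have "\<dots> \<le> R / 8" using \<gamma>M by (simp add: sum_distrib_left)
    finally show ?thesis .
  qed
  have contF: "continuous_on ((U \<times> {-2..2}) \<times> cball x0 R) F"
  proof -
    have "continuous_on ((U \<times> {-2..2}) \<times> cball x0 R) (\<lambda>x. c k (fst (fst x)))" if "k \<in> J" for k
      by (rule continuous_on_compose2[OF Ck_on_imp_continuous_on[OF smooth_onD[OF cs[OF that], of 0]]])
        (auto intro!: continuous_intros)
    moreover have "continuous_on ((U \<times> {-2..2}) \<times> cball x0 R) (\<lambda>x. X k (snd x))" if "k \<in> J" for k
      by (rule continuous_on_compose2[OF Ck_on_imp_continuous_on[OF smooth_onD[OF X[OF that], of 0]]])
        (use R in \<open>auto intro!: continuous_intros\<close>)
    ultimately show ?thesis unfolding F_def[abs_def] by (intro continuous_intros) auto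
  qed
  have lip2: "norm (F (p, v) - F (p, w)) \<le> norm (v - w) / 4"
    if "p \<in> U \<times> {-2..2}" "v \<in> cball x0 R" "w \<in> cball x0 R" for p v w
    using lip[of "(fst p, 0)" v w] that R(2) by (auto simp: F_def I_def C_def subset_iff)
  \<comment> \<open>Solved up to the closed endpoints -2 and 2, then restricted to the open interval
    \<open>I\<close>, where the derivatives become two-sided as \<open>solution_Ck\<close>
    expects.\<close>
  obtain u where u: "continuous_on (U \<times> {-2..2}) u" "u ` (U \<times> {-2..2}) \<subseteq> cball x0 R"
    "\<And>z. z \<in> U \<Longrightarrow> u (z, 0) = y z"
    "\<And>z s. z \<in> U \<Longrightarrow> s \<in> {-2..2} \<Longrightarrow> ((\<lambda>s. u (z, s)) has_vector_derivative F ((z, s), u (z, s))) (at s within {-2..2})"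
  proof (rule picard_parameters[where a=2 and T="{-2..2::real}" and K=U and C="cball x0 R" and F="\<lambda>p u. F (p, u)" and y=y and M="R/8"])
    show "continuous_on ((U \<times> {-2..2}) \<times> cball x0 R) (\<lambda>(p, u). F (p, u))" using contF by simp
    show "continuous_on U y"
      by (rule Ck_on_imp_continuous_on[OF smooth_onD[OF ys[OF UI(1)], of 0]])
    fix z s g assume z: "z \<in> U" and s: "s \<in> {-2..2::real}" and g: "continuous_on {0..1::real} g" "g ` {0..1} \<subseteq> cball x0 R"
    have "norm (integral {0..1} (\<lambda>\<theta>. F ((z, \<theta> * s), g \<theta>))) \<le> R / 8 * (1 - 0)"
    proof (rule integral_bound)
      show "continuous_on {0..1} (\<lambda>\<theta>. F ((z, \<theta> * s), g \<theta>))"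
      proof (rule continuous_on_compose2[OF contF])
        show "continuous_on {0..1} (\<lambda>\<theta>. ((z, \<theta> * s), g \<theta>))" by (intro continuous_intros g)
        have "\<bar>\<theta> * s\<bar> \<le> 1 * 2" if "\<theta> \<in> {0..1}" for \<theta>
          unfolding abs_mult using that s by (intro mult_mono) auto
        then show "(\<lambda>\<theta>. ((z, \<theta> * s), g \<theta>)) ` {0..1} \<subseteq> (U \<times> {- 2..2}) \<times> cball x0 R"
          using z g(2) by (fastforce simp: abs_le_iff)
      qed
      show "norm (F ((z, \<theta> * s), g \<theta>)) \<le> R / 8" if "\<theta> \<in> {0..1}" for \<theta>
        using Fb[of "(z, \<theta> * s)" "g \<theta>"] z g(2) that by (simp add: image_subset_iff)
    qed simp
    then have "\<bar>s\<bar> * norm (integral {0..1} (\<lambda>\<theta>. F ((z, \<theta> * s), g \<theta>))) \<le> 2 * (R / 8)"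
      using s by (intro mult_mono) auto
    then have "norm (s *\<^sub>R integral {0..1} (\<lambda>\<theta>. F ((z, \<theta> * s), g \<theta>))) \<le> R / 4" by simp
    moreover have "norm (y z - x0) < R / 2"
      using \<delta>y[of z] z by (simp add: U_def dist_norm norm_minus_commute)
    ultimately have "norm (y z - x0 + s *\<^sub>R integral {0..1} (\<lambda>\<theta>. F ((z, \<theta> * s), g \<theta>))) \<le> R"
      using norm_triangle_ineq[of "y z - x0" "s *\<^sub>R integral {0..1} (\<lambda>\<theta>. F ((z, \<theta> * s), g \<theta>))"] R(1) by linarith
    then show "y z + s *\<^sub>R integral {0..1} (\<lambda>\<theta>. F ((z, \<theta> * s), g \<theta>)) \<in> cball x0 R"
      by (simp add: dist_norm norm_minus_commute algebra_simps)
  qed (use Fb yC lip2 in auto)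
  have uI: "continuous_on (U \<times> I) u" "u ` (U \<times> I) \<subseteq> C"
  proof -
    have sub: "U \<times> I \<subseteq> U \<times> {-2..2}" by (auto simp: I_def)
    show "continuous_on (U \<times> I) u" by (rule continuous_on_subset[OF u(1) sub])
    show "u ` (U \<times> I) \<subseteq> C" using u(2) R(2) sub unfolding C_def by blast
  qed
  have uder: "((\<lambda>s. u (z, s)) has_vector_derivative F ((z, s), u (z, s))) (at s)" if "z \<in> U" "s \<in> I" for z s
  proof -
    have "((\<lambda>s. u (z, s)) has_vector_derivative F ((z, s), u (z, s))) (at s within I)"
      by (rule has_vector_derivative_within_subset[OF u(4)]) (use that in \<open>auto simp: I_def\<close>)
    then show ?thesis using at_within_open[OF that(2) UI(2)] by simp
  qed
  have us: "smooth_on u (U \<times> I)"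
    unfolding smooth_on_def
    using solution_Ck[OF UI(1) I_def UI(3) smooth_onD[OF Fs] lip smooth_onD[OF ys[OF UI(1)]] uI u(3) uder] by blast
  have uS: "u p \<in> S" "u p \<in> C" if "p \<in> U \<times> I" for p using uI(2) CS that by auto
  obtain W where W: "\<And>p. p \<in> U \<times> I \<Longrightarrow> (u has_derivative (\<lambda>(v, \<tau>). W v p + \<tau> *\<^sub>R F (p, u p))) (at p)"
    "\<And>z v. z \<in> U \<Longrightarrow> W v (z, 0) = ?D y z v"
    "\<And>z s v. z \<in> U \<Longrightarrow> s \<in> I \<Longrightarrow> ((\<lambda>s. W v (z, s)) has_vector_derivative
        ?D F ((z, s), u (z, s)) ((v, 0), W v (z, s))) (at s)"
    "\<And>p w. p \<in> U \<times> I \<Longrightarrow> norm (?D F (p, u p) (0, w)) \<le> norm w / 4"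
    by (rule solution_C1[OF UI(1,3) I_def smooth_onD[OF Fs] lip smooth_onD[OF ys[OF UI(1)]] uI u(3) uder]) blast+
  have W0: "W v (z, 0) = Y v" if "z \<in> U" for z v
    using W(2)[OF that] frechet_derivative_at[OF dy] by metis
  have DF: "?D F ((z, s), x) ((v, t), w) =
      (\<Sum>k\<in>J. c k z *\<^sub>R ?D (X k) x w + (v $ k - ?D (f k) (y z) (Y v)) *\<^sub>R X k x)"
    if "z \<in> U" "s \<in> I" "x \<in> C" for z s x v t w
  proof -
    have "(F has_derivative (\<lambda>h. \<Sum>k\<in>J. c k (fst (fst ((z, s), x))) *\<^sub>R ?D (X k) x (snd h) +
        (fst (fst h) $ k - ?D (f k) (y z) (Y (fst (fst h)))) *\<^sub>R X k (snd ((z, s), x)))) (at ((z, s), x))"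
      unfolding F_def[abs_def]
    proof (intro has_derivative_sum has_derivative_scaleR)
      fix k assume k: "k \<in> J"
      have "((\<lambda>x. fst (fst x)) has_derivative (\<lambda>h. fst (fst h))) (at ((z, s), x))"
        by (intro derivative_intros)
      from has_derivative_compose[OF this, of "c k"] dc[OF k that(1)]
      show "((\<lambda>x. c k (fst (fst x))) has_derivative (\<lambda>h. fst (fst h) $ k - ?D (f k) (y z) (Y (fst (fst h))))) (at ((z, s), x))"
        by simp
      have "(snd has_derivative snd) (at ((z, s), x))"
        by (intro bounded_linear_imp_has_derivative bounded_linear_snd)
      from has_derivative_compose[OF this, of "X k"] dX[OF k, of x] that(3) CS
      show "((\<lambda>x. X k (snd x)) has_derivative (\<lambda>h. ?D (X k) x (snd h))) (at ((z, s), x))"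
        by auto
    qed
    from frechet_derivative_at[OF this, symmetric] show ?thesis by simp
  qed

  \<comment> \<open>The time-one map: its coordinates, its partial derivatives and its
    inverse\<close>
  define \<Psi> where "\<Psi> z = u (z, 1)" for z
  have one: "(1::real) \<in> I" by (simp add: I_def)
  have \<Psi>s: "smooth_on \<Psi> U"
    unfolding smooth_on_def \<Psi>_def[abs_def]
  proof
    fix n
    show "Ck_on n (\<lambda>z. u (z, 1)) U"
      by (rule Ck_on_compose[OF UI(1,4) _ Ck_on_Pair[OF UI(1) Ck_on_bounded_linear[OF UI(1) bounded_linear_ident]
            Ck_on_const[OF UI(1)]] smooth_onD[OF us]]) (use one in auto)
  qed
  have D\<Psi>: "?D \<Psi> z v = W v (z, 1)" if "z \<in> U" for z v
  proof -
    have "((\<lambda>z. (z, 1::real)) has_derivative (\<lambda>v. (v, 0))) (at z)"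
      by (intro has_derivative_Pair has_derivative_const has_derivative_ident)
    from has_derivative_compose[OF this, of u, OF W(1)[of "(z, 1)"]] that one
    have "(\<Psi> has_derivative (\<lambda>v. W v (z, 1))) (at z)" by (simp add: \<Psi>_def[abs_def])
    from frechet_derivative_at[OF this, symmetric] show ?thesis by simp
  qed
  have lin: "linear (?D (X k) (u p))" "linear (?D (f k) (u p))" if "k \<in> J" "p \<in> U \<times> I" for k p
    using has_derivative_linear[OF dX[OF that(1) uS(1)[OF that(2)]]] has_derivative_linear[OF df[OF that(1) uS(1)[OF that(2)]]] by auto
  have sI: "s \<in> I" if "s \<in> {-1..1}" for s using that by (auto simp: I_def)
  have f\<Psi>: "f j (\<Psi> z) = z $ j" if z: "z \<in> U" and j: "j \<in> J" for z j
  proof -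
    \<comment> \<open>By duality \<open>f j\<close> grows along the flow at the constant speed
      \<open>c j z\<close>, so at time 1 it has the value \<open>f j (y z) + c j z\<close>, which is
      \<open>z $ j\<close> by the choice of \<open>c\<close>.\<close>
    let ?R = "\<lambda>s. f j (u (z, s)) - f j (y z) - s * c j z"
    have "norm (?R 1) \<le> 2 * 0 + 4 * 0"
    proof (rule deriv_bound_growth[where a=1 and \<alpha>=0 and c=0 and R="?R" and R'="\<lambda>s. 0"])
      fix s :: real assume s: "s \<in> {-1..1}"
      have p: "(z, s) \<in> U \<times> I" using z sI[OF s] by simp
      have "((\<lambda>s. f j (u (z, s))) has_vector_derivative ?D (f j) (u (z, s)) (F ((z, s), u (z, s)))) (at s)"
        by (rule vector_derivative_diff_chain_within[OF uder[OF z sI[OF s]], of "f j" "?D (f j) (u (z, s))", unfolded o_def])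
          (use df[OF j uS(1)[OF p]] has_derivative_at_withinI in auto)
      also have "?D (f j) (u (z, s)) (F ((z, s), u (z, s))) = c j z"
      proof -
        have "?D (f j) (u (z, s)) (F ((z, s), u (z, s))) = (\<Sum>k\<in>J. c k z * ?D (f j) (u (z, s)) (X k (u (z, s))))"
          by (simp add: F_def linear_sum[OF lin(2)[OF j p]] linear_cmul[OF lin(2)[OF j p]])
        also have "\<dots> = (\<Sum>k\<in>J. if j = k then c k z else 0)"
          using dual[OF j _ uS(1)[OF p]] by (intro sum.cong) auto
        also have "\<dots> = c j z" using j by simp
        finally show ?thesis .
      qed
      finally have "((\<lambda>s. f j (u (z, s))) has_vector_derivative c j z) (at s)" .
      then have "(?R has_vector_derivative 0) (at s)"
        by (auto intro!: derivative_eq_intros)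
      then show "(?R has_vector_derivative 0) (at s within {-1..1})" by (rule has_vector_derivative_at_within)
    next
      show "norm (?R 0) \<le> 0" using u(3)[OF z] by simp
    qed auto
    then show ?thesis by (simp add: \<Psi>_def c_def)
  qed
  have \<Psi>X: "?D \<Psi> z (axis k 1) = X k (\<Psi> z)" if z: "z \<in> U" and k: "k \<in> J" for z k
  proof -
    let ?W = "\<lambda>s. W (axis k 1) (z, s)"
    \<comment> \<open>\<open>?W s\<close> is the parameter derivative of the flow, and
      \<open>s *\<^sub>R X k (u (z, s))\<close> is its expected value. Both start at 0 and solve the
      same inhomogeneous linear equation; for the second this is where the fields have to commute.
      Their difference solves the homogeneous equation and vanishes.\<close>
    let ?R = "\<lambda>s. ?W s - s *\<^sub>R X k (u (z, s))"
    have "norm (?R 1) \<le> 2 * 0 + 4 * 0"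
    proof (rule deriv_bound_growth[where a=1 and \<alpha>=0 and c=0 and R="?R" and R'="\<lambda>s. ?D F ((z, s), u (z, s)) (0, ?R s)"])
      fix s :: real assume s: "s \<in> {-1..1}"
      have p: "(z, s) \<in> U \<times> I" using z sI[OF s] by simp
      let ?u = "u (z, s)"
      have dXu: "((\<lambda>s. X k (u (z, s))) has_vector_derivative ?D (X k) ?u (F ((z, s), ?u))) (at s)"
        by (rule vector_derivative_diff_chain_within[OF uder[OF z sI[OF s]], of "X k" "?D (X k) ?u", unfolded o_def])
          (use dX[OF k uS(1)[OF p]] has_derivative_at_withinI in auto)
      have "((\<lambda>s. s *\<^sub>R X k (u (z, s))) has_vector_derivative s *\<^sub>R ?D (X k) ?u (F ((z, s), ?u)) + 1 *\<^sub>R X k ?u) (at s)"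
        by (rule has_vector_derivative_scaleR[OF _ dXu]) (auto intro!: derivative_eq_intros)
      from has_vector_derivative_diff[OF W(3)[OF z sI[OF s]] this]
      have "(?R has_vector_derivative ?D F ((z, s), ?u) ((axis k 1, 0), ?W s) -
          (s *\<^sub>R ?D (X k) ?u (F ((z, s), ?u)) + 1 *\<^sub>R X k ?u)) (at s)" .
      also have "?D F ((z, s), ?u) ((axis k 1, 0), ?W s) - (s *\<^sub>R ?D (X k) ?u (F ((z, s), ?u)) + 1 *\<^sub>R X k ?u) =
          ?D F ((z, s), ?u) (0, ?R s)"
      proof -
        have C: "?u \<in> C" using uS(2)[OF p] .
        have lk: "linear (?D (X i) ?u)" if "i \<in> J" for i using lin(1)[OF that p] .
        have lf: "?D (f i) (y z) 0 = 0" if "i \<in> J" for i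
          using linear_0[OF has_derivative_linear[OF df[OF that yS[OF z]]]] .
        have "?D F ((z, s), ?u) ((axis k 1, 0), ?W s) = (\<Sum>i\<in>J. c i z *\<^sub>R ?D (X i) ?u (?W s) + (if i = k then X i ?u else 0))"
          unfolding DF[OF z sI[OF s] C] Yk[OF k] by (intro sum.cong) (auto simp: lf axis_def)
        also have "\<dots> = (\<Sum>i\<in>J. c i z *\<^sub>R ?D (X i) ?u (?W s)) + X k ?u"
          using k by (simp add: sum.distrib)
        finally have 1: "?D F ((z, s), ?u) ((axis k 1, 0), ?W s) = (\<Sum>i\<in>J. c i z *\<^sub>R ?D (X i) ?u (?W s)) + X k ?u" .
        have "?D (X k) ?u (F ((z, s), ?u)) = (\<Sum>i\<in>J. c i z *\<^sub>R ?D (X k) ?u (X i ?u))"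
          by (simp add: F_def linear_sum[OF lk[OF k]] linear_cmul[OF lk[OF k]])
        also have "\<dots> = (\<Sum>i\<in>J. c i z *\<^sub>R ?D (X i) ?u (X k ?u))"
          using comm[OF k _ uS(1)[OF p]] by (intro sum.cong) auto
        finally have 2: "?D (X k) ?u (F ((z, s), ?u)) = (\<Sum>i\<in>J. c i z *\<^sub>R ?D (X i) ?u (X k ?u))" .
        have "?D F ((z, s), ?u) (0, ?R s) = (\<Sum>i\<in>J. c i z *\<^sub>R ?D (X i) ?u (?R s))"
          using DF[OF z sI[OF s] C, of 0 0 "?R s"] linear_0[OF Y] lf by (simp add: zero_prod_def)
        also have "\<dots> = (\<Sum>i\<in>J. c i z *\<^sub>R (?D (X i) ?u (?W s) - s *\<^sub>R ?D (X i) ?u (X k ?u)))"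
          by (intro sum.cong) (auto simp: linear_diff[OF lk] linear_cmul[OF lk])
        also have "\<dots> = (\<Sum>i\<in>J. c i z *\<^sub>R ?D (X i) ?u (?W s)) - s *\<^sub>R (\<Sum>i\<in>J. c i z *\<^sub>R ?D (X i) ?u (X k ?u))"
          by (simp add: scaleR_right_diff_distrib sum_subtractf scaleR_right.sum mult.commute)
        finally show ?thesis using 1 2 by simp
      qed
      finally show "(?R has_vector_derivative ?D F ((z, s), ?u) (0, ?R s)) (at s within {-1..1})"
        by (rule has_vector_derivative_at_within)
      show "norm (?D F ((z, s), ?u) (0, ?R s)) \<le> norm (?R s) / 4 + 0"
        using W(4)[OF p, of "?R s"] by simp
    next
      show "norm (?R 0) \<le> 0" using W0[OF z] Yk[OF k] by simp
    qed auto
    then show ?thesis using D\<Psi>[OF z] by (simp add: \<Psi>_def)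
  qed
  have z0U: "z0 \<in> U" using \<delta> by (simp add: U_def)
  have F0: "F ((z0, s), x) = 0" for s x using c0 by (simp add: F_def)
  \<comment> \<open>A kernel vector has no components in \<open>J\<close> because \<open>f j\<close>
    composed with \<Psi> is the j-th coordinate. For such \<open>v\<close> the linearised equation
    at \<open>z0\<close> is trivial, as both \<open>c k\<close> and its derivative along
    \<open>v\<close> vanish; so \<Psi> has derivative \<open>Y v = l v\<close>, and \<open>l\<close>
    is injective there.\<close>
  have inj: "v = 0" if v: "?D \<Psi> z0 v = 0" for v
  proof -
    have vj: "v $ j = 0" if j: "j \<in> J" for j
    proof -
      have d: "((\<lambda>z. f j (\<Psi> z)) has_derivative (\<lambda>v. ?D (f j) (\<Psi> z0) (?D \<Psi> z0 v))) (at z0)"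
        by (rule has_derivative_compose[OF smooth_on_has_derivative[OF \<Psi>s z0U] df[OF j]])
          (use uS(1)[of "(z0, 1)"] z0U one in \<open>simp add: \<Psi>_def\<close>)
      have "((\<lambda>z. f j (\<Psi> z)) has_derivative (\<lambda>v. v $ j)) (at z0)"
        by (rule has_derivative_transform_within_open[OF bounded_linear_imp_has_derivative[OF bounded_linear_vec_nth] UI(1) z0U])
          (simp add: f\<Psi> j)
      from has_derivative_unique[OF this d] have "v $ j = ?D (f j) (\<Psi> z0) (?D \<Psi> z0 v)" by metis
      also have "\<dots> = 0"
        unfolding v using linear_0[OF lin(2)[OF j, of "(z0, 1)"]] z0U one by (simp add: \<Psi>_def)
      finally show ?thesis .
    qed
    have "W v (z0, 1) = Y v"
    proof -
      let ?R = "\<lambda>s. W v (z0, s) - Y v"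
      have "norm (?R 1) \<le> 2 * 0 + 4 * 0"
      proof (rule deriv_bound_growth[where a=1 and \<alpha>=0 and c=0 and R="?R" and R'="\<lambda>s. 0"])
        fix s :: real assume s: "s \<in> {-1..1}"
        have "?D F ((z0, s), u (z0, s)) ((v, 0), W v (z0, s)) = 0"
          using DF[OF z0U sI[OF s] uS(2)] sI[OF s] z0U c0 vj aY by (simp add: y0)
        then have "((\<lambda>s. W v (z0, s)) has_vector_derivative 0) (at s)"
          using W(3)[OF z0U sI[OF s], of v] by simp
        from has_vector_derivative_diff[OF this has_vector_derivative_const]
        show "(?R has_vector_derivative 0) (at s within {-1..1})"
          by (simp add: has_vector_derivative_at_within)
      qed (use W0[OF z0U] in auto)
      then show ?thesis by simp
    qed
    then have "l (Q v) = 0" using v D\<Psi>[OF z0U] by (simp add: Y_def)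
    moreover have "Q v = v" using vj by (auto simp: Q_def vec_eq_iff)
    ultimately show "v = 0" using l(3)[OF vj] by simp
  qed
  have \<Psi>0: "\<Psi> z0 = x0"
  proof -
    let ?R = "\<lambda>s. u (z0, s) - x0"
    have "norm (?R 1) \<le> 2 * 0 + 4 * 0"
    proof (rule deriv_bound_growth[where a=1 and \<alpha>=0 and c=0 and R="?R" and R'="\<lambda>s. 0"])
      fix s :: real assume s: "s \<in> {-1..1}"
      from has_vector_derivative_diff[OF uder[OF z0U sI[OF s]] has_vector_derivative_const]
      show "((\<lambda>s. u (z0, s) - x0) has_vector_derivative 0) (at s within {-1..1})"
        by (simp add: F0 has_vector_derivative_at_within)
    qed (use u(3)[OF z0U] y0 in auto)
    then show ?thesis by (simp add: \<Psi>_def)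
  qed
  from smooth_inverse_function[OF UI(1) z0U \<Psi>s inj]
  obtain r \<Theta> where r: "r > 0" "ball z0 r \<subseteq> U" "open (\<Psi> ` ball z0 r)"
    "homeomorphism (ball z0 r) (\<Psi> ` ball z0 r) \<Psi> \<Theta>" "smooth_on \<Theta> (\<Psi> ` ball z0 r)" by metis
  show thesis
  proof (rule that[OF r(1) _ _ r(3,4) _ r(5)])
    show "x0 \<in> \<Psi> ` ball z0 r" using r(1) \<Psi>0 by force
    show "\<Psi> ` ball z0 r \<subseteq> S" using r(2) uS(1) one by (auto simp: \<Psi>_def)
    show "smooth_on \<Psi> (ball z0 r)" by (rule smooth_on_subset[OF \<Psi>s r(2)])
  qed (use f\<Psi> \<Psi>X r(2) in auto)
qed

section \<open>Lie derivatives of metrics\<close>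

lemma FD_eqI: "(f has_derivative f') (at x) \<Longrightarrow> FD f x v = f' v"
  using frechet_derivative_at by metis

lemma FD_const: "FD (\<lambda>x. c) x v = 0"
  by (rule FD_eqI[OF has_derivative_const])

lemma frechet_derivative_symmetric:
  fixes f :: "'a::real_normed_vector \<Rightarrow> 'b::euclidean_space"
  assumes S: "open S" "x \<in> S" and f: "smooth_on f S"
  shows "FD (\<lambda>y. FD f y w) x v = FD (\<lambda>y. FD f y v) x w"
proof (rule euclidean_eqI)
  fix b :: 'b assume "b \<in> Basis"
  have 1: "FD (\<lambda>y. f y \<bullet> b) y u = FD f y u \<bullet> b" if "y \<in> S" for y u
    by (rule FD_eqI) (intro has_derivative_inner_left smooth_on_has_derivative[OF f that])
  have 2: "FD (\<lambda>y. FD (\<lambda>y. f y \<bullet> b) y u) x v = FD (\<lambda>y. FD f y u) x v \<bullet> b" for u v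
    by (rule FD_eqI, rule has_derivative_transform_within_open[OF has_derivative_inner_left[OF
          smooth_on_has_derivative[OF smooth_on_frechet_derivative[OF f] S(2)]] S]) (simp add: 1)
  have "Ck_on 2 (\<lambda>y. f y \<bullet> b) S"
    by (intro Ck_on_inner S Ck_on_const smooth_onD[OF f])
  from frechet_derivative_symmetric_real[OF S this]
  show "FD (\<lambda>y. FD f y w) x v \<bullet> b = FD (\<lambda>y. FD f y v) x w \<bullet> b" by (simp only: 2)
qed

text \<open>Product rule for a derivative paired with a moving vector; the first summand freezes the
  vector at \<open>X x\<close>. The basis expansion reduces it to derivatives in fixed
  directions.\<close>

lemma has_derivative_frechet_derivative_apply:
  fixes f :: "'a::euclidean_space \<Rightarrow> 'b::real_normed_vector"
  assumes S: "open S" "x \<in> S" and f: "smooth_on f S" and X: "(X has_derivative X') (at x)"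
  shows "((\<lambda>y. FD f y (X y)) has_derivative (\<lambda>v. FD (\<lambda>y. FD f y (X x)) x v + FD f x (X' v))) (at x)"
proof -
  have lin: "linear (FD f y)" if "y \<in> S" for y
    using has_derivative_linear[OF smooth_on_has_derivative[OF f that]] .
  have exp: "FD f y w = (\<Sum>b\<in>Basis. (w \<bullet> b) *\<^sub>R FD f y b)" if "y \<in> S" for y w
    by (rule linear_basis_expansion[OF lin[OF that]])
  have d: "((\<lambda>y. FD f y b) has_derivative FD (\<lambda>y. FD f y b) x) (at x)" for b
    by (rule smooth_on_has_derivative[OF smooth_on_frechet_derivative[OF f] S(2)])
  have gen: "((\<lambda>y. FD f y (Y y)) has_derivative (\<lambda>v. \<Sum>b\<in>Basis. (Y x \<bullet> b) *\<^sub>R FD (\<lambda>y. FD f y b) x v + (Y' v \<bullet> b) *\<^sub>R FD f x b)) (at x)"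
    if "(Y has_derivative Y') (at x)" for Y Y'
  proof -
    have "((\<lambda>y. \<Sum>b\<in>Basis. (Y y \<bullet> b) *\<^sub>R FD f y b) has_derivative
       (\<lambda>v. \<Sum>b\<in>Basis. (Y x \<bullet> b) *\<^sub>R FD (\<lambda>y. FD f y b) x v + (Y' v \<bullet> b) *\<^sub>R FD f x b)) (at x)"
      by (intro has_derivative_sum has_derivative_scaleR has_derivative_inner_left that d)
    then show ?thesis
      by (rule has_derivative_transform_within_open[OF _ S]) (rule exp[symmetric])
  qed
  have "FD (\<lambda>y. FD f y (X x)) x v = (\<Sum>b\<in>Basis. (X x \<bullet> b) *\<^sub>R FD (\<lambda>y. FD f y b) x v)" for v
    using FD_eqI[OF gen[OF has_derivative_const[of "X x"]]] by simp
  moreover have "FD f x (X' v) = (\<Sum>b\<in>Basis. (X' v \<bullet> b) *\<^sub>R FD f x b)" for v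
    by (rule exp[OF S(2)])
  ultimately show ?thesis
    using gen[OF X] by (simp add: sum.distrib)
qed

lemma has_derivative_matrix_form:
  fixes G :: "'a::real_normed_vector \<Rightarrow> real^'n::finite^'m::finite"
  assumes "(G has_derivative G') (at x)" "(X has_derivative X') (at x)" "(Y has_derivative Y') (at x)"
  shows "((\<lambda>y. X y \<bullet> (G y *v Y y)) has_derivative
     (\<lambda>v. X' v \<bullet> (G x *v Y x) + X x \<bullet> (G' v *v Y x) + X x \<bullet> (G x *v Y' v))) (at x)"
  by (rule has_derivative_eq_rhs[OF has_derivative_inner[OF assms(2)
        bounded_bilinear.FDERIV[OF bounded_bilinear_matrix_vector_mult assms(1,3)]]])
    (auto simp: inner_add_right)

text \<open>The Lie derivative of the 2-tensor \<open>G\<close> along \<open>X\<close>, evaluated on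
  constant fields v and w: X(G(v, w)) - G([X, v], w) - G(v, [X, w]), where the bracket [X, v] is
  minus the derivative of \<open>X\<close> along v.\<close>

definition lie :: "(real^'n::finite \<Rightarrow> real^'n) \<Rightarrow> (real^'n \<Rightarrow> real^'n^'n) \<Rightarrow> real^'n \<Rightarrow> real^'n \<Rightarrow> real^'n \<Rightarrow> real" where
  "lie X G x v w = v \<bullet> (FD G x (X x) *v w) + FD X x v \<bullet> (G x *v w) + v \<bullet> (G x *v FD X x w)"

text \<open>Naturality of the Lie derivative: \<open>H\<close> is the pullback of \<open>G\<close>
  by \<open>F\<close>, and the fields \<open>X\<close> and \<open>Y\<close> are related by
  \<open>F\<close>.\<close>

lemma lie_pullback:
  fixes F :: "real^'n::finite \<Rightarrow> real^'n"
  assumes Z: "open Z" "z \<in> Z" and S: "open S" "F ` Z \<subseteq> S"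
    and F: "smooth_on F Z" and G: "smooth_on G S" and H: "smooth_on H Z"
    and X: "smooth_on X Z" and Y: "smooth_on Y S"
    and HG: "\<And>z v w. z \<in> Z \<Longrightarrow> v \<bullet> (H z *v w) = FD F z v \<bullet> (G (F z) *v FD F z w)"
    and XY: "\<And>z. z \<in> Z \<Longrightarrow> FD F z (X z) = Y (F z)"
  shows "lie X H z v w = lie Y G (F z) (FD F z v) (FD F z w)"
proof -
  have Fz: "F z \<in> S" using Z S by blast
  have dF: "(F has_derivative FD F z) (at z)" by (rule smooth_on_has_derivative[OF F Z(2)])
  have ddF: "((\<lambda>y. FD F y u) has_derivative FD (\<lambda>y. FD F y u) z) (at z)" for u
    by (rule smooth_on_has_derivative[OF smooth_on_frechet_derivative[OF F] Z(2)])
  \<comment> \<open>Differentiating the relation between \<open>X\<close> and \<open>Y\<close> along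
    u brings in the second derivative of \<open>F\<close>. By its symmetry this is the derivative of
    \<open>FD F y u\<close> along \<open>X\<close>, the term that arises when the pulled-back form
    is differentiated.\<close>
  have second: "FD (\<lambda>y. FD F y u) z (X z) = FD Y (F z) (FD F z u) - FD F z (FD X z u)" for u
  proof -
    have "((\<lambda>y. FD F y (X y)) has_derivative (\<lambda>u. FD Y (F z) (FD F z u))) (at z)"
      by (rule has_derivative_transform_within_open[OF has_derivative_compose[OF dF
              smooth_on_has_derivative[OF Y Fz]] Z]) (simp add: XY)
    from has_derivative_unique[OF this has_derivative_frechet_derivative_apply[OF Z F smooth_on_has_derivative[OF X Z(2)]]]
    have "FD Y (F z) (FD F z u) = FD (\<lambda>y. FD F y (X z)) z u + FD F z (FD X z u)" by metis
    then show ?thesis using frechet_derivative_symmetric[OF Z F] by simp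
  qed
  have dGF: "((\<lambda>y. G (F y)) has_derivative (\<lambda>u. FD G (F z) (FD F z u))) (at z)"
    by (rule has_derivative_compose[OF dF smooth_on_has_derivative[OF G Fz]])
  have "((\<lambda>y. FD F y v \<bullet> (G (F y) *v FD F y w)) has_derivative (\<lambda>u. FD (\<lambda>y. FD F y v) z u \<bullet> (G (F z) *v FD F z w) +
      FD F z v \<bullet> (FD G (F z) (FD F z u) *v FD F z w) + FD F z v \<bullet> (G (F z) *v FD (\<lambda>y. FD F y w) z u))) (at z)"
    by (rule has_derivative_matrix_form[OF dGF ddF ddF])
  then have 1: "((\<lambda>y. v \<bullet> (H y *v w)) has_derivative (\<lambda>u. FD (\<lambda>y. FD F y v) z u \<bullet> (G (F z) *v FD F z w) +
      FD F z v \<bullet> (FD G (F z) (FD F z u) *v FD F z w) + FD F z v \<bullet> (G (F z) *v FD (\<lambda>y. FD F y w) z u))) (at z)"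
    by (rule has_derivative_transform_within_open[OF _ Z]) (simp add: HG)
  have 2: "((\<lambda>y. v \<bullet> (H y *v w)) has_derivative (\<lambda>u. v \<bullet> (FD H z u *v w))) (at z)"
    using has_derivative_matrix_form[OF smooth_on_has_derivative[OF H Z(2)] has_derivative_const has_derivative_const]
    by simp
  from has_derivative_unique[OF 2 1]
  have "v \<bullet> (FD H z (X z) *v w) = FD (\<lambda>y. FD F y v) z (X z) \<bullet> (G (F z) *v FD F z w) +
      FD F z v \<bullet> (FD G (F z) (FD F z (X z)) *v FD F z w) + FD F z v \<bullet> (G (F z) *v FD (\<lambda>y. FD F y w) z (X z))"
    by metis
  then show ?thesis
    unfolding lie_def second HG[OF Z(2)] XY[OF Z(2)]
    by (simp add: inner_diff_left inner_diff_right matrix_vector_mult_diff_distrib)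
qed

lemma lie_scale_metric:
  assumes "(c has_derivative c') (at x)" "(G has_derivative G') (at x)"
  shows "lie X (\<lambda>y. c y *\<^sub>R G y) x v w = c' (X x) * (v \<bullet> (G x *v w)) + c x * lie X G x v w"
proof -
  have "FD (\<lambda>y. c y *\<^sub>R G y) x u = c x *\<^sub>R G' u + c' u *\<^sub>R G x" for u
    by (rule FD_eqI[OF has_derivative_scaleR[OF assms]])
  moreover have "FD G x u = G' u" for u by (rule FD_eqI[OF assms(2)])
  ultimately show ?thesis
    by (simp add: lie_def matrix_vector_mult_add_rdistrib scaleR_matrix_vector_assoc[symmetric]
        inner_add_right distrib_left)
qed

lemma lie_scale_field:
  assumes "(c has_derivative c') (at x)" "(Y has_derivative Y') (at x)" "(G has_derivative G') (at x)"
  shows "lie (\<lambda>y. c y *\<^sub>R Y y) G x v w = c x * lie Y G x v w + c' v * (Y x \<bullet> (G x *v w)) + c' w * (v \<bullet> (G x *v Y x))"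
proof -
  have 1: "FD (\<lambda>y. c y *\<^sub>R Y y) x u = c x *\<^sub>R Y' u + c' u *\<^sub>R Y x" for u
    by (rule FD_eqI[OF has_derivative_scaleR[OF assms(1,2)]])
  have 2: "FD Y x u = Y' u" for u by (rule FD_eqI[OF assms(2)])
  have 3: "FD G x (a *\<^sub>R u) = a *\<^sub>R FD G x u" for a u
    using linear_cmul[OF has_derivative_linear[OF assms(3)]] FD_eqI[OF assms(3)] by metis
  show ?thesis
    unfolding lie_def 1 2 3
    by (simp add: matrix_vector_right_distrib scaleR_matrix_vector_assoc[symmetric] matrix_vector_mult_scaleR
        inner_add_right inner_add_left distrib_left)
qed

text \<open>The algebra behind the equivalence of the two definitions of limiting Carleman weights;
  \<open>P\<close> is the metric, \<open>B\<close> the Lie derivative of the metric along the gradient \<open>g\<close>, and the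
  right-hand side describes the Lie derivative along \<open>(1/N) *\<^sub>R g\<close>.\<close>

lemma carleman_iff_conformal:
  fixes P B :: "'a::real_vector \<Rightarrow> 'a \<Rightarrow> real"
  assumes bP: "bilinear P" and sP: "\<And>v w. P v w = P w v" and pos: "\<And>v. v \<noteq> 0 \<Longrightarrow> P v v > 0"
    and bB: "bilinear B" and sB: "\<And>v w. B v w = B w v" and N: "N = P g g" "N > 0"
  shows "(\<forall>v. P v v = N \<and> P v g = 0 \<longrightarrow> B g g + B v v = 0) \<longleftrightarrow>
    (\<exists>c. \<forall>v w. B v w / N - (B g v * P w g + B g w * P v g) / N\<^sup>2 = c * P v w)" (is "?L \<longleftrightarrow> (\<exists>c. \<forall>v w. ?T v w = c * P v w)")
proof
  assume L: ?L
  \<comment> \<open>The only possible value: for v = w = g the left-hand side is - B g g / N, while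
    P g g = N.\<close>
  define c where "c = - B g g / N\<^sup>2"
  define T where "T v w = ?T v w" for v w
  \<comment> \<open>The hypothesis concerns vectors of squared length N only; both sides are
    homogeneous of degree two, which removes the normalisation.\<close>
  have perp: "B v v = c * N * P v v" if "P v g = 0" for v
  proof (cases "v = 0")
    case True
    then show ?thesis using bilinear_lzero[OF bB] bilinear_lzero[OF bP] by simp
  next
    case False
    define t where "t = sqrt (N / P v v)"
    have t: "t\<^sup>2 = N / P v v" "t \<noteq> 0" using N pos[OF False] by (auto simp: t_def)
    have sc: "P (t *\<^sub>R v) (t *\<^sub>R v) = t\<^sup>2 * P v v" "B (t *\<^sub>R v) (t *\<^sub>R v) = t\<^sup>2 * B v v" "P (t *\<^sub>R v) g = t * P v g"
      by (simp_all add: bilinear_lmul[OF bP] bilinear_rmul[OF bP] bilinear_lmul[OF bB] bilinear_rmul[OF bB] power2_eq_square)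
    have "P (t *\<^sub>R v) (t *\<^sub>R v) = N" unfolding sc t(1) using pos[OF False] by simp
    then have "B g g + t\<^sup>2 * B v v = 0" using L sc that by (metis mult_zero_right)
    then show ?thesis using pos[OF False] N unfolding t(1) c_def
      by (simp add: field_simps power2_eq_square)
  qed
  \<comment> \<open>Splits v into a multiple of g and a part orthogonal to g. The subtracted term of
    \<open>T\<close> cancels the mixed values of \<open>B\<close>, about which the hypothesis says
    nothing; polarisation then passes from squares to all pairs.\<close>
  have quad: "T v v = c * P v v" for v
  proof -
    define a where "a = P v g / N"
    define v' where "v' = v - a *\<^sub>R g"
    have v: "v = a *\<^sub>R g + v'" by (simp add: v'_def)
    have "P v' g = 0" using N
      by (simp add: v'_def bilinear_lsub[OF bP] bilinear_lmul[OF bP] a_def)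
    note p = perp[OF this]
    have e1: "P v g = a * N" using N by (simp add: a_def)
    have e2: "P v v = a\<^sup>2 * N + P v' v'"
      unfolding v using \<open>P v' g = 0\<close> sP[of g v'] N
      by (simp add: bilinear_ladd[OF bP] bilinear_radd[OF bP] bilinear_lmul[OF bP] bilinear_rmul[OF bP] power2_eq_square)
    have e3: "B v v = a\<^sup>2 * B g g + 2 * a * B g v' + B v' v'"
      unfolding v using sB[of v' g]
      by (simp add: bilinear_ladd[OF bB] bilinear_radd[OF bB] bilinear_lmul[OF bB] bilinear_rmul[OF bB] power2_eq_square algebra_simps)
    have e4: "B g v = a * B g g + B g v'"
      unfolding v by (simp add: bilinear_radd[OF bB] bilinear_rmul[OF bB])
    have Bgg: "B g g = - c * N\<^sup>2" using N by (simp add: c_def)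
    show ?thesis
      unfolding T_def e1 e3 e4 e2 p Bgg using N(2) by (simp add: field_simps power2_eq_square)
  qed
  have "T v w = c * P v w" for v w
  proof -
    have t: "T (v + w) (v + w) = T v v + 2 * T v w + T w w"
      unfolding T_def using sB[of w v] N(2)
      by (simp add: bilinear_ladd[OF bB] bilinear_radd[OF bB] bilinear_ladd[OF bP] field_simps)
    have p: "P (v + w) (v + w) = P v v + 2 * P v w + P w w"
      using sP[of w v] by (simp add: bilinear_ladd[OF bP] bilinear_radd[OF bP])
    have "c * P (v + w) (v + w) = c * P v v + 2 * (c * P v w) + c * P w w"
      unfolding p by (simp add: algebra_simps)
    then show ?thesis
      using t quad[of "v + w"] quad[of v] quad[of w] by linarith
  qed
  then show "\<exists>c. \<forall>v w. ?T v w = c * P v w" unfolding T_def by blast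
next
  assume "\<exists>c. \<forall>v w. ?T v w = c * P v w"
  then obtain c where c: "\<And>v w. ?T v w = c * P v w" by blast
  show ?L
  proof safe
    fix v assume "N = P v v" "P v g = 0"
    then have "B v v / N = c * N" using c[of v v] by simp
    moreover have "- B g g / N = c * N" using c[of g g] N by (simp add: field_simps power2_eq_square)
    ultimately show "B g g + B v v = 0" using N(2) by (simp add: field_simps)
  qed
qed

section \<open>Limiting Carleman weights in a coordinate domain\<close>

lemma positive_form_det:
  fixes A :: "real^'n::finite^'n"
  assumes "\<And>v. v \<noteq> 0 \<Longrightarrow> v \<bullet> (A *v v) > 0"
  shows "det A \<noteq> 0"
proof -
  have "det (matrix ((*v) A)) \<noteq> 0"
  proof (rule det_matrix_nonzero)
    show "v = 0" if "A *v v = 0" for v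
      using assms[of v] that by (cases "v = 0") auto
  qed simp
  then show ?thesis by simp
qed

locale local_metric =
  fixes S :: "(real^'n::finite) set" and G :: "real^'n \<Rightarrow> real^'n^'n"
  assumes open_S: "open S" and smooth_G: "smooth_on G S"
    and transpose_G: "x \<in> S \<Longrightarrow> transpose (G x) = G x"
    and pos_G: "x \<in> S \<Longrightarrow> v \<noteq> 0 \<Longrightarrow> v \<bullet> (G x *v v) > 0"
begin

definition gradient :: "(real^'n \<Rightarrow> real) \<Rightarrow> real^'n \<Rightarrow> real^'n" where
  "gradient f x = matrix_inv (G x) *v (\<chi> i. FD f x (axis i 1))"

definition sqnorm_gradient :: "(real^'n \<Rightarrow> real) \<Rightarrow> real^'n \<Rightarrow> real" where
  "sqnorm_gradient f x = gradient f x \<bullet> (G x *v gradient f x)"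

definition gradient_field :: "(real^'n \<Rightarrow> real) \<Rightarrow> real^'n \<Rightarrow> real^'n" where
  "gradient_field f x = inverse (sqnorm_gradient f x) *\<^sub>R gradient f x"

definition hessian :: "(real^'n \<Rightarrow> real) \<Rightarrow> real^'n \<Rightarrow> real^'n \<Rightarrow> real^'n \<Rightarrow> real" where
  "hessian f x v w =
     (let dG = (\<lambda>l a b. partial l (\<lambda>y. G y $ a $ b) x)
      in \<Sum>i\<in>UNIV. \<Sum>j\<in>UNIV. v $ i * w $ j * (partial i (partial j f) x
        - (\<Sum>k\<in>UNIV. (1/2) * (\<Sum>l\<in>UNIV. matrix_inv (G x) $ k $ l * (dG i j l + dG j i l - dG l i j))
             * FD f x (axis k 1))))"

lemma det_G: "x \<in> S \<Longrightarrow> det (G x) \<noteq> 0"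
  by (rule positive_form_det) (rule pos_G)

lemma form_sym: "x \<in> S \<Longrightarrow> v \<bullet> (G x *v w) = w \<bullet> (G x *v v)"
  by (metis dot_lmul_matrix transpose_G transpose_matrix_vector inner_commute)

lemma has_derivative_G: "x \<in> S \<Longrightarrow> (G has_derivative FD G x) (at x)"
  by (rule smooth_on_has_derivative[OF smooth_G])

lemma FD_G_sym:
  assumes x: "x \<in> S"
  shows "v \<bullet> (FD G x u *v w) = w \<bullet> (FD G x u *v v)"
proof -
  have d: "((\<lambda>y. a \<bullet> (G y *v b)) has_derivative (\<lambda>u. a \<bullet> (FD G x u *v b))) (at x)" for a b
    using has_derivative_matrix_form[OF has_derivative_G[OF x] has_derivative_const has_derivative_const] by simp
  have "((\<lambda>y. v \<bullet> (G y *v w)) has_derivative (\<lambda>u. w \<bullet> (FD G x u *v v))) (at x)"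
    by (rule has_derivative_transform_within_open[OF d open_S x]) (rule form_sym)
  from has_derivative_unique[OF d this] show ?thesis by metis
qed

lemma G_gradient: "x \<in> S \<Longrightarrow> G x *v gradient f x = (\<chi> i. FD f x (axis i 1))"
  by (simp add: gradient_def matrix_vector_mul_assoc matrix_inv det_G)

lemma form_gradient:
  assumes "x \<in> S" "smooth_on f S"
  shows "v \<bullet> (G x *v gradient f x) = FD f x v"
  using linear_functional_inner[OF has_derivative_linear[OF smooth_on_has_derivative[OF assms(2,1)]], of v]
  by (simp add: G_gradient[OF assms(1)] inner_commute)

lemma smooth_gradient:
  assumes "smooth_on f S" shows "smooth_on (gradient f) S"
  unfolding smooth_on_def gradient_def[abs_def]
  by (intro allI Ck_on_matrix_inv_mult open_S smooth_onD[OF smooth_G] Ck_on_vec_lambda det_G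
      smooth_onD[OF smooth_on_frechet_derivative[OF assms]])

lemma smooth_sqnorm_gradient:
  assumes "smooth_on f S" shows "smooth_on (sqnorm_gradient f) S"
  unfolding smooth_on_def sqnorm_gradient_def[abs_def]
  by (intro allI Ck_on_inner Ck_on_matrix_vector_mult open_S smooth_onD[OF smooth_G] smooth_onD[OF smooth_gradient[OF assms]])

lemma sqnorm_gradient_pos:
  assumes x: "x \<in> S" and f: "smooth_on f S" and nz: "(\<chi> i. FD f x (axis i 1)) \<noteq> 0"
  shows "sqnorm_gradient f x > 0"
proof -
  have "gradient f x \<noteq> 0"
  proof
    assume "gradient f x = 0"
    then show False using nz G_gradient[OF x, of f] by simp
  qed
  then show ?thesis using pos_G[OF x] by (simp add: sqnorm_gradient_def)
qed

lemma sqnorm_gradient_eq: "x \<in> S \<Longrightarrow> smooth_on f S \<Longrightarrow> sqnorm_gradient f x = FD f x (gradient f x)"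
  unfolding sqnorm_gradient_def by (rule form_gradient)

lemma smooth_gradient_field:
  assumes "smooth_on f S" "\<And>x. x \<in> S \<Longrightarrow> sqnorm_gradient f x \<noteq> 0"
  shows "smooth_on (gradient_field f) S"
  unfolding smooth_on_def gradient_field_def[abs_def]
  by (intro allI Ck_on_scaleR Ck_on_inverse open_S smooth_onD[OF smooth_gradient] smooth_onD[OF smooth_sqnorm_gradient] assms)

lemma derivative_gradient:
  assumes x: "x \<in> S" and f: "smooth_on f S"
  shows "u \<bullet> (FD G x v *v gradient f x) + u \<bullet> (G x *v FD (gradient f) x v) = FD (\<lambda>y. FD f y u) x v"
proof -
  have "((\<lambda>y. u \<bullet> (G y *v gradient f y)) has_derivative
      (\<lambda>v. u \<bullet> (FD G x v *v gradient f x) + u \<bullet> (G x *v FD (gradient f) x v))) (at x)"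
    using has_derivative_matrix_form[OF has_derivative_G[OF x] has_derivative_const
        smooth_on_has_derivative[OF smooth_gradient[OF f] x], of u] by simp
  then have "((\<lambda>y. FD f y u) has_derivative
      (\<lambda>v. u \<bullet> (FD G x v *v gradient f x) + u \<bullet> (G x *v FD (gradient f) x v))) (at x)"
    by (rule has_derivative_transform_within_open[OF _ open_S x]) (rule form_gradient[OF _ f])
  from FD_eqI[OF this] show ?thesis by simp
qed

text \<open>Differentiating \<open>form_gradient\<close> trades the derivative of the gradient, and
  with it that of the inverse matrix, for second derivatives of \<open>f\<close> and first
  derivatives of \<open>G\<close>. These are the ingredients of the Christoffel symbols.\<close>

lemma lie_gradient:
  assumes x: "x \<in> S" and f: "smooth_on f S"
  shows "lie (gradient f) G x v w = 2 * FD (\<lambda>y. FD f y w) x v - w \<bullet> (FD G x v *v gradient f x)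
     - v \<bullet> (FD G x w *v gradient f x) + v \<bullet> (FD G x (gradient f x) *v w)"
  using derivative_gradient[OF x f, of w v] derivative_gradient[OF x f, of v w]
    frechet_derivative_symmetric[OF open_S x f, of w v] form_sym[OF x, of w "FD (gradient f) x v"]
  unfolding lie_def by linarith

lemma trilinear_expansion:
  assumes x: "x \<in> S"
  shows "a \<bullet> (FD G x u *v b) =
    (\<Sum>i\<in>UNIV. \<Sum>j\<in>UNIV. \<Sum>l\<in>UNIV. u $ i * a $ j * b $ l * partial i (\<lambda>y. G y $ j $ l) x)"
proof -
  have lin: "linear (FD G x)" using has_derivative_linear[OF has_derivative_G[OF x]] .
  have "FD G x u = FD G x (\<Sum>i\<in>UNIV. u $ i *\<^sub>R axis i 1)"
    using basis_expansion[of u] by (simp add: scalar_mult_eq_scaleR)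
  also have "\<dots> = (\<Sum>i\<in>UNIV. u $ i *\<^sub>R FD G x (axis i 1))"
    by (simp add: linear_sum[OF lin] linear_cmul[OF lin])
  finally have 1: "FD G x u = (\<Sum>i\<in>UNIV. u $ i *\<^sub>R FD G x (axis i 1))" .
  have 2: "partial i (\<lambda>y. G y $ j $ l) x = FD G x (axis i 1) $ j $ l" for i j l
    unfolding partial_def
    by (rule FD_eqI) (intro bounded_linear.has_derivative[OF bounded_linear_vec_nth] has_derivative_G x)
  have "a \<bullet> (FD G x u *v b) = (\<Sum>j\<in>UNIV. \<Sum>l\<in>UNIV. \<Sum>i\<in>UNIV. u $ i * a $ j * b $ l * FD G x (axis i 1) $ j $ l)"
    unfolding 1 by (simp add: inner_vec_def matrix_vector_mult_def sum_distrib_left sum_distrib_right mult_ac)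
  also have "\<dots> = (\<Sum>j\<in>UNIV. \<Sum>i\<in>UNIV. \<Sum>l\<in>UNIV. u $ i * a $ j * b $ l * FD G x (axis i 1) $ j $ l)"
    by (intro sum.cong refl sum.swap)
  also have "\<dots> = (\<Sum>i\<in>UNIV. \<Sum>j\<in>UNIV. \<Sum>l\<in>UNIV. u $ i * a $ j * b $ l * FD G x (axis i 1) $ j $ l)"
    by (rule sum.swap)
  finally show ?thesis by (simp add: 2)
qed

lemma second_derivative_expansion:
  assumes x: "x \<in> S" and f: "smooth_on f S"
  shows "FD (\<lambda>y. FD f y w) x v = (\<Sum>i\<in>UNIV. \<Sum>j\<in>UNIV. v $ i * w $ j * partial i (partial j f) x)"
proof -
  have d: "((\<lambda>y. FD f y u) has_derivative FD (\<lambda>y. FD f y u) x) (at x)" for u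
    by (rule smooth_on_has_derivative[OF smooth_on_frechet_derivative[OF f] x])
  have exp: "(\<Sum>j\<in>UNIV. w $ j * FD f y (axis j 1)) = FD f y w" if "y \<in> S" for y
    using linear_functional_inner[OF has_derivative_linear[OF smooth_on_has_derivative[OF f that]], of w]
    by (simp add: inner_vec_def mult.commute)
  have "((\<lambda>y. \<Sum>j\<in>UNIV. w $ j * FD f y (axis j 1)) has_derivative
      (\<lambda>v. \<Sum>j\<in>UNIV. w $ j * FD (\<lambda>y. FD f y (axis j 1)) x v)) (at x)"
    by (intro has_derivative_sum has_derivative_mult_right d)
  then have "((\<lambda>y. FD f y w) has_derivative (\<lambda>v. \<Sum>j\<in>UNIV. w $ j * FD (\<lambda>y. FD f y (axis j 1)) x v)) (at x)"
    by (rule has_derivative_transform_within_open[OF _ open_S x]) (rule exp)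
  from FD_eqI[OF this]
  have "FD (\<lambda>y. FD f y w) x v = (\<Sum>j\<in>UNIV. w $ j * FD (\<lambda>y. FD f y (axis j 1)) x v)" .
  also have "\<dots> = (\<Sum>j\<in>UNIV. w $ j * (\<Sum>i\<in>UNIV. v $ i * FD (\<lambda>y. FD f y (axis j 1)) x (axis i 1)))"
    using linear_functional_inner[OF has_derivative_linear[OF d], of "axis _ 1" v]
    by (simp add: inner_vec_def mult.commute)
  also have "\<dots> = (\<Sum>j\<in>UNIV. \<Sum>i\<in>UNIV. v $ i * w $ j * FD (\<lambda>y. FD f y (axis j 1)) x (axis i 1))"
    by (simp add: sum_distrib_left mult_ac)
  also have "\<dots> = (\<Sum>i\<in>UNIV. \<Sum>j\<in>UNIV. v $ i * w $ j * FD (\<lambda>y. FD f y (axis j 1)) x (axis i 1))"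
    by (rule sum.swap)
  finally show ?thesis by (simp add: partial_def[abs_def])
qed

text \<open>Contracting the Christoffel symbols with the differential of \<open>f\<close> turns the
  inverse matrix into components of the gradient. The three metric derivatives that remain are the
  three trilinear terms of \<open>lie_gradient\<close>.\<close>

lemma hessian_eq_lie:
  assumes x: "x \<in> S" and f: "smooth_on f S"
  shows "2 * hessian f x v w = lie (gradient f) G x v w"
proof -
  let ?g = "gradient f x"
  define dG where "dG l a b = partial l (\<lambda>y. G y $ a $ b) x" for l a b
  have GT: "transpose (matrix_inv (G x)) = matrix_inv (G x)"
  proof -
    have "transpose (matrix_inv (G x)) ** transpose (G x) = mat 1"
      by (simp add: matrix_transpose_mul[symmetric] matrix_inv det_G x)
    then have "transpose (matrix_inv (G x)) ** G x ** matrix_inv (G x) = matrix_inv (G x)"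
      by (simp add: transpose_G x)
    then show ?thesis by (simp add: matrix_mul_assoc[symmetric] matrix_inv det_G x)
  qed
  have inv_sym: "matrix_inv (G x) $ k $ l = matrix_inv (G x) $ l $ k" for k l
    using arg_cong[OF GT, of "\<lambda>A. A $ l $ k"] by (simp add: transpose_def)
  have gl: "?g $ l = (\<Sum>k\<in>UNIV. matrix_inv (G x) $ k $ l * FD f x (axis k 1))" for l
    by (simp add: gradient_def matrix_vector_mult_def inv_sym[of l])
  have chr: "(\<Sum>k\<in>UNIV. (1/2) * (\<Sum>l\<in>UNIV. matrix_inv (G x) $ k $ l * t l) * FD f x (axis k 1)) =
     (1/2) * (\<Sum>l\<in>UNIV. ?g $ l * t l)" for t
  proof -
    have "(\<Sum>k\<in>UNIV. (\<Sum>l\<in>UNIV. matrix_inv (G x) $ k $ l * t l) * FD f x (axis k 1)) =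
        (\<Sum>k\<in>UNIV. \<Sum>l\<in>UNIV. matrix_inv (G x) $ k $ l * FD f x (axis k 1) * t l)"
      by (simp add: sum_distrib_left sum_distrib_right mult_ac)
    also have "\<dots> = (\<Sum>l\<in>UNIV. \<Sum>k\<in>UNIV. matrix_inv (G x) $ k $ l * FD f x (axis k 1) * t l)"
      by (rule sum.swap)
    also have "\<dots> = (\<Sum>l\<in>UNIV. ?g $ l * t l)" by (simp add: gl sum_distrib_right)
    finally show ?thesis by (simp add: sum_divide_distrib[symmetric])
  qed
  have h: "hessian f x v w = (\<Sum>i\<in>UNIV. \<Sum>j\<in>UNIV. v $ i * w $ j * (partial i (partial j f) x
      - (1/2) * (\<Sum>l\<in>UNIV. ?g $ l * (dG i j l + dG j i l - dG l i j))))"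
    unfolding hessian_def Let_def dG_def[symmetric] chr ..
  have "2 * hessian f x v w = (\<Sum>i\<in>UNIV. \<Sum>j\<in>UNIV. 2 * (v $ i * w $ j * partial i (partial j f) x)
      - (\<Sum>l\<in>UNIV. v $ i * w $ j * ?g $ l * dG i j l) - (\<Sum>l\<in>UNIV. v $ i * w $ j * ?g $ l * dG j i l)
      + (\<Sum>l\<in>UNIV. v $ i * w $ j * ?g $ l * dG l i j))"
    unfolding h sum_distrib_left[of 2]
    by (intro sum.cong refl) (simp add: sum.distrib sum_subtractf sum_distrib_left algebra_simps)
  also have "\<dots> = 2 * (\<Sum>i\<in>UNIV. \<Sum>j\<in>UNIV. v $ i * w $ j * partial i (partial j f) x)
      - (\<Sum>i\<in>UNIV. \<Sum>j\<in>UNIV. \<Sum>l\<in>UNIV. v $ i * w $ j * ?g $ l * dG i j l)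
      - (\<Sum>i\<in>UNIV. \<Sum>j\<in>UNIV. \<Sum>l\<in>UNIV. v $ i * w $ j * ?g $ l * dG j i l)
      + (\<Sum>i\<in>UNIV. \<Sum>j\<in>UNIV. \<Sum>l\<in>UNIV. v $ i * w $ j * ?g $ l * dG l i j)"
    by (simp add: sum.distrib sum_subtractf sum_distrib_left)
  also have "(\<Sum>i\<in>UNIV. \<Sum>j\<in>UNIV. v $ i * w $ j * partial i (partial j f) x) = FD (\<lambda>y. FD f y w) x v"
    by (rule second_derivative_expansion[OF x f, symmetric])
  also have "(\<Sum>i\<in>UNIV. \<Sum>j\<in>UNIV. \<Sum>l\<in>UNIV. v $ i * w $ j * ?g $ l * dG i j l) = w \<bullet> (FD G x v *v ?g)"
    unfolding dG_def by (rule trilinear_expansion[OF x, symmetric])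
  also have "(\<Sum>i\<in>UNIV. \<Sum>j\<in>UNIV. \<Sum>l\<in>UNIV. v $ i * w $ j * ?g $ l * dG j i l) = v \<bullet> (FD G x w *v ?g)"
  proof -
    have "(\<Sum>i\<in>UNIV. \<Sum>j\<in>UNIV. \<Sum>l\<in>UNIV. v $ i * w $ j * ?g $ l * dG j i l) =
        (\<Sum>j\<in>UNIV. \<Sum>i\<in>UNIV. \<Sum>l\<in>UNIV. w $ j * v $ i * ?g $ l * dG j i l)"
      by (subst sum.swap) (simp add: mult_ac)
    then show ?thesis unfolding dG_def by (simp only: trilinear_expansion[OF x])
  qed
  also have "(\<Sum>i\<in>UNIV. \<Sum>j\<in>UNIV. \<Sum>l\<in>UNIV. v $ i * w $ j * ?g $ l * dG l i j) = v \<bullet> (FD G x ?g *v w)"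
  proof -
    have "(\<Sum>i\<in>UNIV. \<Sum>j\<in>UNIV. \<Sum>l\<in>UNIV. v $ i * w $ j * ?g $ l * dG l i j) =
        (\<Sum>i\<in>UNIV. \<Sum>l\<in>UNIV. \<Sum>j\<in>UNIV. ?g $ l * v $ i * w $ j * dG l i j)"
      by (rule sum.cong[OF refl], subst sum.swap, simp add: mult_ac)
    also have "\<dots> = (\<Sum>l\<in>UNIV. \<Sum>i\<in>UNIV. \<Sum>j\<in>UNIV. ?g $ l * v $ i * w $ j * dG l i j)"
      by (rule sum.swap)
    finally show ?thesis unfolding dG_def by (simp only: trilinear_expansion[OF x])
  qed
  finally show ?thesis unfolding lie_gradient[OF x f] .
qed

lemma bilinear_form: "bilinear (\<lambda>v w. v \<bullet> (G x *v w))"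
  by (auto simp: bilinear_def linear_iff inner_add_left inner_add_right matrix_vector_right_distrib matrix_vector_mult_scaleR)

lemma bilinear_lie:
  assumes "(X has_derivative X') (at x)"
  shows "bilinear (\<lambda>v w. lie X G x v w)"
proof -
  have "FD X x (a + b) = FD X x a + FD X x b" "FD X x (c *\<^sub>R a) = c *\<^sub>R FD X x a" for a b c
    using linear_add[OF has_derivative_linear[OF assms]] linear_cmul[OF has_derivative_linear[OF assms]]
    by (simp_all add: FD_eqI[OF assms])
  then show ?thesis
    by (auto simp: lie_def bilinear_def linear_iff inner_add_left inner_add_right matrix_vector_right_distrib
        matrix_vector_mult_scaleR algebra_simps)
qed

lemma lie_sym: "x \<in> S \<Longrightarrow> lie X G x v w = lie X G x w v"
  unfolding lie_def using FD_G_sym[of x v "X x" w] form_sym[of x "FD X x v" w] form_sym[of x v "FD X x w"] by simp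

text \<open>The identity d|grad f|^2 = 2 Hess f(grad f, .) in terms of the Lie derivative; it comes
  from exchanging \<open>v\<close> with the gradient in the second derivative of
  \<open>f\<close>.\<close>

lemma derivative_sqnorm_gradient:
  assumes x: "x \<in> S" and f: "smooth_on f S"
  shows "FD (sqnorm_gradient f) x v = lie (gradient f) G x (gradient f x) v"
proof -
  let ?g = "gradient f x"
  have dg: "(gradient f has_derivative FD (gradient f) x) (at x)"
    by (rule smooth_on_has_derivative[OF smooth_gradient[OF f] x])
  have "FD (sqnorm_gradient f) x v = FD (gradient f) x v \<bullet> (G x *v ?g) + ?g \<bullet> (FD G x v *v ?g) + ?g \<bullet> (G x *v FD (gradient f) x v)"
    unfolding sqnorm_gradient_def[abs_def] by (rule FD_eqI[OF has_derivative_matrix_form[OF has_derivative_G[OF x] dg dg]])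
  moreover have "v \<bullet> (FD G x ?g *v ?g) + v \<bullet> (G x *v FD (gradient f) x ?g) = ?g \<bullet> (FD G x v *v ?g) + ?g \<bullet> (G x *v FD (gradient f) x v)"
    unfolding derivative_gradient[OF x f] by (rule frechet_derivative_symmetric[OF open_S x f])
  ultimately show ?thesis
    unfolding lie_def
    using form_sym[OF x, of "FD (gradient f) x v" ?g] form_sym[OF x, of "FD (gradient f) x ?g" v] FD_G_sym[OF x, of ?g ?g v]
    by linarith
qed

text \<open>Leibniz rule for the factor 1/N, with the derivative of N taken from the preceding
  lemma. The result is the expression of \<open>carleman_iff_conformal\<close>, with the Lie
  derivative along the gradient in the place of \<open>B\<close>.\<close>

lemma lie_gradient_field:
  assumes x: "x \<in> S" and f: "smooth_on f S" and N: "sqnorm_gradient f x \<noteq> 0"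
  shows "lie (gradient_field f) G x v w = lie (gradient f) G x v w / sqnorm_gradient f x
     - (lie (gradient f) G x (gradient f x) v * (w \<bullet> (G x *v gradient f x))
      + lie (gradient f) G x (gradient f x) w * (v \<bullet> (G x *v gradient f x))) / (sqnorm_gradient f x)\<^sup>2"
proof -
  let ?N = "sqnorm_gradient f x"
  have "((\<lambda>y. inverse (sqnorm_gradient f y)) has_derivative (\<lambda>v. - (inverse ?N * FD (sqnorm_gradient f) x v * inverse ?N))) (at x)"
    by (rule Deriv.has_derivative_inverse[OF N smooth_on_has_derivative[OF smooth_sqnorm_gradient[OF f] x]])
  from lie_scale_field[OF this smooth_on_has_derivative[OF smooth_gradient[OF f] x] has_derivative_G[OF x], of v w]
  have "lie (gradient_field f) G x v w = inverse ?N * lie (gradient f) G x v w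
     + - (inverse ?N * lie (gradient f) G x (gradient f x) v * inverse ?N) * (w \<bullet> (G x *v gradient f x))
     + - (inverse ?N * lie (gradient f) G x (gradient f x) w * inverse ?N) * (v \<bullet> (G x *v gradient f x))"
    unfolding gradient_field_def[abs_def] derivative_sqnorm_gradient[OF x f] form_sym[OF x, of "gradient f x" w] .
  then show ?thesis
    by (simp add: divide_inverse power2_eq_square algebra_simps)
qed

theorem carleman_iff_lie_gradient_field:
  assumes x: "x \<in> S" and f: "smooth_on f S" and N: "sqnorm_gradient f x > 0"
  shows "(\<forall>v. v \<bullet> (G x *v v) = sqnorm_gradient f x \<and> v \<bullet> (G x *v gradient f x) = 0 \<longrightarrow>
      hessian f x (gradient f x) (gradient f x) + hessian f x v v = 0) \<longleftrightarrow>
    (\<exists>c. \<forall>v w. lie (gradient_field f) G x v w = c * (v \<bullet> (G x *v w)))"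
proof -
  have h: "hessian f x a a + hessian f x b b = 0 \<longleftrightarrow> lie (gradient f) G x a a + lie (gradient f) G x b b = 0" for a b
    using hessian_eq_lie[OF x f, of a a] hessian_eq_lie[OF x f, of b b] by linarith
  show ?thesis
    unfolding h using N
    by (simp add: lie_gradient_field[OF x f]
      carleman_iff_conformal[OF bilinear_form form_sym[OF x] pos_G[OF x] bilinear_lie[OF smooth_on_has_derivative[OF smooth_gradient[OF f] x]]
        lie_sym[OF x] sqnorm_gradient_def N])
qed

lemma FD_gradient_field:
  assumes "x \<in> S" "smooth_on f S" "sqnorm_gradient f x \<noteq> 0"
  shows "FD f x (gradient_field f x) = 1"
proof -
  have "FD f x (gradient_field f x) = inverse (sqnorm_gradient f x) * FD f x (gradient f x)"
    using linear_cmul[OF has_derivative_linear[OF smooth_on_has_derivative[OF assms(2,1)]]]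
    by (simp add: gradient_field_def)
  then show ?thesis using assms by (simp add: sqnorm_gradient_eq[symmetric])
qed

lemma form_gradient_field:
  assumes "x \<in> S" "smooth_on f S"
  shows "v \<bullet> (G x *v gradient_field f x) = inverse (sqnorm_gradient f x) * FD f x v"
  using form_gradient[OF assms] by (simp add: gradient_field_def matrix_vector_mult_scaleR)

lemma gradient_field_bracket:
  assumes x: "x \<in> S" and f: "smooth_on f S" and h: "smooth_on h S"
    and N: "\<And>x. x \<in> S \<Longrightarrow> sqnorm_gradient f x \<noteq> 0" "\<And>x. x \<in> S \<Longrightarrow> sqnorm_gradient h x \<noteq> 0"
    and orth: "\<And>y. y \<in> S \<Longrightarrow> FD h y (gradient_field f y) = 0"
    and conf: "\<And>v w. lie (gradient_field f) G x v w = c * (v \<bullet> (G x *v w))"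
  obtains \<beta> where "FD (gradient_field h) x (gradient_field f x) - FD (gradient_field f) x (gradient_field h x) =
     \<beta> *\<^sub>R gradient_field h x"
proof -
  let ?X = "gradient_field f" and ?Y = "gradient_field h"
  define M where "M y = inverse (sqnorm_gradient h y)" for y
  have Ms: "smooth_on M S" unfolding smooth_on_def M_def[abs_def]
    by (intro allI Ck_on_inverse open_S smooth_onD[OF smooth_sqnorm_gradient[OF h]] N)
  have M0: "M x \<noteq> 0" using N(2)[OF x] by (simp add: M_def)
  have sX: "smooth_on ?X S" and sY: "smooth_on ?Y S"
    using smooth_gradient_field f h N by blast+
  have dX: "(?X has_derivative FD ?X x) (at x)" and dY: "(?Y has_derivative FD ?Y x) (at x)"
    and dM: "(M has_derivative FD M x) (at x)"
    using smooth_on_has_derivative[OF sX x] smooth_on_has_derivative[OF sY x] smooth_on_has_derivative[OF Ms x] .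
  \<comment> \<open>The form dual to Y is M dh. Its Lie derivative along X is X(M) dh, since dh(X) =
    0 identically, and it is also the form dual to [X, Y] plus c M dh, by conformality. Comparing
    the two gives \<beta>.\<close>
  define \<beta> where "\<beta> = FD M x (?X x) / M x - c"
  have "u \<bullet> (G x *v (FD ?Y x (?X x) - FD ?X x (?Y x))) = u \<bullet> (G x *v (\<beta> *\<^sub>R ?Y x))" for u
  proof -
    have YM: "v \<bullet> (G y *v ?Y y) = M y * FD h y v" if "y \<in> S" for y v
      using form_gradient_field[OF that h] by (simp add: M_def)
    have ddh: "((\<lambda>y. FD h y u) has_derivative FD (\<lambda>y. FD h y u) x) (at x)"
      by (rule smooth_on_has_derivative[OF smooth_on_frechet_derivative[OF h] x])
    have "((\<lambda>y. u \<bullet> (G y *v ?Y y)) has_derivative (\<lambda>v. u \<bullet> (FD G x v *v ?Y x) + u \<bullet> (G x *v FD ?Y x v))) (at x)"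
      using has_derivative_matrix_form[OF has_derivative_G[OF x] has_derivative_const dY, of u] by simp
    then have 1: "((\<lambda>y. M y * FD h y u) has_derivative (\<lambda>v. u \<bullet> (FD G x v *v ?Y x) + u \<bullet> (G x *v FD ?Y x v))) (at x)"
      by (rule has_derivative_transform_within_open[OF _ open_S x]) (rule YM)
    from has_derivative_unique[OF 1 has_derivative_mult[OF dM ddh]]
    have 2: "u \<bullet> (FD G x (?X x) *v ?Y x) + u \<bullet> (G x *v FD ?Y x (?X x)) =
        M x * FD (\<lambda>y. FD h y u) x (?X x) + FD M x (?X x) * FD h x u" by metis
    have "((\<lambda>y. FD h y (?X y)) has_derivative (\<lambda>v. 0)) (at x)"
      by (rule has_derivative_transform_within_open[OF has_derivative_const open_S x]) (simp add: orth)
    from has_derivative_unique[OF has_derivative_frechet_derivative_apply[OF open_S x h dX] this]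
    have 3: "FD (\<lambda>y. FD h y (?X x)) x u + FD h x (FD ?X x u) = 0" by metis
    have 4: "FD (\<lambda>y. FD h y (?X x)) x u = FD (\<lambda>y. FD h y u) x (?X x)"
      by (rule frechet_derivative_symmetric[OF open_S x h])
    have 5: "u \<bullet> (FD G x (?X x) *v ?Y x) + FD ?X x u \<bullet> (G x *v ?Y x) + u \<bullet> (G x *v FD ?X x (?Y x)) = c * (M x * FD h x u)"
      using conf[of u "?Y x"] by (simp add: lie_def YM[OF x])
    have "u \<bullet> (G x *v FD ?Y x (?X x)) - u \<bullet> (G x *v FD ?X x (?Y x)) =
        M x * (FD (\<lambda>y. FD h y u) x (?X x) + FD h x (FD ?X x u)) + FD M x (?X x) * FD h x u - c * (M x * FD h x u)"
      using 2 5 by (simp add: YM[OF x] algebra_simps)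
    also have "\<dots> = \<beta> * (M x * FD h x u)"
      using 3 4 M0 by (simp add: \<beta>_def field_simps)
    also have "\<dots> = u \<bullet> (G x *v (\<beta> *\<^sub>R ?Y x))"
      by (simp add: matrix_vector_mult_scaleR YM[OF x])
    finally show ?thesis by (simp add: matrix_vector_mult_diff_distrib inner_diff_right)
  qed
  then have "(FD ?Y x (?X x) - FD ?X x (?Y x)) - \<beta> *\<^sub>R ?Y x = 0"
    using pos_G[OF x, of "(FD ?Y x (?X x) - FD ?X x (?Y x)) - \<beta> *\<^sub>R ?Y x"]
    by (metis (no_types, lifting) inner_diff_right less_irrefl matrix_vector_mult_diff_distrib right_minus_eq)
  then show thesis using that[of \<beta>] by simp
qed

text \<open>The bracket of the two fields is a multiple of each of them, and they are independent.\<close>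

theorem gradient_fields_commute:
  assumes x: "x \<in> S" and f: "smooth_on f S" and h: "smooth_on h S"
    and N: "\<And>x. x \<in> S \<Longrightarrow> sqnorm_gradient f x \<noteq> 0" "\<And>x. x \<in> S \<Longrightarrow> sqnorm_gradient h x \<noteq> 0"
    and orth: "\<And>y. y \<in> S \<Longrightarrow> FD h y (gradient_field f y) = 0" "\<And>y. y \<in> S \<Longrightarrow> FD f y (gradient_field h y) = 0"
    and conf: "\<exists>c. \<forall>v w. lie (gradient_field f) G x v w = c * (v \<bullet> (G x *v w))"
      "\<exists>c. \<forall>v w. lie (gradient_field h) G x v w = c * (v \<bullet> (G x *v w))"
  shows "FD (gradient_field h) x (gradient_field f x) = FD (gradient_field f) x (gradient_field h x)"
proof -
  let ?X = "gradient_field f" and ?Y = "gradient_field h"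
  obtain \<beta> where b: "FD ?Y x (?X x) - FD ?X x (?Y x) = \<beta> *\<^sub>R ?Y x"
    using gradient_field_bracket[OF x f h N orth(1)] conf(1) by metis
  obtain \<beta>' where b': "FD ?X x (?Y x) - FD ?Y x (?X x) = \<beta>' *\<^sub>R ?X x"
    using gradient_field_bracket[OF x h f N(2,1) orth(2)] conf(2) by metis
  have lin: "linear (FD h x)" using has_derivative_linear[OF smooth_on_has_derivative[OF h x]] .
  have "\<beta> *\<^sub>R ?Y x = - (\<beta>' *\<^sub>R ?X x)" using b b' by (metis minus_diff_eq)
  \<comment> \<open>dh separates the two fields: it is 1 on \<open>?Y\<close> and 0 on
    \<open>?X\<close>.\<close>
  then have "FD h x (\<beta> *\<^sub>R ?Y x) = FD h x (- (\<beta>' *\<^sub>R ?X x))" by simp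
  then have "\<beta> = 0"
    using linear_cmul[OF lin] linear_neg[OF lin] FD_gradient_field[OF x h N(2)[OF x]] orth(1)[OF x] by simp
  then show ?thesis using b by simp
qed

text \<open>A conformal \<open>Y\<close> changes the rescaled metric by a scalar multiple of
  \<open>G\<close>, and the scalar can be tested on the gradient field of \<open>f\<close>. That
  field has constant length 1 for the rescaled metric and commutes with \<open>Y\<close>, so the Lie
  derivative vanishes on it and the scalar is 0.\<close>

lemma lie_normalised_metric:
  assumes x: "x \<in> S" and f: "smooth_on f S" and N: "\<And>x. x \<in> S \<Longrightarrow> sqnorm_gradient f x \<noteq> 0"
    and comm: "FD Y x (gradient_field f x) = FD (gradient_field f) x (Y x)"
    and conf: "\<And>v w. lie Y G x v w = c * (v \<bullet> (G x *v w))"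
  shows "lie Y (\<lambda>y. sqnorm_gradient f y *\<^sub>R G y) x v w = 0"
proof -
  let ?X = "gradient_field f" and ?N = "sqnorm_gradient f"
  let ?H = "\<lambda>y. ?N y *\<^sub>R G y"
  have sX: "smooth_on ?X S" using smooth_gradient_field[OF f] N by blast
  have dX: "(?X has_derivative FD ?X x) (at x)" by (rule smooth_on_has_derivative[OF sX x])
  have dN: "(?N has_derivative FD ?N x) (at x)" by (rule smooth_on_has_derivative[OF smooth_sqnorm_gradient[OF f] x])
  have scale: "lie Y ?H x v w = (FD ?N x (Y x) + ?N x * c) * (v \<bullet> (G x *v w))" for v w
    unfolding lie_scale_metric[OF dN has_derivative_G[OF x]] conf by (simp add: algebra_simps)
  have dH: "(?H has_derivative FD ?H x) (at x)"
    using has_derivative_scaleR[OF dN has_derivative_G[OF x]] frechet_derivative_works differentiable_def by blast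
  have H1: "?X y \<bullet> (?H y *v ?X y) = 1" if "y \<in> S" for y
    using form_gradient_field[OF that f, of "?X y"] FD_gradient_field[OF that f N[OF that]] N[OF that]
    by (simp add: scaleR_matrix_vector_assoc[symmetric])
  have "((\<lambda>y. ?X y \<bullet> (?H y *v ?X y)) has_derivative (\<lambda>v. 0)) (at x)"
    by (rule has_derivative_transform_within_open[OF has_derivative_const open_S x]) (simp only: H1)
  from has_derivative_unique[OF has_derivative_matrix_form[OF dH dX dX] this]
  have "FD ?X x (Y x) \<bullet> (?H x *v ?X x) + ?X x \<bullet> (FD ?H x (Y x) *v ?X x) + ?X x \<bullet> (?H x *v FD ?X x (Y x)) = 0"
    by metis
  then have "lie Y ?H x (?X x) (?X x) = 0" by (simp add: lie_def comm)
  moreover have "?X x \<bullet> (G x *v ?X x) \<noteq> 0"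
    using H1[OF x] by (auto simp: scaleR_matrix_vector_assoc[symmetric])
  ultimately have "FD ?N x (Y x) + ?N x * c = 0" by (simp add: scale)
  then show ?thesis by (simp add: scale)
qed

end

section \<open>Charts\<close>

lemma is_chartD:
  assumes "is_chart X c"
  shows "openin X (fst c)" "open (snd c ` fst c)" "inj_on (snd c) (fst c)"
    "homeomorphic_map (subtopology X (fst c)) (top_of_set (snd c ` fst c)) (snd c)"
proof -
  show op: "openin X (fst c)" "open (snd c ` fst c)"
    and hom: "homeomorphic_map (subtopology X (fst c)) (top_of_set (snd c ` fst c)) (snd c)"
    using assms by (auto simp: is_chart_def case_prod_beta)
  show "inj_on (snd c) (fst c)"
    using homeomorphic_imp_injective_map[OF hom] openin_subset[OF op(1)] by (simp add: Int_absorb1)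
qed

lemma in_chart_eq: "in_chart c f x = f (inv_into (fst c) (snd c) x)"
  by (simp add: in_chart_def case_prod_beta)

lemma in_chart_apply: "is_chart X c \<Longrightarrow> q \<in> fst c \<Longrightarrow> in_chart c f (snd c q) = f q"
  by (simp add: in_chart_eq is_chartD(3))

lemma chart_image_open:
  assumes c: "is_chart X c" and W: "openin X W"
  shows "open (snd c ` (fst c \<inter> W))"
proof -
  have "openin (subtopology X (fst c)) (fst c \<inter> W)"
    using W by (auto simp: openin_subtopology)
  then have "openin (top_of_set (snd c ` fst c)) (snd c ` (fst c \<inter> W))"
    using homeomorphic_imp_open_map[OF is_chartD(4)[OF c]] by (simp add: open_map_def)
  then show ?thesis using is_chartD(2)[OF c] openin_open_trans by blast
qed

locale riemannian =
  fixes X :: "'a topology" and A :: "('a, 'n::finite) chart set" and g :: "('a, 'n) metric"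
  assumes RM: "riemannian_manifold X A g"
begin

lemma atlas_chart: "c \<in> A \<Longrightarrow> is_chart X c"
  using RM by (simp add: riemannian_manifold_def smooth_manifold_def)

lemma atlas_maximal: "is_chart X c \<Longrightarrow> (\<And>c'. c' \<in> A \<Longrightarrow> smooth_compatible c c') \<Longrightarrow> c \<in> A"
  using RM unfolding riemannian_manifold_def smooth_manifold_def by blast

lemma atlas_cover: "p \<in> topspace X \<Longrightarrow> \<exists>c\<in>A. p \<in> fst c"
proof -
  assume "p \<in> topspace X"
  moreover have "\<Union> (fst ` A) = topspace X"
    using RM by (simp add: riemannian_manifold_def smooth_manifold_def)
  ultimately show ?thesis by blast
qed

lemma smooth_transition:
  assumes "c \<in> A" "c' \<in> A"
  shows "smooth_on (in_chart c (snd c')) (snd c ` (fst c \<inter> fst c'))"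
proof -
  have "smooth_compatible c c'"
    using RM assms by (simp add: riemannian_manifold_def smooth_manifold_def)
  then show ?thesis by (simp add: smooth_compatible_def case_prod_beta)
qed

lemma smooth_metric: "c \<in> A \<Longrightarrow> smooth_on (in_chart c (g c)) (snd c ` fst c)"
  using RM by (simp add: riemannian_manifold_def riemannian_metric_def)

lemma metric_transform:
  assumes "c \<in> A" "c' \<in> A" "q \<in> fst c" "q \<in> fst c'"
    and "(in_chart c (snd c') has_derivative L) (at (snd c q))"
  shows "v \<bullet> (g c q *v w) = L v \<bullet> (g c' q *v L w)"
proof -
  let ?J = "matrix L"
  have J: "jacobian_at c c' q = ?J"
    using frechet_derivative_at[OF assms(5)] by (simp add: jacobian_at_def)
  have "\<forall>c\<in>A. \<forall>c'\<in>A. \<forall>q\<in>fst c \<inter> fst c'.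
      g c q = transpose (jacobian_at c c' q) ** g c' q ** jacobian_at c c' q"
    using RM unfolding riemannian_manifold_def riemannian_metric_def by blast
  from this[rule_format, OF assms(1,2) IntI[OF assms(3,4)]]
  have "g c q = transpose ?J ** g c' q ** ?J" unfolding J .
  then have "v \<bullet> (g c q *v w) = v \<bullet> (transpose ?J *v (g c' q *v (?J *v w)))"
    by (simp add: matrix_vector_mul_assoc matrix_mul_assoc)
  also have "\<dots> = (?J *v v) \<bullet> (g c' q *v (?J *v w))"
    by (metis dot_lmul_matrix transpose_matrix_vector transpose_transpose)
  finally show ?thesis by (simp add: matrix_frechet_mult[OF assms(5)])
qed

lemma local_metric_chart:
  assumes c: "c \<in> A" and W: "openin X W"
  shows "local_metric (snd c ` (fst c \<inter> W)) (in_chart c (g c))"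
proof
  show "open (snd c ` (fst c \<inter> W))" by (rule chart_image_open[OF atlas_chart[OF c] W])
  show "smooth_on (in_chart c (g c)) (snd c ` (fst c \<inter> W))"
    by (rule smooth_on_subset[OF smooth_metric[OF c]]) blast
  fix x assume "x \<in> snd c ` (fst c \<inter> W)"
  then obtain q where q: "q \<in> fst c" "x = snd c q" by blast
  have eq: "in_chart c (g c) x = g c q" using in_chart_apply[OF atlas_chart[OF c] q(1), of "g c"] q(2) by simp
  have "\<forall>c\<in>A. \<forall>q\<in>fst c. transpose (g c q) = g c q \<and> (\<forall>v. v \<noteq> 0 \<longrightarrow> v \<bullet> (g c q *v v) > 0)"
    using RM unfolding riemannian_manifold_def riemannian_metric_def by blast
  from this[rule_format, OF c q(1)] show "transpose (in_chart c (g c) x) = in_chart c (g c) x"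
    and "\<And>v. v \<noteq> 0 \<Longrightarrow> 0 < v \<bullet> (in_chart c (g c) x *v v)"
    unfolding eq by blast+
qed

lemma differential_eq: "differential c \<phi> q = (\<chi> i. FD (in_chart c \<phi>) (snd c q) (axis i 1))"
  by (simp add: differential_def partial_def)

lemma grad_eq:
  assumes "c \<in> A" "q \<in> fst c"
  shows "grad g c \<phi> q = local_metric.gradient (in_chart c (g c)) (in_chart c \<phi>) (snd c q)"
proof -
  interpret local_metric "snd c ` (fst c \<inter> topspace X)" "in_chart c (g c)"
    by (rule local_metric_chart[OF assms(1)]) simp
  show ?thesis
    by (simp add: grad_def gradient_def differential_eq in_chart_apply[OF atlas_chart[OF assms(1)] assms(2)])
qed

lemma hess_eq:
  assumes "c \<in> A" "q \<in> fst c"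
  shows "hess g c \<phi> q v w = local_metric.hessian (in_chart c (g c)) (in_chart c \<phi>) (snd c q) v w"
proof -
  interpret local_metric "snd c ` (fst c \<inter> topspace X)" "in_chart c (g c)"
    by (rule local_metric_chart[OF assms(1)]) simp
  have "in_chart c (\<lambda>r. g c r $ a $ b) = (\<lambda>y. in_chart c (g c) y $ a $ b)" for a b
    by (simp add: in_chart_eq[abs_def])
  then show ?thesis
    by (simp add: hess_def hessian_def christoffel_def Let_def differential_eq
        in_chart_apply[OF atlas_chart[OF assms(1)] assms(2)])
qed

text \<open>Carries the pointwise equivalence of \<open>carleman_iff_lie_gradient_field\<close> over
  to the manifold; from here on the Hessian no longer appears.\<close>

lemma LCW_iff_conformal:
  assumes W: "openin X W"
  shows "LCW A g W \<phi> \<longleftrightarrow> smooth_fun_on A W \<phi> \<and>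
    (\<forall>c\<in>A. \<forall>x\<in>snd c ` (fst c \<inter> W). (\<chi> i. FD (in_chart c \<phi>) x (axis i 1)) \<noteq> 0 \<and>
       (\<exists>k. \<forall>v w. lie (local_metric.gradient_field (in_chart c (g c)) (in_chart c \<phi>)) (in_chart c (g c)) x v w =
          k * (v \<bullet> (in_chart c (g c) x *v w))))" (is "_ \<longleftrightarrow> _ \<and> (\<forall>c\<in>A. \<forall>x\<in>_. ?N c x \<and> ?K c x)")
proof -
  have pointwise: "(differential c \<phi> q \<noteq> 0 \<and> (\<forall>v. g_norm g c q v = g_norm g c q (grad g c \<phi> q) \<and> g_inner g c q v (grad g c \<phi> q) = 0 \<longrightarrow>
           hess g c \<phi> q (grad g c \<phi> q) (grad g c \<phi> q) + hess g c \<phi> q v v = 0)) \<longleftrightarrow> ?N c (snd c q) \<and> ?K c (snd c q)"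
    if s: "smooth_fun_on A W \<phi>" and c: "c \<in> A" and q: "q \<in> W" "q \<in> fst c" for c q
  proof -
    interpret local_metric "snd c ` (fst c \<inter> W)" "in_chart c (g c)"
      by (rule local_metric_chart[OF c W])
    have x: "snd c q \<in> snd c ` (fst c \<inter> W)" using q by blast
    have f: "smooth_on (in_chart c \<phi>) (snd c ` (fst c \<inter> W))"
      using s c by (auto simp: smooth_fun_on_def)
    have G: "g c q = in_chart c (g c) (snd c q)"
      by (rule in_chart_apply[OF atlas_chart[OF c] q(2), symmetric])
    \<comment> \<open>Where the differential vanishes both sides are false, so the equivalence is
      invoked only where the gradient has positive length.\<close>
    show ?thesis
    proof (cases "?N c (snd c q)")
      case True
      from carleman_iff_lie_gradient_field[OF x f sqnorm_gradient_pos[OF x f True]] show ?thesis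
        using True unfolding differential_eq grad_eq[OF c q(2)] hess_eq[OF c q(2)] g_norm_def g_inner_def G
          sqnorm_gradient_def by simp
    qed (simp add: differential_eq)
  qed
  have img: "(\<forall>x\<in>snd c ` (fst c \<inter> W). P x) \<longleftrightarrow> (\<forall>q\<in>W \<inter> fst c. P (snd c q))"
    for c :: "('a, 'n) chart" and P by auto
  show ?thesis unfolding LCW_def img
    by (rule conj_cong[OF refl], rule ball_cong[OF refl], rule ball_cong[OF refl], rule pointwise) auto
qed

lemma smooth_fun_on_comp_chart:
  assumes c: "c \<in> A" and V: "openin X V" "V \<subseteq> fst c" and h: "smooth_on h T" "open T" "snd c ` V \<subseteq> T"
  shows "smooth_fun_on A V (\<lambda>q. h (snd c q))"
  unfolding smooth_fun_on_def
proof (rule ballI, clarify)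
  fix U' \<eta> assume c': "(U', \<eta>) \<in> A"
  let ?c' = "(U', \<eta>)"
  have op: "open (\<eta> ` (U' \<inter> V))" using chart_image_open[OF atlas_chart[OF c'] V(1)] by simp
  have "smooth_on (\<lambda>x. h (in_chart ?c' (snd c) x)) (\<eta> ` (U' \<inter> V))"
  proof (rule smooth_on_compose[OF op h(2) _ _ h(1)])
    show "in_chart ?c' (snd c) ` \<eta> ` (U' \<inter> V) \<subseteq> T"
      using in_chart_apply[OF atlas_chart[OF c'], of _ "snd c"] h(3) by auto
    show "smooth_on (in_chart ?c' (snd c)) (\<eta> ` (U' \<inter> V))"
      by (rule smooth_on_subset[OF smooth_transition[OF c' c]]) (use V(2) in auto)
  qed
  then show "smooth_on (in_chart ?c' (\<lambda>q. h (snd c q))) (\<eta> ` (U' \<inter> V))"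
    by (simp add: in_chart_eq[abs_def])
qed

text \<open>Maximality of \<open>A\<close> makes the straightened coordinates an admissible chart:
  its transition maps to the other charts are those of \<open>c\<close> composed with \<Psi> or
  \<Theta>, hence smooth.\<close>

lemma compose_chart:
  assumes c: "c \<in> A" and T: "open T" "T \<subseteq> snd c ` fst c" "open Z"
    and hom: "homeomorphism Z T \<Psi> \<Theta>" and sm: "smooth_on \<Psi> Z" "smooth_on \<Theta> T"
    and V: "V = {q \<in> fst c. snd c q \<in> T}" and \<Phi>: "\<Phi> = (\<lambda>q. \<Theta> (snd c q))"
  shows "(V, \<Phi>) \<in> A" "openin X V" "\<Phi> ` V = Z" "\<And>z f. z \<in> Z \<Longrightarrow> in_chart (V, \<Phi>) f z = in_chart c f (\<Psi> z)"
proof -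
  note ch = atlas_chart[OF c]
  note chD = is_chartD[OF ch]
  have h: "\<Theta> ` T = Z" "\<Psi> ` Z = T" "\<And>y. y \<in> T \<Longrightarrow> \<Psi> (\<Theta> y) = y" "\<And>z. z \<in> Z \<Longrightarrow> \<Theta> (\<Psi> z) = z"
    using hom by (auto simp: homeomorphism_def)
  have VU: "V \<subseteq> fst c" by (auto simp: V)
  have img: "snd c ` V = T" using T(2) by (auto simp: V)
  have "openin (subtopology X (fst c)) {q \<in> topspace (subtopology X (fst c)). snd c q \<in> T}"
    by (rule openin_continuous_map_preimage[OF homeomorphic_imp_continuous_map[OF chD(4)]])
      (simp add: openin_open_eq[OF chD(2)] T(1,2))
  moreover have "{q \<in> topspace (subtopology X (fst c)). snd c q \<in> T} = V"
    using openin_subset[OF chD(1)] by (auto simp: V)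
  ultimately have "openin (subtopology X (fst c)) V" by simp
  then show opV: "openin X V" using chD(1) openin_trans_full by blast
  show imgV: "\<Phi> ` V = Z" using h(1) img by (auto simp: \<Phi> image_image[symmetric])
  have inj: "inj_on \<Phi> V"
  proof (rule inj_onI)
    fix q r assume qr: "q \<in> V" "r \<in> V" "\<Phi> q = \<Phi> r"
    then have "\<Psi> (\<Theta> (snd c q)) = \<Psi> (\<Theta> (snd c r))" by (simp add: \<Phi>)
    then have "snd c q = snd c r" using qr(1,2) h(3) by (simp add: V)
    then show "q = r" using chD(3) qr(1,2) VU by (auto dest: inj_onD)
  qed
  have inv: "inv_into V \<Phi> z = inv_into (fst c) (snd c) (\<Psi> z)" if z: "z \<in> Z" for z
  proof -
    obtain q where q: "q \<in> V" "snd c q = \<Psi> z" using img h(2) z by (metis imageE imageI)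
    have "\<Phi> q = z" using q h(4) z by (simp add: \<Phi>)
    then have "inv_into V \<Phi> z = q" using inv_into_f_f[OF inj q(1)] by simp
    moreover have "inv_into (fst c) (snd c) (\<Psi> z) = q"
      using inv_into_f_f[OF chD(3), of q] q VU by auto
    ultimately show ?thesis by simp
  qed
  then show "in_chart (V, \<Phi>) f z = in_chart c f (\<Psi> z)" if "z \<in> Z" for z and f :: "'a \<Rightarrow> 'd"
    using that by (simp add: in_chart_eq)
  have chart: "is_chart X (V, \<Phi>)"
  proof -
    have "homeomorphic_map (subtopology (subtopology X (fst c)) V) (subtopology (top_of_set (snd c ` fst c)) T) (snd c)"
      by (rule homeomorphic_map_subtopologies[OF chD(4)]) (use openin_subset[OF chD(1)] VU img T(2) in auto)
    then have "homeomorphic_map (subtopology X V) (top_of_set T) (snd c)"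
      using VU T(2) by (simp add: subtopology_subtopology Int_absorb1)
    moreover have "homeomorphic_map (top_of_set T) (top_of_set Z) \<Theta>"
      using hom unfolding homeomorphic_map_maps homeomorphic_maps_def
      by (intro exI[of _ \<Psi>]) (auto simp: homeomorphism_def)
    ultimately have "homeomorphic_map (subtopology X V) (top_of_set Z) (\<Theta> \<circ> snd c)"
      by (rule homeomorphic_map_compose)
    then show ?thesis using opV T(3) by (simp add: is_chart_def imgV) (simp add: \<Phi> o_def)
  qed
  show "(V, \<Phi>) \<in> A"
  proof (rule atlas_maximal[OF chart])
    fix c' assume c': "c' \<in> A"
    obtain V' \<eta> where c'_eq: "c' = (V', \<eta>)" by fastforce
    have opV': "openin X V'" using is_chartD(1)[OF atlas_chart[OF c']] by (simp add: c'_eq)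
    have o1: "open (\<Phi> ` (V \<inter> V'))" using chart_image_open[OF chart opV'] by simp
    have o2: "open (snd c ` (fst c \<inter> (V \<inter> V')))" "open (\<eta> ` (V' \<inter> V))"
      using chart_image_open[OF ch openin_Int[OF opV opV']] chart_image_open[OF atlas_chart[OF c'] opV] by (simp_all add: c'_eq)
    have sub1: "\<Phi> ` (V \<inter> V') \<subseteq> Z" using imgV by blast
    have "smooth_on (\<lambda>z. in_chart c \<eta> (\<Psi> z)) (\<Phi> ` (V \<inter> V'))"
    proof (rule smooth_on_compose[where f="in_chart c \<eta>" and g=\<Psi>, OF o1 o2(1)])
      show "\<Psi> ` \<Phi> ` (V \<inter> V') \<subseteq> snd c ` (fst c \<inter> (V \<inter> V'))"
      proof safe
        fix q assume "q \<in> V" "q \<in> V'"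
        then show "\<Psi> (\<Phi> q) \<in> snd c ` (fst c \<inter> (V \<inter> V'))"
          using h(3) VU by (auto simp: \<Phi> V)
      qed
      show "smooth_on \<Psi> (\<Phi> ` (V \<inter> V'))" by (rule smooth_on_subset[OF sm(1) sub1])
      show "smooth_on (in_chart c \<eta>) (snd c ` (fst c \<inter> (V \<inter> V')))"
        by (rule smooth_on_subset[OF smooth_transition[OF c c', unfolded c'_eq snd_conv fst_conv]]) auto
    qed
    then have 1: "smooth_on (in_chart (V, \<Phi>) \<eta>) (\<Phi> ` (V \<inter> V'))"
      by (rule smooth_on_cong[OF o1, rotated]) (use sub1 inv in \<open>auto simp: in_chart_eq subset_iff\<close>)
    have "smooth_on (\<lambda>x. \<Theta> (in_chart c' (snd c) x)) (\<eta> ` (V' \<inter> V))"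
    proof (rule smooth_on_compose[where g="in_chart c' (snd c)", OF o2(2) T(1) _ _ sm(2)])
      show "in_chart c' (snd c) ` \<eta> ` (V' \<inter> V) \<subseteq> T"
        using in_chart_apply[OF atlas_chart[OF c'], of _ "snd c"] img by (auto simp: c'_eq)
      show "smooth_on (in_chart c' (snd c)) (\<eta> ` (V' \<inter> V))"
        by (rule smooth_on_subset[OF smooth_transition[OF c' c]]) (use VU in \<open>auto simp: c'_eq\<close>)
    qed
    then have 2: "smooth_on (in_chart c' \<Phi>) (\<eta> ` (V \<inter> V'))"
      by (simp add: in_chart_eq[abs_def] \<Phi> Int_commute)
    show "smooth_compatible (V, \<Phi>) c'"
      using 1 2 by (simp add: smooth_compatible_def c'_eq)
  qed
qed

section \<open>The normal form\<close>

text \<open>Being a weight is a condition in every chart \<open>c\<close>, so an arbitrary one is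
  fixed and compared with \<Phi> by the transition map \<open>F\<close>. It carries the normalised
  gradient of a coordinate to the constant axis field, along which the rescaled metric
  \<open>K\<close> does not change; \<open>lie_pullback\<close> brings this back to
  \<open>c\<close>.\<close>

lemma block_form_orthogonal_LCWs:
  assumes e: "bij_betw e {1..CARD('n)} UNIV" and m: "m \<le> CARD('n)"
    and VA: "(V, \<Phi>) \<in> A" and form: "conformal_block_form A g e m (V, \<Phi>)"
  shows "orthogonal_LCWs A g V m (coord e \<Phi>)"
proof -
  obtain \<mu> f D where \<mu>: "smooth_fun_on A V \<mu>" "\<And>q. q \<in> V \<Longrightarrow> \<mu> q > 0"
    and block: "\<And>q. q \<in> V \<Longrightarrow> block_matrix e m (\<lambda>j. f j (tail_coords e m \<Phi> q)) (D (tail_coords e m \<Phi> q)) (\<mu> q *\<^sub>R g (V, \<Phi>) q)"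
    using form[unfolded conformal_block_form_def prod.case] by blast
  note ch = atlas_chart[OF VA]
  have opV: "openin X V" using is_chartD(1)[OF ch] by simp
  have opZ: "open (\<Phi> ` V)" using is_chartD(2)[OF ch] by simp
  define K where "K z = in_chart (V, \<Phi>) \<mu> z *\<^sub>R in_chart (V, \<Phi>) (g (V, \<Phi>)) z" for z
  have Ks: "smooth_on K (\<Phi> ` V)"
  proof -
    have "smooth_on (in_chart (V, \<Phi>) \<mu>) (\<Phi> ` V)" using \<mu>(1) VA by (auto simp: smooth_fun_on_def)
    then show ?thesis
      using smooth_metric[OF VA] opZ unfolding smooth_on_def K_def[abs_def] by (auto intro: Ck_on_scaleR)
  qed
  have KV: "K (\<Phi> q) = \<mu> q *\<^sub>R g (V, \<Phi>) q" if "q \<in> V" for q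
    using in_chart_apply[OF ch, of q \<mu>] in_chart_apply[OF ch, of q "g (V, \<Phi>)"] that by (simp add: K_def)
  have e_range: "\<exists>i\<in>{1..CARD('n)}. a = e i" for a
    using e by (auto simp: bij_betw_def)
  have e_inj: "e i = e j \<longleftrightarrow> i = j" if "i \<in> {1..CARD('n)}" "j \<in> {1..CARD('n)}" for i j
    using inj_on_eq_iff[OF bij_betw_imp_inj_on[OF e] that] .
  have K_tail: "K (\<Phi> q) = K (\<Phi> q')" if "q \<in> V" "q' \<in> V" "tail_coords e m \<Phi> q = tail_coords e m \<Phi> q'" for q q'
  proof -
    have "K (\<Phi> q) $ a $ b = K (\<Phi> q') $ a $ b" for a b
    proof -
      obtain i j where ij: "i \<in> {1..CARD('n)}" "j \<in> {1..CARD('n)}" "a = e i" "b = e j" using e_range by metis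
      show ?thesis
        using block[OF that(1)] block[OF that(2)] ij(1,2) unfolding that(3) block_matrix_def KV[OF that(1)] KV[OF that(2)] ij(3,4)
        by metis
    qed
    then show ?thesis by (simp add: vec_eq_iff)
  qed
  have K_axis: "\<exists>\<kappa>. K (\<Phi> q) *v axis (e i) 1 = \<kappa> *\<^sub>R axis (e i) 1" if q: "q \<in> V" and i: "i \<in> {1..m}" for q i
  proof
    have "(K (\<Phi> q) *v axis (e i) 1) $ a = (K (\<Phi> q) $ e i $ e i *\<^sub>R axis (e i) 1) $ a" for a
    proof -
      obtain j where j: "j \<in> {1..CARD('n)}" "a = e j" using e_range by metis
      have i': "i \<in> {1..CARD('n)}" using i m by auto
      have "(K (\<Phi> q) *v axis (e i) 1) $ a = K (\<Phi> q) $ a $ e i"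
        by (simp add: matrix_vector_mul_component inner_axis)
      moreover have "K (\<Phi> q) $ e j $ e i = 0" if "j \<noteq> i"
        using block[OF q] j(1) i' i that unfolding block_matrix_def KV[OF q] by auto
      moreover have "e j \<noteq> e i" if "j \<noteq> i"
        using e_inj[OF j(1) i'] that by simp
      ultimately show ?thesis by (cases "j = i") (auto simp: j(2) axis_def)
    qed
    then show "K (\<Phi> q) *v axis (e i) 1 = K (\<Phi> q) $ e i $ e i *\<^sub>R axis (e i) 1" by (simp add: vec_eq_iff)
  qed
  \<comment> \<open>The domain \<open>V\<close> has no prescribed shape, so points with equal tail
    coordinates are compared only on the part of an axis line near t = 0, which is enough for the
    derivative.\<close>
  have K_deriv: "FD K z (axis (e i) 1) = 0" if z: "z \<in> \<Phi> ` V" and i: "i \<in> {1..m}" for z i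
  proof -
    let ?l = "\<lambda>t::real. z + t *\<^sub>R axis (e i) 1"
    have l: "(?l has_derivative (\<lambda>t. t *\<^sub>R axis (e i) 1)) (at 0)"
      by (auto intro!: derivative_eq_intros)
    have "(K has_derivative FD K z) (at (?l 0))"
      using smooth_on_has_derivative[OF Ks z] by simp
    from has_derivative_compose[OF l this]
    have 1: "((\<lambda>t. K (?l t)) has_derivative (\<lambda>t. FD K z (t *\<^sub>R axis (e i) 1))) (at 0)" .
    have "open (?l -` (\<Phi> ` V))"
      by (rule open_vimage[OF opZ]) (auto intro!: continuous_intros)
    moreover have "0 \<in> ?l -` (\<Phi> ` V)" using z by simp
    moreover have "K z = K (?l t)" if t: "t \<in> ?l -` (\<Phi> ` V)" for t
    proof -
      obtain q q' where q: "q \<in> V" "z = \<Phi> q" "q' \<in> V" "?l t = \<Phi> q'" using z t by auto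
      have "tail_coords e m \<Phi> q = tail_coords e m \<Phi> q'"
        unfolding tail_coords_def coord_def
      proof (rule restrict_ext)
        fix k assume k: "k \<in> {m + 1..CARD('n)}"
        then have "e k \<noteq> e i" using e_inj[of k i] i m by simp
        then show "\<Phi> q $ e k = \<Phi> q' $ e k"
          unfolding q(2)[symmetric] q(4)[symmetric] by (simp add: axis_def)
      qed
      then show ?thesis using K_tail[OF q(1,3)] q(2,4) by simp
    qed
    ultimately have 2: "((\<lambda>t. K (?l t)) has_derivative (\<lambda>t. 0)) (at 0)"
      by (intro has_derivative_transform_within_open[OF has_derivative_const[of "K z"]]) auto
    from fun_cong[OF has_derivative_unique[OF 1 2], of 1] show ?thesis by simp
  qed

  \<comment> \<open>The coordinate functions in an arbitrary chart\<close>
  have main: "(\<chi> a. FD (in_chart c (coord e \<Phi> i)) x (axis a 1)) \<noteq> 0 \<and>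
       (\<exists>k. \<forall>v w. lie (local_metric.gradient_field (in_chart c (g c)) (in_chart c (coord e \<Phi> i))) (in_chart c (g c)) x v w =
          k * (v \<bullet> (in_chart c (g c) x *v w)))" (is ?lcw)
    and grad_orth: "j \<in> {1..m} \<Longrightarrow> i \<noteq> j \<Longrightarrow>
       local_metric.gradient (in_chart c (g c)) (in_chart c (coord e \<Phi> i)) x \<bullet>
        (in_chart c (g c) x *v local_metric.gradient (in_chart c (g c)) (in_chart c (coord e \<Phi> j)) x) = 0"
    and coord_smooth: "smooth_on (in_chart c (coord e \<Phi> i)) (snd c ` (fst c \<inter> V))"
    if c: "c \<in> A" and i: "i \<in> {1..m}" and x: "x \<in> snd c ` (fst c \<inter> V)" for c i x j
  proof -
    define S where "S = snd c ` (fst c \<inter> V)"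
    define G where "G = in_chart c (g c)"
    interpret local_metric S G unfolding S_def G_def by (rule local_metric_chart[OF c opV])
    define F where "F = in_chart c \<Phi>"
    define M where "M = in_chart c \<mu>"
    define h where "h i = in_chart c (coord e \<Phi> i)" for i
    have h: "h i = (\<lambda>x. F x $ e i)" for i by (simp add: h_def F_def in_chart_eq[abs_def] coord_def[abs_def])
    have Fs: "smooth_on F S"
      using smooth_transition[OF c VA] by (simp add: F_def S_def)
    have Ms: "smooth_on M S"
      using \<mu>(1) c by (auto simp: smooth_fun_on_def M_def S_def)
    have hs: "smooth_on (h i) S" for i
      using Fs open_S unfolding smooth_on_def h by (auto intro: Ck_on_vec_nth)
    have dF: "(F has_derivative FD F y) (at y)" if "y \<in> S" for y by (rule smooth_on_has_derivative[OF Fs that])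
    have dh: "FD (h i) y v = FD F y v $ e i" if "y \<in> S" for i y v
      unfolding h by (rule FD_eqI) (intro bounded_linear.has_derivative[OF bounded_linear_vec_nth] dF that)
    have FS: "F ` S \<subseteq> \<Phi> ` V"
      using in_chart_apply[OF atlas_chart[OF c], of _ \<Phi>] by (auto simp: F_def S_def)
    have MG: "M y > 0" "v \<bullet> ((M y *\<^sub>R G y) *v w) = FD F y v \<bullet> (K (F y) *v FD F y w)" if y: "y \<in> S" for y v w
    proof -
      obtain q where q: "q \<in> fst c" "q \<in> V" "y = snd c q" using y by (auto simp: S_def)
      have eqs: "M y = \<mu> q" "G y = g c q" "F y = \<Phi> q"
        unfolding M_def G_def F_def q(3) by (rule in_chart_apply[OF atlas_chart[OF c] q(1)])+
      show "M y > 0" using \<mu>(2) q(2) by (simp add: eqs)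
      have "v \<bullet> (g c q *v w) = FD F y v \<bullet> (g (V, \<Phi>) q *v FD F y w)"
        by (rule metric_transform[OF c VA q(1)]) (use q dF[OF y] in \<open>simp_all add: F_def\<close>)
      then show "v \<bullet> ((M y *\<^sub>R G y) *v w) = FD F y v \<bullet> (K (F y) *v FD F y w)"
        by (simp add: eqs KV[OF q(2)] scaleR_matrix_vector_assoc[symmetric])
    qed
    have injF: "v = 0" if y: "y \<in> S" and v: "FD F y v = 0" for y v
    proof (rule ccontr)
      assume "v \<noteq> 0"
      then have "v \<bullet> (G y *v v) > 0" by (rule pos_G[OF y])
      then show False using MG(2)[OF y, of v v] MG(1)[OF y] v by (simp add: scaleR_matrix_vector_assoc[symmetric])
    qed
    have surjF: "\<exists>v. FD F y v = u" if y: "y \<in> S" for y u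
    proof -
      have lin: "linear (FD F y)" using has_derivative_linear[OF dF[OF y]] .
      have "inj (FD F y)" using injF[OF y] lin by (simp add: linear_injective_0)
      from linear_injective_imp_surjective[OF lin this] show ?thesis by (metis surjD)
    qed
    have nz: "(\<chi> a. FD (h i) y (axis a 1)) \<noteq> 0" if y: "y \<in> S" for i y
    proof
      assume 0: "(\<chi> a. FD (h i) y (axis a 1)) = 0"
      obtain v where v: "FD F y v = axis (e i) 1" using surjF[OF y] by blast
      have "FD (h i) y v = 1" by (simp add: dh[OF y] v axis_def)
      moreover have "FD (h i) y v = 0"
        using linear_functional_inner[OF has_derivative_linear[OF smooth_on_has_derivative[OF hs[of i] y]], of v] 0 by simp
      ultimately show False by simp
    qed
    have N: "sqnorm_gradient (h i) y > 0" if "y \<in> S" for i y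
      by (rule sqnorm_gradient_pos[OF that hs nz[OF that]])
    \<comment> \<open>The image w of the gradient satisfies K w = M e_i, while the block form gives
      K e_i = \<kappa> e_i. Since K is positive definite, w = (M / \<kappa>) e_i; the factor is
      recovered as the squared length by applying the differential of the coordinate.\<close>
    have Fgrad: "FD F y (gradient (h i) y) = sqnorm_gradient (h i) y *\<^sub>R axis (e i) 1"
      if y: "y \<in> S" and i: "i \<in> {1..m}" for i y
    proof -
      define w where "w = FD F y (gradient (h i) y)"
      obtain q where q: "q \<in> V" "F y = \<Phi> q" using FS y by blast
      obtain \<kappa> where \<kappa>: "K (F y) *v axis (e i) 1 = \<kappa> *\<^sub>R axis (e i) 1" using K_axis[OF q(1) i] q(2) by auto
      have pos: "u \<bullet> (K (F y) *v u) > 0" if "u \<noteq> 0" for u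
      proof -
        obtain v where v: "FD F y v = u" using surjF[OF y] by blast
        have "v \<noteq> 0" using that v linear_0[OF has_derivative_linear[OF dF[OF y]]] by auto
        then have "M y * (v \<bullet> (G y *v v)) > 0" using MG(1)[OF y] pos_G[OF y] by simp
        then show ?thesis using MG(2)[OF y, of v v] v by (simp add: scaleR_matrix_vector_assoc[symmetric])
      qed
      have Kw: "u \<bullet> (K (F y) *v w) = M y * u $ e i" for u
      proof -
        obtain v where v: "FD F y v = u" using surjF[OF y] by blast
        have "u \<bullet> (K (F y) *v w) = M y * (v \<bullet> (G y *v gradient (h i) y))"
          using MG(2)[OF y, of v "gradient (h i) y"] by (simp add: v w_def scaleR_matrix_vector_assoc[symmetric])
        then show ?thesis by (simp add: form_gradient[OF y hs] dh[OF y] v)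
      qed
      have "\<kappa> > 0" using pos[of "axis (e i) 1"] \<kappa> by (simp add: axis_eq_0_iff inner_axis_axis)
      define u where "u = w - (M y / \<kappa>) *\<^sub>R axis (e i) 1"
      have "K (F y) *v u = K (F y) *v w - M y *\<^sub>R axis (e i) 1"
        using \<open>\<kappa> > 0\<close> by (simp add: u_def matrix_vector_mult_diff_distrib matrix_vector_mult_scaleR \<kappa>)
      then have "u \<bullet> (K (F y) *v u) = 0"
        by (simp add: inner_diff_right Kw inner_axis)
      then have "w = (M y / \<kappa>) *\<^sub>R axis (e i) 1" using pos[of u] by (cases "u = 0") (auto simp: u_def)
      moreover have "sqnorm_gradient (h i) y = w $ e i"
        by (simp add: sqnorm_gradient_eq[OF y hs] dh[OF y] w_def)
      ultimately show ?thesis by (simp add: w_def[symmetric] axis_def)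
    qed
    have Ffield: "FD F y (gradient_field (h i) y) = axis (e i) 1" if y: "y \<in> S" for y
      using Fgrad[OF y i] N[OF y, of i] linear_cmul[OF has_derivative_linear[OF dF[OF y]]]
      by (simp add: gradient_field_def)
    have xS: "x \<in> S" using x by (simp add: S_def)
    have sX: "smooth_on (gradient_field (h i)) S"
      by (rule smooth_gradient_field[OF hs]) (use N in \<open>auto simp: less_imp_neq[symmetric]\<close>)
    have MGs: "smooth_on (\<lambda>y. M y *\<^sub>R G y) S"
      using Ms smooth_G open_S unfolding smooth_on_def by (auto intro: Ck_on_scaleR)
    have Ys: "smooth_on (\<lambda>z. axis (e i) 1 :: real^'n) (\<Phi> ` V)"
      using opZ by (simp add: smooth_on_def Ck_on_const)
    have lie0: "lie (gradient_field (h i)) (\<lambda>y. M y *\<^sub>R G y) x v w = 0" for v w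
    proof -
      have "lie (gradient_field (h i)) (\<lambda>y. M y *\<^sub>R G y) x v w = lie (\<lambda>z. axis (e i) 1) K (F x) (FD F x v) (FD F x w)"
        by (rule lie_pullback[OF open_S xS opZ FS Fs Ks MGs sX Ys MG(2) Ffield])
      also have "\<dots> = 0"
        using K_deriv[OF _ i, of "F x"] FS xS by (auto simp: lie_def FD_const)
      finally show ?thesis .
    qed
    have "lie (gradient_field (h i)) G x v w = - (FD M x (gradient_field (h i) x) / M x) * (v \<bullet> (G x *v w))" for v w
      using lie_scale_metric[OF smooth_on_has_derivative[OF Ms xS] has_derivative_G[OF xS], of "gradient_field (h i)" v w]
        lie0[of v w] MG(1)[OF xS] by (simp add: field_simps)
    then show ?lcw
      using nz[OF xS] unfolding h_def G_def by blast
    show "smooth_on (in_chart c (coord e \<Phi> i)) (snd c ` (fst c \<inter> V))"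
      using hs by (simp add: h_def S_def)
    assume j: "j \<in> {1..m}" "i \<noteq> j"
    then have "e j \<noteq> e i" using e_inj[of j i] i m by simp
    then have "gradient (h i) x \<bullet> (G x *v gradient (h j) x) = 0"
      by (simp add: form_gradient[OF xS hs] dh[OF xS] Fgrad[OF xS i] axis_def)
    then show "local_metric.gradient (in_chart c (g c)) (in_chart c (coord e \<Phi> i)) x \<bullet>
        (in_chart c (g c) x *v local_metric.gradient (in_chart c (g c)) (in_chart c (coord e \<Phi> j)) x) = 0"
      unfolding h_def G_def .
  qed
  have smooth: "smooth_fun_on A V (coord e \<Phi> i)" if i: "i \<in> {1..m}" for i
    unfolding smooth_fun_on_def
  proof (rule ballI, clarify)
    fix U \<psi> assume c: "(U, \<psi>) \<in> A"
    \<comment> \<open>\<open>coord_smooth\<close> presupposes a point of the overlap, so charts that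
      do not meet \<open>V\<close> are treated apart.\<close>
    show "smooth_on (in_chart (U, \<psi>) (coord e \<Phi> i)) (\<psi> ` (U \<inter> V))"
    proof (cases "U \<inter> V = {}")
      case True
      then have "\<psi> ` (U \<inter> V) = {}" by simp
      moreover have "Ck_on k f' {}" for k and f' :: "real^'n \<Rightarrow> real" by (induction k arbitrary: f') auto
      ultimately show ?thesis by (simp add: smooth_on_def)
    next
      case False
      then show ?thesis using coord_smooth[OF c i] by auto
    qed
  qed
  show ?thesis
    unfolding orthogonal_LCWs_def
  proof (intro conjI ballI impI)
    fix i assume "i \<in> {1..m}"
    then show "LCW A g V (coord e \<Phi> i)"
      unfolding LCW_iff_conformal[OF opV] using smooth main by blast
  next
    fix i j c q assume i: "i \<in> {1..m}" and j: "j \<in> {1..m}" "i \<noteq> j" and c: "c \<in> A" and q: "q \<in> V \<inter> fst c"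
    have x: "snd c q \<in> snd c ` (fst c \<inter> V)" and qc: "q \<in> fst c" using q by auto
    show "g_inner g c q (grad g c (coord e \<Phi> i) q) (grad g c (coord e \<Phi> j) q) = 0"
      using grad_orth[OF c i x j] in_chart_apply[OF atlas_chart[OF c] qc, of "g c"]
      by (simp add: g_inner_def grad_eq[OF c qc])
  qed
qed

lemma orthogonal_LCWs_coordinates:
  assumes e: "bij_betw e {1..CARD('n)} UNIV" and m: "m \<ge> 1"
    and U: "openin X U" and p: "p \<in> U" and LCWs: "orthogonal_LCWs A g U m \<phi>"
  shows "\<exists>(V, \<Phi>)\<in>A. p \<in> V \<and> V \<subseteq> U \<and> (\<forall>i\<in>{1..m}. \<forall>q\<in>V. coord e \<Phi> i q = \<phi> i q) \<and>
    conformal_block_form A g e m (V, \<Phi>)"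
proof -

  \<comment> \<open>The weights and their commuting fields in one chart\<close>
  obtain c where c: "c \<in> A" and pc: "p \<in> fst c"
    using atlas_cover p openin_subset[OF U] by blast
  note ch = atlas_chart[OF c]
  define S where "S = snd c ` (fst c \<inter> U)"
  define G where "G = in_chart c (g c)"
  interpret local_metric S G unfolding S_def G_def by (rule local_metric_chart[OF c U])
  define x0 where "x0 = snd c p"
  have x0: "x0 \<in> S" using p pc by (auto simp: x0_def S_def)
  define F where "F i = in_chart c (\<phi> i)" for i
  define E where "E i = gradient_field (F i)" for i
  have lcw: "smooth_on (F i) S" "\<And>x. x \<in> S \<Longrightarrow> (\<chi> a. FD (F i) x (axis a 1)) \<noteq> 0"
    "\<And>x. x \<in> S \<Longrightarrow> \<exists>k. \<forall>v w. lie (E i) G x v w = k * (v \<bullet> (G x *v w))" if i: "i \<in> {1..m}" for i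
  proof -
    have "LCW A g U (\<phi> i)" using LCWs i by (simp add: orthogonal_LCWs_def)
    then have l: "smooth_fun_on A U (\<phi> i)" and l': "\<forall>x\<in>snd c ` (fst c \<inter> U). (\<chi> a. FD (in_chart c (\<phi> i)) x (axis a 1)) \<noteq> 0 \<and>
       (\<exists>k. \<forall>v w. lie (local_metric.gradient_field (in_chart c (g c)) (in_chart c (\<phi> i))) (in_chart c (g c)) x v w =
          k * (v \<bullet> (in_chart c (g c) x *v w)))"
      using c unfolding LCW_iff_conformal[OF U] by auto
    show "smooth_on (F i) S" using l c by (auto simp: smooth_fun_on_def F_def S_def)
    show "(\<chi> a. FD (F i) x (axis a 1)) \<noteq> 0" if "x \<in> S" for x
      using l' that unfolding F_def S_def by blast
    show "\<exists>k. \<forall>v w. lie (E i) G x v w = k * (v \<bullet> (G x *v w))" if "x \<in> S" for x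
      using l' that unfolding F_def S_def E_def G_def by blast
  qed
  note Fs = lcw(1)
  have N: "sqnorm_gradient (F i) x > 0" if "i \<in> {1..m}" "x \<in> S" for i x
    by (rule sqnorm_gradient_pos[OF that(2) Fs[OF that(1)] lcw(2)[OF that]])
  have N0: "sqnorm_gradient (F i) x \<noteq> 0" if "i \<in> {1..m}" "x \<in> S" for i x
    using N[OF that] by simp
  have Es: "smooth_on (E i) S" if i: "i \<in> {1..m}" for i
    unfolding E_def by (rule smooth_gradient_field[OF Fs[OF i] N0[OF i]])
  have orth: "FD (F i) x (E j x) = 0" if i: "i \<in> {1..m}" and j: "j \<in> {1..m}" "i \<noteq> j" and x: "x \<in> S" for i j x
  proof -
    obtain q where q: "q \<in> fst c" "q \<in> U" "x = snd c q" using x by (auto simp: S_def)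
    have "g_inner g c q (grad g c (\<phi> j) q) (grad g c (\<phi> i) q) = 0"
      using LCWs i j c q by (auto simp: orthogonal_LCWs_def)
    then have "gradient (F j) x \<bullet> (G x *v gradient (F i) x) = 0"
      using in_chart_apply[OF ch q(1), of "g c"] by (simp add: g_inner_def grad_eq[OF c q(1)] F_def G_def q(3))
    then have "FD (F i) x (gradient (F j) x) = 0" by (simp add: form_gradient[OF x Fs[OF i]])
    then show ?thesis
      using linear_cmul[OF has_derivative_linear[OF smooth_on_has_derivative[OF Fs[OF i] x]]]
      by (simp add: E_def gradient_field_def)
  qed
  have dual: "FD (F i) x (E j x) = (if i = j then 1 else 0)" if "i \<in> {1..m}" "j \<in> {1..m}" "x \<in> S" for i j x
    using orth[OF that(1,2) _ that(3)] FD_gradient_field[OF that(3) Fs[OF that(1)] N0[OF that(1,3)]]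
    by (auto simp: E_def)
  have comm: "FD (E i) x (E j x) = FD (E j) x (E i x)" if i: "i \<in> {1..m}" and j: "j \<in> {1..m}" and x: "x \<in> S" for i j x
  proof (cases "i = j")
    case False
    show ?thesis unfolding E_def
      by (rule gradient_fields_commute[OF x Fs[OF j] Fs[OF i] N0[OF j] N0[OF i] _ _ lcw(3)[OF j x, unfolded E_def]
            lcw(3)[OF i x, unfolded E_def]])
        (use orth[OF i j False] orth[OF j i False[symmetric]] in \<open>auto simp: E_def\<close>)
  qed simp
  \<comment> \<open>The weights give m dual pairs of covectors and vectors at \<open>x0\<close>. The
    bound puts {1..m} inside the range on which \<open>e\<close> is injective.\<close>
  have mn: "m \<le> CARD('n)"
  proof -
    have "card {1..m} \<le> DIM(real^'n)"
    proof (rule dual_system_card)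
      show "(\<chi> a. FD (F i) x0 (axis a 1)) \<bullet> E j x0 = (if i = j then 1 else 0)" if "i \<in> {1..m}" "j \<in> {1..m}" for i j
        unfolding dual[OF that x0, symmetric]
        by (rule linear_functional_inner[OF has_derivative_linear[OF smooth_on_has_derivative[OF Fs[OF that(1)] x0]]])
    qed simp
    then show ?thesis by simp
  qed
  \<comment> \<open>Weights are numbered by natural numbers and coordinates by the type
    \<open>'n\<close>; \<open>idx\<close> translates back, and \<open>J\<close> is the set of
    coordinates reserved for the weights.\<close>
  define idx where "idx = inv_into {1..CARD('n)} e"
  have idx: "idx (e i) = i" if "i \<in> {1..CARD('n)}" for i
    using inv_into_f_f[OF bij_betw_imp_inj_on[OF e] that] by (simp add: idx_def)
  have e_range: "\<exists>i\<in>{1..CARD('n)}. a = e i" for a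
    using e by (auto simp: bij_betw_def)
  define J where "J = e ` {1..m}"
  have idxJ: "idx k \<in> {1..m}" "e (idx k) = k" if "k \<in> J" for k
    using that idx mn by (auto simp: J_def)
  have idx_eq: "idx j = idx k \<longleftrightarrow> j = k" if "j \<in> J" "k \<in> J" for j k
    using idxJ(2) that by metis
  obtain z0 r \<Psi> \<Theta> where r: "r > 0" and T: "x0 \<in> \<Psi> ` ball z0 r" "\<Psi> ` ball z0 r \<subseteq> S" "open (\<Psi> ` ball z0 r)"
    and hom: "homeomorphism (ball z0 r) (\<Psi> ` ball z0 r) \<Psi> \<Theta>"
    and \<Psi>s: "smooth_on \<Psi> (ball z0 r)" and \<Theta>s: "smooth_on \<Theta> (\<Psi> ` ball z0 r)"
    and F\<Psi>: "\<And>z k. z \<in> ball z0 r \<Longrightarrow> k \<in> J \<Longrightarrow> F (idx k) (\<Psi> z) = z $ k"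
    and \<Psi>E: "\<And>z k. z \<in> ball z0 r \<Longrightarrow> k \<in> J \<Longrightarrow> FD \<Psi> z (axis k 1) = E (idx k) (\<Psi> z)"
  proof (rule straightening_commuting_fields[OF open_S x0, where J=J and X="\<lambda>k. E (idx k)" and f="\<lambda>k. F (idx k)"])
    show "smooth_on (E (idx k)) S" "smooth_on (F (idx k)) S" if "k \<in> J" for k
      using Es Fs idxJ(1)[OF that] by auto
    show "FD (F (idx j)) x (E (idx k) x) = (if j = k then 1 else 0)" if "j \<in> J" "k \<in> J" "x \<in> S" for j k x
      using dual[OF idxJ(1)[OF that(1)] idxJ(1)[OF that(2)] that(3)] idx_eq[OF that(1,2)] by simp
    show "FD (E (idx j)) x (E (idx k) x) = FD (E (idx k)) x (E (idx j) x)" if "j \<in> J" "k \<in> J" "x \<in> S" for j k x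
      by (rule comm[OF idxJ(1)[OF that(1)] idxJ(1)[OF that(2)] that(3)])
  qed (rule that)

  \<comment> \<open>The straightened coordinates as a chart of the atlas\<close>
  define Z where "Z = ball z0 r"
  define V where "V = {q \<in> fst c. snd c q \<in> \<Psi> ` Z}"
  define \<Phi> where "\<Phi> = (\<lambda>q. \<Theta> (snd c q))"
  have Tc: "\<Psi> ` Z \<subseteq> snd c ` fst c" using T(2) by (auto simp: S_def Z_def)
  note comp = compose_chart[OF c T(3)[folded Z_def] Tc _ hom[folded Z_def] \<Psi>s[folded Z_def] \<Theta>s[folded Z_def] V_def \<Phi>_def]
  have opZ: "open Z" by (simp add: Z_def)
  have VA: "(V, \<Phi>) \<in> A" and opV: "openin X V" and imgV: "\<Phi> ` V = Z" using comp(1-3)[OF opZ] by auto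
  have inV: "in_chart (V, \<Phi>) (snd c) z = \<Psi> z" if "z \<in> Z" for z
  proof -
    have "\<Psi> z \<in> snd c ` fst c" using Tc that by blast
    then obtain q where "q \<in> fst c" "\<Psi> z = snd c q" by blast
    then show ?thesis
      using comp(4)[OF opZ that, of "snd c"] in_chart_apply[OF ch, of q "snd c"] by simp
  qed
  have \<Psi>S: "\<Psi> z \<in> S" if "z \<in> Z" for z using T(2) that by (auto simp: Z_def)
  have \<Psi>\<Phi>: "\<Psi> (\<Phi> q) = snd c q" "\<Phi> q \<in> Z" "q \<in> fst c" if "q \<in> V" for q
    using that hom imgV by (auto simp: homeomorphism_def \<Phi>_def V_def Z_def)
  have VU: "V \<subseteq> U"
  proof
    fix q assume q: "q \<in> V"
    have "snd c q \<in> S" using \<Psi>S[OF \<Psi>\<Phi>(2)[OF q]] \<Psi>\<Phi>(1)[OF q] by simp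
    then obtain q' where "q' \<in> fst c" "q' \<in> U" "snd c q = snd c q'" by (auto simp: S_def)
    then show "q \<in> U" using is_chartD(3)[OF ch] \<Psi>\<Phi>(3)[OF q] by (auto dest: inj_onD)
  qed
  have d\<Psi>: "(\<Psi> has_derivative FD \<Psi> z) (at z)" if "z \<in> Z" for z
    by (rule smooth_on_has_derivative[OF \<Psi>s]) (use that in \<open>simp add: Z_def\<close>)
  let ?N = "sqnorm_gradient (F 1)"
  have one: "1 \<in> {1..m}" using m by simp
  \<comment> \<open>The metric in the new coordinates, rescaled by the squared gradient length of
    the first weight.\<close>
  define H where "H z = ?N (\<Psi> z) *\<^sub>R in_chart (V, \<Phi>) (g (V, \<Phi>)) z" for z
  have gV: "v \<bullet> (g (V, \<Phi>) q *v w) = FD \<Psi> (\<Phi> q) v \<bullet> (G (snd c q) *v FD \<Psi> (\<Phi> q) w)" if q: "q \<in> V" for q v w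
  proof -
    have "(in_chart (V, \<Phi>) (snd c) has_derivative FD \<Psi> (\<Phi> q)) (at (\<Phi> q))"
      by (rule has_derivative_transform_within_open[OF d\<Psi>[OF \<Psi>\<Phi>(2)[OF q]] opZ \<Psi>\<Phi>(2)[OF q]]) (simp add: inV)
    then have "v \<bullet> (g (V, \<Phi>) q *v w) = FD \<Psi> (\<Phi> q) v \<bullet> (g c q *v FD \<Psi> (\<Phi> q) w)"
      by (intro metric_transform[OF VA c]) (use q \<Psi>\<Phi>(3)[OF q] in simp_all)
    then show ?thesis using in_chart_apply[OF ch \<Psi>\<Phi>(3)[OF q], of "g c"] by (simp add: G_def)
  qed
  have HV: "H (\<Phi> q) = ?N (snd c q) *\<^sub>R g (V, \<Phi>) q" if q: "q \<in> V" for q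
    using in_chart_apply[OF atlas_chart[OF VA], of q "g (V, \<Phi>)"] q \<Psi>\<Phi>(1)[OF q] by (simp add: H_def)
  have Hform: "v \<bullet> (H z *v w) = FD \<Psi> z v \<bullet> ((?N (\<Psi> z) *\<^sub>R G (\<Psi> z)) *v FD \<Psi> z w)" if z: "z \<in> Z" for z v w
  proof -
    obtain q where q: "q \<in> V" "z = \<Phi> q" using imgV z by blast
    show ?thesis using gV[OF q(1), of v w] by (simp add: q(2) HV[OF q(1)] \<Psi>\<Phi>(1)[OF q(1)] scaleR_matrix_vector_assoc[symmetric])
  qed
  have Ns: "smooth_on ?N S" by (rule smooth_sqnorm_gradient[OF Fs[OF one]])
  have Hs: "smooth_on H Z"
  proof -
    have "smooth_on (\<lambda>z. ?N (\<Psi> z)) Z"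
      by (rule smooth_on_compose[OF opZ open_S _ \<Psi>s[folded Z_def] Ns]) (use \<Psi>S in auto)
    moreover have "smooth_on (in_chart (V, \<Phi>) (g (V, \<Phi>))) Z"
      using smooth_metric[OF VA] imgV by simp
    ultimately show ?thesis using opZ unfolding smooth_on_def H_def[abs_def] by (auto intro: Ck_on_scaleR)
  qed
  have NGs: "smooth_on (\<lambda>y. ?N y *\<^sub>R G y) S"
    using Ns smooth_G open_S unfolding smooth_on_def by (auto intro: Ck_on_scaleR)
  \<comment> \<open>The Lie derivative along a constant field is the plain directional derivative.
    Naturality identifies it with the Lie derivative along \<open>E (idx k)\<close> in the old
    chart, where \<open>lie_normalised_metric\<close> applies.\<close>
  have H_deriv: "FD H z (axis k 1) = 0" if z: "z \<in> Z" and k: "k \<in> J" for z k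
  proof -
    have i: "idx k \<in> {1..m}" using idxJ(1)[OF k] .
    have xS: "\<Psi> z \<in> S" using \<Psi>S[OF z] .
    have cs: "smooth_on (\<lambda>z. axis k 1 :: real^'n) Z"
      using opZ by (simp add: smooth_on_def Ck_on_const)
    have "v \<bullet> (FD H z (axis k 1) *v w) = 0" for v w
    proof -
      obtain \<kappa> where \<kappa>: "\<And>v w. lie (E (idx k)) G (\<Psi> z) v w = \<kappa> * (v \<bullet> (G (\<Psi> z) *v w))"
        using lcw(3)[OF i xS] by blast
      have "v \<bullet> (FD H z (axis k 1) *v w) = lie (\<lambda>z. axis k 1) H z v w"
        by (simp add: lie_def FD_const)
      also have "\<dots> = lie (E (idx k)) (\<lambda>y. ?N y *\<^sub>R G y) (\<Psi> z) (FD \<Psi> z v) (FD \<Psi> z w)"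
        by (rule lie_pullback[OF opZ z open_S _ \<Psi>s[folded Z_def] NGs Hs cs Es[OF i] Hform])
          (use \<Psi>S \<Psi>E k in \<open>auto simp: Z_def\<close>)
      also have "\<dots> = 0"
        by (rule lie_normalised_metric[OF xS Fs[OF one] N0[OF one] _ \<kappa>])
          (use comm[OF i one xS] in \<open>simp_all add: E_def\<close>)
      finally show ?thesis .
    qed
    then have "FD H z (axis k 1) *v w = 0" for w
      using inner_eq_zero_iff by blast
    then show ?thesis by (metis matrix_eq matrix_vector_mult_0)
  qed
  \<comment> \<open>\<open>Z\<close> is a ball, so the segment between the two points stays in it;
    its direction is a combination of axes in \<open>J\<close>, along which \<open>H\<close> has
    derivative 0.\<close>
  have H_const: "H z = H z'" if z: "z \<in> Z" "z' \<in> Z" and eq: "\<And>k. k \<notin> J \<Longrightarrow> z $ k = z' $ k" for z z'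
  proof -
    define d where "d = z' - z"
    have inZ: "z + t *\<^sub>R d \<in> Z" if "t \<in> {0..1}" for t
      using convexD_alt[OF convex_ball z[unfolded Z_def], of t] that by (simp add: Z_def d_def algebra_simps)
    have "d = (\<Sum>k\<in>UNIV. d $ k *\<^sub>R axis k 1)"
      using basis_expansion[of d] by (simp add: scalar_mult_eq_scaleR)
    also have "\<dots> = (\<Sum>k\<in>J. d $ k *\<^sub>R axis k 1)"
      by (rule sum.mono_neutral_right) (auto simp: d_def eq)
    finally have dJ: "d = (\<Sum>k\<in>J. d $ k *\<^sub>R axis k 1)" .
    have Hd: "FD H y d = 0" if "y \<in> Z" for y
    proof -
      have lin: "linear (FD H y)" using has_derivative_linear[OF smooth_on_has_derivative[OF Hs that]] .
      have "FD H y (\<Sum>k\<in>J. d $ k *\<^sub>R axis k 1) = (\<Sum>k\<in>J. d $ k *\<^sub>R FD H y (axis k 1))"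
        by (simp add: linear_sum[OF lin] linear_cmul[OF lin])
      then show ?thesis using H_deriv[OF that] dJ by simp
    qed
    have "((\<lambda>t. H (z + t *\<^sub>R d)) has_derivative (\<lambda>t. 0)) (at t within {0..1})" if t: "t \<in> {0..1}" for t
    proof -
      have "((\<lambda>t. z + t *\<^sub>R d) has_derivative (\<lambda>t. t *\<^sub>R d)) (at t within {0..1})"
        by (auto intro!: derivative_eq_intros)
      from has_derivative_compose[OF this smooth_on_has_derivative[OF Hs inZ[OF t]]]
      show ?thesis
        using Hd[OF inZ[OF t]] linear_cmul[OF has_derivative_linear[OF smooth_on_has_derivative[OF Hs inZ[OF t]]]] by simp
    qed
    from has_derivative_zero_constant[OF convex_real_interval(5)[of 0 1] this]
    obtain a where "\<And>t. t \<in> {0..1} \<Longrightarrow> H (z + t *\<^sub>R d) = a" by blast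
    from this[of 0] this[of 1] show ?thesis by (simp add: d_def)
  qed
  \<comment> \<open>Representative of all points with tail \<tau>: its components in
    \<open>J\<close> are those of the centre \<open>z0\<close>. Replacing components by those of the
    centre does not increase the distance to it, so the representative remains in the ball.
    Evaluating \<open>H\<close> there turns its entries into functions of the tail alone.\<close>
  define zc where "zc \<tau> = (\<chi> k. if k \<in> J then z0 $ k else \<tau> (idx k))" for \<tau> :: "nat \<Rightarrow> real"
  have notJ: "idx k \<in> {m + 1..CARD('n)}" "e (idx k) = k" if "k \<notin> J" for k
  proof -
    obtain i where i: "i \<in> {1..CARD('n)}" "k = e i" using e_range by blast
    then show "idx k \<in> {m + 1..CARD('n)}" "e (idx k) = k" using that idx[OF i(1)] by (auto simp: J_def)
  qed
  have H_tail: "H (\<Phi> q) = H (zc (tail_coords e m \<Phi> q))" if q: "q \<in> V" for q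
  proof (rule H_const)
    show "\<Phi> q \<in> Z" using \<Psi>\<Phi>(2)[OF q] .
    show "\<Phi> q $ k = zc (tail_coords e m \<Phi> q) $ k" if "k \<notin> J" for k
      using that notJ[OF that] by (simp add: zc_def tail_coords_def coord_def)
    have "norm (zc (tail_coords e m \<Phi> q) - z0) \<le> norm (\<Phi> q - z0)"
    proof (rule norm_le_componentwise_cart)
      fix k
      show "norm ((zc (tail_coords e m \<Phi> q) - z0) $ k) \<le> norm ((\<Phi> q - z0) $ k)"
      proof (cases "k \<in> J")
        case False
        then show ?thesis using notJ[OF False] by (simp add: zc_def tail_coords_def coord_def)
      qed (simp add: zc_def)
    qed
    then show "zc (tail_coords e m \<Phi> q) \<in> Z"
      using \<Psi>\<Phi>(2)[OF q] by (simp add: Z_def dist_norm norm_minus_commute)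
  qed
  have H_entry: "H z $ a $ b = axis a 1 \<bullet> (H z *v axis b 1)" for z a b
    by (simp add: matrix_vector_mul_component inner_axis inner_axis')
  have H_sym: "H z $ a $ b = H z $ b $ a" if "z \<in> Z" for z a b
    unfolding H_entry Hform[OF that]
    using form_sym[OF \<Psi>S[OF that]] by (simp add: scaleR_matrix_vector_assoc[symmetric])
  \<comment> \<open>The form dual to \<open>E (idx k)\<close> is a multiple of the differential of
    its weight, and that weight is the coordinate k. So column k is diagonal, with entry |grad
    \<phi>_1|^2 / |grad \<phi>_(idx k)|^2.\<close>
  have H_col: "H z $ a $ k = (if a = k then ?N (\<Psi> z) * inverse (sqnorm_gradient (F (idx k)) (\<Psi> z)) else 0)"
    if z: "z \<in> Z" and k: "k \<in> J" for z a k
  proof -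
    have z': "z \<in> ball z0 r" using z by (simp add: Z_def)
    have i: "idx k \<in> {1..m}" using idxJ(1)[OF k] .
    have "((\<lambda>z. F (idx k) (\<Psi> z)) has_derivative (\<lambda>v. FD (F (idx k)) (\<Psi> z) (FD \<Psi> z v))) (at z)"
      by (rule has_derivative_compose[OF d\<Psi>[OF z] smooth_on_has_derivative[OF Fs[OF i] \<Psi>S[OF z]]])
    moreover have "((\<lambda>z. F (idx k) (\<Psi> z)) has_derivative (\<lambda>v. v $ k)) (at z)"
      by (rule has_derivative_transform_within_open[OF bounded_linear_imp_has_derivative[OF bounded_linear_vec_nth] opZ z])
        (simp add: F\<Psi> k Z_def)
    ultimately have "FD (F (idx k)) (\<Psi> z) (FD \<Psi> z v) = v $ k" for v
      using has_derivative_unique by metis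
    then have "H z $ a $ k = ?N (\<Psi> z) * (inverse (sqnorm_gradient (F (idx k)) (\<Psi> z)) * axis a 1 $ k)"
      unfolding H_entry Hform[OF z] \<Psi>E[OF z' k]
      by (simp add: scaleR_matrix_vector_assoc[symmetric] E_def form_gradient_field[OF \<Psi>S[OF z] Fs[OF i]])
    then show ?thesis by (simp add: axis_def)
  qed
  have "conformal_block_form A g e m (V, \<Phi>)"
    unfolding conformal_block_form_def prod.case
  proof (intro exI conjI ballI)
    show "smooth_fun_on A V (\<lambda>q. ?N (snd c q))"
      by (rule smooth_fun_on_comp_chart[OF c opV _ Ns open_S]) (use \<Psi>\<Phi> \<Psi>S in \<open>auto simp flip: \<Psi>\<Phi>(1)\<close>)
    show "0 < ?N (snd c q)" if q: "q \<in> V" for q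
      using N[OF one \<Psi>S[OF \<Psi>\<Phi>(2)[OF q]]] \<Psi>\<Phi>(1)[OF q] by simp
    fix q assume q: "q \<in> V"
    define \<tau> where "\<tau> = tail_coords e m \<Phi> q"
    have z: "\<Phi> q \<in> Z" using \<Psi>\<Phi>(2)[OF q] .
    have inJ: "e i \<in> J" "idx (e i) = i" if "i \<in> {1..m}" for i using that idx mn by (auto simp: J_def)
    have e_inj: "e i = e j \<longleftrightarrow> i = j" if "i \<in> {1..CARD('n)}" "j \<in> {1..CARD('n)}" for i j
      using inj_on_eq_iff[OF bij_betw_imp_inj_on[OF e] that] .
    have entry: "H (\<Phi> q) $ e i $ e j = (if m < i \<and> m < j then H (zc \<tau>) $ e i $ e j
         else if i \<noteq> j then 0 else if i = 1 then 1 else H (zc \<tau>) $ e i $ e i)"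
      if ij: "i \<in> {1..CARD('n)}" "j \<in> {1..CARD('n)}" for i j
    proof -
      have t: "H (zc \<tau>) = H (\<Phi> q)" using H_tail[OF q] by (simp add: \<tau>_def)
      \<comment> \<open>Outside the tail block one of the two indices is at most m:
        \<open>H_col\<close> covers the columns and, by symmetry, the rows. The entry for i = j = 1
        is a quotient of equal nonzero numbers.\<close>
      consider "m < i \<and> m < j" | "j \<in> {1..m}" | "i \<in> {1..m}" using ij by force
      then show ?thesis
      proof cases
        case 2
        then show ?thesis
          using H_col[OF z inJ(1)[OF 2], of "e i"] e_inj[OF ij] N0[OF one \<Psi>S[OF z]] inJ(2)[OF 2] by (auto simp: t)
      next
        case 3
        then show ?thesis
          using trans[OF H_sym[OF z, of "e i" "e j"] H_col[OF z inJ(1)[OF 3], of "e j"]]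
            e_inj[OF ij(2,1)] N0[OF one \<Psi>S[OF z]] inJ(2)[OF 3] unfolding t by (cases "i = j") simp_all
      qed (simp add: t)
    qed
    show "block_matrix e m (\<lambda>j. (\<lambda>j \<tau>. H (zc \<tau>) $ e j $ e j) j (tail_coords e m \<Phi> q))
       ((\<lambda>\<tau> i j. H (zc \<tau>) $ e i $ e j) (tail_coords e m \<Phi> q)) (?N (snd c q) *\<^sub>R g (V, \<Phi>) q)"
      unfolding block_matrix_def HV[OF q, symmetric] \<tau>_def[symmetric]
    proof (intro conjI ballI)
      show "H (zc \<tau>) $ e i $ e j = H (zc \<tau>) $ e j $ e i" for i j
        using H_sym[OF z] unfolding H_tail[OF q] \<tau>_def .
    qed (rule entry)
  qed
  moreover have "p \<in> V" using pc T(1) by (simp add: V_def Z_def x0_def)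
  moreover have "coord e \<Phi> i q = \<phi> i q" if i: "i \<in> {1..m}" and q: "q \<in> V" for i q
  proof -
    have k: "e i \<in> J" "idx (e i) = i" using i idx mn by (auto simp: J_def)
    have "F i (snd c q) = \<Phi> q $ e i"
      using F\<Psi>[OF _ k(1), of "\<Phi> q"] \<Psi>\<Phi>[OF q] k(2) by (simp add: Z_def)
    then show ?thesis
      using in_chart_apply[OF ch \<Psi>\<Phi>(3)[OF q], of "\<phi> i"] by (simp add: F_def coord_def)
  qed
  ultimately show ?thesis using VA VU by blast
qed

end

theorem theorem1p3:
  fixes X :: "'a topology"
    and A :: "('a, 'n::finite) chart set"
    and g :: "('a, 'n) metric"
    and e :: "nat \<Rightarrow> 'n"
    and m :: nat
  assumes "riemannian_manifold X A g"
    and "CARD('n) \<ge> 3"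
    and "bij_betw e {1..CARD('n)} UNIV"
    and "m \<ge> 1"
  shows "(\<forall>p U (\<phi> :: nat \<Rightarrow> 'a \<Rightarrow> real).
            openin X U \<and> p \<in> U \<and> orthogonal_LCWs A g U m \<phi> \<and>
            (\<forall>i\<in>{1..m}. \<forall>j\<in>{1..m}. i \<noteq> j \<longrightarrow> (\<exists>q\<in>U. \<phi> i q \<noteq> \<phi> j q)) \<longrightarrow>
            (\<exists>(V, \<Phi>)\<in>A. p \<in> V \<and> V \<subseteq> U \<and>
               (\<forall>i\<in>{1..m}. \<forall>q\<in>V. coord e \<Phi> i q = \<phi> i q) \<and>
               conformal_block_form A g e m (V, \<Phi>)))
       \<and> (\<forall>(V, \<Phi>)\<in>A. m \<le> CARD('n) \<and> conformal_block_form A g e m (V, \<Phi>) \<longrightarrow>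
            orthogonal_LCWs A g V m (coord e \<Phi>))"
proof -
  interpret riemannian X A g using assms(1) by unfold_locales
  show ?thesis
    using orthogonal_LCWs_coordinates[OF assms(3,4)] block_form_orthogonal_LCWs[OF assms(3)] by blast
qed

end
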